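(* Let $\Gamma$ be a finitely generated, infinite group, let $H$ be a subgroup of $\Gamma$ and let $\mathcal G$ be a Cayley graph of $\Gamma$ with respect to a finite symmetric generating set. Then the pair $(\Gamma,H)$ has relative property (T) if and only if there exists a threshold $\alpha^*<1$ such that for every $\Gamma$-invariant bond percolation $\mathbb P$ on $\mathcal G$, $\mathbb E[\deg_\omega(o)]>\alpha^*\deg(o)$ implies that $\tau$ is bounded away from zero on each left $H$-coset, i.e. for every $g\in\Gamma$ $$\inf_{h\in H}\tau(g,gh)>0.$$
   Context: Right Cayley graph: vertex set $\Gamma$, edge set $E=\{[g,gs]: g\in\Gamma, s\in S\}$ with $S$ a finite symmetric generating set; $o$ is the identity, $\deg(o)$ its degree. $\Gamma$ acts by left multiplication. A $\Gamma$-invariant bond percolation is a probability measure $\mathbb P$ (expectation $\mathbb E$) on subsets $\omega\subset E$ invariant under $\Gamma$; clusters are connected components of $(\Gamma,\omega)$; $\deg_\omega(o)$ is the degree of $o$ in $\omega$; $\tau(g,h)=\mathbb P[g\leftrightarrow h]$ is the probability that $g,h$ are in the same cluster. The pair $(\Gamma,H)$ has relative property (T) if every unitary representation $\pi$ of $\Gamma$ on a Hilbert space which almost has invariant vectors (for every $\varepsilon>0$ and finite $K\subset\Gamma$ there is a unit vector $\varphi$ with $\sup_{s\in K}\|\pi(s)\varphi-\varphi\|<\varepsilon$) has a non-zero $H$-invariant vector. *)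

theory Defs
  imports
    "HOL-Algebra.Generated_Groups"
    "HOL-Algebra.Group_Action"
    "HOL-Algebra.Module"
    "HOL-Algebra.Algebraic_Closure_Type"
    "HOL-Library.Equipollence"
    "HOL-Probability.Probability"
begin

section \<open>Complex Hilbert spaces with explicit carrier\<close>

text \<open>
  Relative property (T) quantifies over all Hilbert spaces inside a formula, so a type-class
  rendering (one Hilbert space per type) is not available.  A Hilbert space is therefore a complex
  vector space in the style of HOL-Algebra (a module over the field of complex numbers whose
  carrier is a subset of an ambient type) with an inner product.  As usual for modules in
  HOL-Algebra, the inherited ring fields for multiplication and unit of the module are unused.
\<close>

record 'v inner_module = "(complex, 'v) module" +
  ip :: "'v \<Rightarrow> 'v \<Rightarrow> complex"

definition hnorm :: "('v, 'm) inner_module_scheme \<Rightarrow> 'v \<Rightarrow> real" where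
  "hnorm V x = sqrt (Re (ip V x x))"

text \<open>The inner product is linear in the second argument; by conjugate symmetry it is
  conjugate-linear in the first one, and \<open>ip V x x\<close> is real.\<close>

locale complex_hilbert_space =
  module "ring_of_type_algebra :: complex ring" V
  for V :: "('v, 'm) inner_module_scheme" (structure) +
  assumes ip_add: "\<lbrakk>x \<in> carrier V; y \<in> carrier V; z \<in> carrier V\<rbrakk>
      \<Longrightarrow> ip V x (y \<oplus>\<^bsub>V\<^esub> z) = ip V x y + ip V x z"
    and ip_smult: "\<lbrakk>x \<in> carrier V; y \<in> carrier V\<rbrakk> \<Longrightarrow> ip V x (c \<odot>\<^bsub>V\<^esub> y) = c * ip V x y"
    and ip_commute: "\<lbrakk>x \<in> carrier V; y \<in> carrier V\<rbrakk> \<Longrightarrow> ip V y x = cnj (ip V x y)"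
    and ip_pos: "\<lbrakk>x \<in> carrier V; x \<noteq> \<zero>\<^bsub>V\<^esub>\<rbrakk> \<Longrightarrow> Re (ip V x x) > 0"
    and complete: "\<lbrakk>\<And>n :: nat. xs n \<in> carrier V;
        \<And>e :: real. e > 0 \<Longrightarrow> \<exists>N. \<forall>m\<ge>N. \<forall>n\<ge>N. hnorm V (xs m \<ominus>\<^bsub>V\<^esub> xs n) < e\<rbrakk>
      \<Longrightarrow> \<exists>x\<in>carrier V. (\<lambda>n. hnorm V (xs n \<ominus>\<^bsub>V\<^esub> x)) \<longlonglongrightarrow> 0"


section \<open>Unitary representations and relative property (T)\<close>

definition unitary_operator ::
  "('v, 'm) inner_module_scheme \<Rightarrow> ('v \<Rightarrow> 'v) \<Rightarrow> bool" where
  "unitary_operator V U \<longleftrightarrow>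
     bij_betw U (carrier V) (carrier V) \<and>
     (\<forall>x\<in>carrier V. \<forall>y\<in>carrier V. U (x \<oplus>\<^bsub>V\<^esub> y) = U x \<oplus>\<^bsub>V\<^esub> U y) \<and>
     (\<forall>c. \<forall>x\<in>carrier V. U (c \<odot>\<^bsub>V\<^esub> x) = c \<odot>\<^bsub>V\<^esub> U x) \<and>
     (\<forall>x\<in>carrier V. \<forall>y\<in>carrier V. ip V (U x) (U y) = ip V x y)"

definition unitary_representation ::
  "('g, 'b) monoid_scheme \<Rightarrow> ('v, 'm) inner_module_scheme \<Rightarrow> ('g \<Rightarrow> 'v \<Rightarrow> 'v) \<Rightarrow> bool" where
  "unitary_representation G V \<pi> \<longleftrightarrow>
     complex_hilbert_space V \<and> group_action G (carrier V) \<pi> \<and>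
     (\<forall>g\<in>carrier G. unitary_operator V (\<pi> g))"

definition almost_invariant_vectors ::
  "('g, 'b) monoid_scheme \<Rightarrow> ('v, 'm) inner_module_scheme \<Rightarrow> ('g \<Rightarrow> 'v \<Rightarrow> 'v) \<Rightarrow> bool" where
  "almost_invariant_vectors G V \<pi> \<longleftrightarrow>
     (\<forall>\<epsilon>>0. \<forall>K. finite K \<and> K \<subseteq> carrier G \<longrightarrow>
        (\<exists>\<phi>\<in>carrier V. hnorm V \<phi> = 1 \<and> (\<forall>s\<in>K. hnorm V (\<pi> s \<phi> \<ominus>\<^bsub>V\<^esub> \<phi>) < \<epsilon>)))"

definition nonzero_invariant_vector ::
  "'g set \<Rightarrow> ('v, 'm) inner_module_scheme \<Rightarrow> ('g \<Rightarrow> 'v \<Rightarrow> 'v) \<Rightarrow> bool" where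
  "nonzero_invariant_vector H V \<pi> \<longleftrightarrow>
     (\<exists>v\<in>carrier V. v \<noteq> \<zero>\<^bsub>V\<^esub> \<and> (\<forall>h\<in>H. \<pi> h v = v))"

text \<open>
  The type argument \<open>'v\<close> plays the role of a universe: all Hilbert spaces whose vectors are
  elements of \<open>'v\<close> are considered.  Statements about relative property (T) should keep \<open>'v\<close>
  arbitrary, subject only to being at least as large as the continuum, so that the separable
  infinite-dimensional Hilbert spaces occur (over a finite \<open>'v\<close>, say, there is only the zero space
  and the property would be vacuous).
\<close>

definition relative_property_T ::
  "'v itself \<Rightarrow> ('g, 'b) monoid_scheme \<Rightarrow> 'g set \<Rightarrow> bool" where
  "relative_property_T TYPE('v) G H \<longleftrightarrow>
     (\<forall>(V :: 'v inner_module) \<pi>.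
        unitary_representation G V \<pi> \<and> almost_invariant_vectors G V \<pi>
        \<longrightarrow> nonzero_invariant_vector H V \<pi>)"


section \<open>Cayley graphs and invariant bond percolation\<close>

text \<open>An undirected edge is the set of its endpoints; a loop (if the identity lies in \<open>S\<close>) is a
  singleton and contributes one to the degree, so the degree of the identity is \<open>card S\<close>.\<close>

definition cayley_edges :: "('g, 'b) monoid_scheme \<Rightarrow> 'g set \<Rightarrow> 'g set set" where
  "cayley_edges G S = {{g, g \<otimes>\<^bsub>G\<^esub> s} | g s. g \<in> carrier G \<and> s \<in> S}"

definition edge_degree :: "'g set set \<Rightarrow> 'g \<Rightarrow> nat" where
  "edge_degree \<omega> x = card {e \<in> \<omega>. x \<in> e}"

definition cluster :: "'g set set \<Rightarrow> 'g \<Rightarrow> 'g set" where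
  "cluster \<omega> x = {y. (x, y) \<in> {(u, v). {u, v} \<in> \<omega>}\<^sup>*}"

definition translate :: "('g, 'b) monoid_scheme \<Rightarrow> 'g \<Rightarrow> 'g set set \<Rightarrow> 'g set set" where
  "translate G g \<omega> = (\<lambda>e. (\<lambda>x. g \<otimes>\<^bsub>G\<^esub> x) ` e) ` \<omega>"

text \<open>Configurations carry the product \<open>\<sigma>\<close>-algebra, generated by the events that a given edge is
  open.\<close>

definition invariant_bond_percolation ::
  "('g, 'b) monoid_scheme \<Rightarrow> 'g set \<Rightarrow> 'g set set measure \<Rightarrow> bool" where
  "invariant_bond_percolation G S P \<longleftrightarrow>
     prob_space P \<and>
     space P = Pow (cayley_edges G S) \<and>
     sets P = sigma_sets (Pow (cayley_edges G S))
       {{\<omega> \<in> Pow (cayley_edges G S). e \<in> \<omega>} | e. e \<in> cayley_edges G S} \<and>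
     (\<forall>g\<in>carrier G. distr P P (translate G g) = P)"

definition two_point_function :: "'g set set measure \<Rightarrow> 'g \<Rightarrow> 'g \<Rightarrow> real" where
  "two_point_function P x y = measure P {\<omega> \<in> space P. y \<in> cluster \<omega> x}"

end

(*
Both directions translate between invariant percolations and invariant positive semidefinite kernels.

Suppose there is no threshold.  Then there are invariant percolations P k and elements h k of H such
that the two-point functions tau k tend to 1 pointwise exponentially fast although tau k (1, h k)
tends to 0.  The kernels Phi n = prod_{k >= n} tau k are positive semidefinite, since averaging over
clusters preserves this property, and Phi n tends to 1 pointwise, so the direct sum of the associated
unitary representations almost has invariant vectors.  Since connectivity is transitive,
Phi n (x, h k y) tends to 0 in k for all x and y; hence the operators of h k tend weakly to 0 and
there is no H-invariant vector.

Conversely, let a representation almost have invariant vectors but no H-invariant vector.  A closest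
point argument and scaling give vectors psi n that are moved by at most delta n by the generators and
by at least n + 1 by some h n in H, where the sum of the delta n is as small as we please.  Let W be
the centred Gaussian process with covariance Re <pi(x) psi n, pi(y) psi m>; its law is invariant
because it is determined by the covariance.  Keep an edge {x, y} if W (x, n) + u and W (y, n) + u have
the same integer part for every n.  For a suitable shift u the expected number of removed edges at
the identity is small, while 1 and h n can only be connected if |W (1, n) - W (h n, n)| < 1, which
has probability at most 1 / (n + 1).
*)

theory Submission
  imports Defs
begin

section \<open>Cholesky factorization of positive semidefinite kernels\<close>

text \<open>Relative property (T) only sees Hilbert spaces whose vectors lie in \<open>'v\<close>,
  so the representation attached to a kernel cannot be an abstract completion; it must be given in
  coordinates. Triangular factorization provides them: it embeds a kernel on a countable set into
  square-summable sequences, which inject into every type of at least continuum size, and applied to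
  i.i.d. normal variables the same factor produces the Gaussian process. The coordinates depend on
  an enumeration, so the group does not act on them by any formula. Both invariances therefore rest
  on uniqueness: a law is determined by its covariance, a vector by its values against the kernel
  vectors. Scaling pays off because the probability of cutting an edge by a randomly shifted grid is
  at most the mean increment, while a large increment separates points with high probability. A
  single vector only makes \<open>\<tau>\<close> small to one degree; infinitely many, with summable
  costs, make its infimum over \<open>H\<close> vanish in one percolation. Conversely, the summable
  rate 1/2^k keeps the tail products close to 1.\<close>

definition psd_on :: "'a set \<Rightarrow> ('a \<Rightarrow> 'a \<Rightarrow> real) \<Rightarrow> bool" where
  "psd_on A K \<longleftrightarrow> (\<forall>x\<in>A. \<forall>y\<in>A. K x y = K y x) \<and>
     (\<forall>F c. finite F \<and> F \<subseteq> A \<longrightarrow> 0 \<le> (\<Sum>x\<in>F. \<Sum>y\<in>F. c x * c y * K x y))"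

lemma psd_onD:
  assumes "psd_on A K"
  shows "x \<in> A \<Longrightarrow> y \<in> A \<Longrightarrow> K x y = K y x"
    and "finite F \<Longrightarrow> F \<subseteq> A \<Longrightarrow> 0 \<le> (\<Sum>x\<in>F. \<Sum>y\<in>F. c x * c y * K x y)"
  using assms unfolding psd_on_def by blast+

lemma psd_on_diag: "psd_on A K \<Longrightarrow> x \<in> A \<Longrightarrow> 0 \<le> K x x"
  using psd_onD(2)[of A K "{x}" "\<lambda>_. 1"] by simp

lemma quadratic_form_insert:
  fixes c :: "'a \<Rightarrow> real"
  assumes "finite F" "j \<notin> F" and sym: "\<And>x y. x \<in> insert j F \<Longrightarrow> y \<in> insert j F \<Longrightarrow> K x y = K y x"
  shows "(\<Sum>x\<in>insert j F. \<Sum>y\<in>insert j F. c x * c y * K x y) =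
    (\<Sum>x\<in>F. \<Sum>y\<in>F. c x * c y * K x y) + 2 * c j * (\<Sum>x\<in>F. c x * K x j) + (c j)\<^sup>2 * K j j"
proof -
  have "(\<Sum>y\<in>F. c j * c y * K j y) = c j * (\<Sum>x\<in>F. c x * K x j)"
    unfolding sum_distrib_left using sym by (intro sum.cong) auto
  moreover have "(\<Sum>x\<in>F. c x * c j * K x j) = c j * (\<Sum>x\<in>F. c x * K x j)"
    unfolding sum_distrib_left by (intro sum.cong) auto
  ultimately show ?thesis
    using assms(1,2) by (simp add: sum.distrib power2_eq_square algebra_simps)
qed

text \<open>Since the diagonal entry at \<open>j\<close> is 0, the form on \<open>{x, j}\<close> is
  affine in the coefficient of \<open>j\<close>; a non-zero slope \<open>2 * K x j\<close> would
  make it negative somewhere. The chosen \<open>t\<close> gives the value -1.\<close>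

lemma psd_on_null_row:
  assumes K: "psd_on A K" and "x \<in> A" "j \<in> A" and 0: "K j j = 0"
  shows "K x j = 0"
proof (rule ccontr)
  assume nz: "K x j \<noteq> 0"
  then have ne: "x \<noteq> j" using 0 by auto
  define t where "t = - (K x x + 1) / (2 * K x j)"
  have "0 \<le> (\<Sum>u\<in>{x,j}. \<Sum>v\<in>{x,j}. (if u = j then t else 1) * (if v = j then t else 1) * K u v)"
    using assms by (intro psd_onD(2)[OF K]) auto
  also have "\<dots> = K x x + 2 * t * K x j"
    using ne 0 psd_onD(1)[OF K, of x j] assms by (simp add: algebra_simps)
  also have "\<dots> = -1" using nz by (simp add: t_def field_simps)
  finally show False by simp
qed

text \<open>Completing the square in the pivot variable shows that a Schur complement is again positive
  semidefinite.\<close>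

lemma psd_on_schur_complement:
  assumes K: "psd_on A K" and j: "j \<in> A" "K j j > 0"
  shows "psd_on A (\<lambda>x y. K x y - K x j * K y j / K j j)"
  unfolding psd_on_def
proof (intro conjI allI impI ballI)
  fix F :: "'a set" and c :: "'a \<Rightarrow> real"
  assume F: "finite F \<and> F \<subseteq> A"
  define c' where "c' = c(j := 0)"
  define F' where "F' = F - {j}"
  define s where "s = (\<Sum>x\<in>F'. c x * K x j)"
  \<comment> \<open>\<open>- s / K j j\<close> is the coefficient of \<open>j\<close> that minimises
    the form of \<open>K\<close> with the other coefficients fixed; the minimum is the form of the
    Schur complement.\<close>
  define d where "d = c'(j := - s / K j j)"
  have F': "finite F'" "j \<notin> F'" "F' \<subseteq> A" "F \<subseteq> insert j F'" using F by (auto simp: F'_def)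
  have dc: "x \<in> F' \<Longrightarrow> d x = c x" for x by (auto simp: d_def c'_def F'_def)
  let ?K' = "\<lambda>x y. K x y - K x j * K y j / K j j"
  \<comment> \<open>Row and column \<open>j\<close> of \<open>?K'\<close> vanish, so it does not
    matter whether \<open>F\<close> contains \<open>j\<close>.\<close>
  have "(\<Sum>x\<in>F. \<Sum>y\<in>F. c x * c y * ?K' x y) = (\<Sum>x\<in>F'. \<Sum>y\<in>F'. c x * c y * ?K' x y)"
  proof -
    have "(\<Sum>x\<in>F. \<Sum>y\<in>F. c x * c y * ?K' x y) = (\<Sum>x\<in>F'. \<Sum>y\<in>F. c x * c y * ?K' x y)"
      using F j psd_onD(1)[OF K] unfolding F'_def
      by (intro sum.mono_neutral_right) (auto intro!: sum.neutral)
    also have "\<dots> = (\<Sum>x\<in>F'. \<Sum>y\<in>F'. c x * c y * ?K' x y)"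
      using F j psd_onD(1)[OF K] unfolding F'_def
      by (intro sum.cong refl sum.mono_neutral_right) auto
    finally show ?thesis .
  qed
  also have "\<dots> = (\<Sum>x\<in>F'. \<Sum>y\<in>F'. c x * c y * K x y) - s\<^sup>2 / K j j"
    by (simp add: s_def power2_eq_square sum_product sum_divide_distrib right_diff_distrib
        sum_subtractf mult_ac)
  also have "\<dots> = (\<Sum>x\<in>insert j F'. \<Sum>y\<in>insert j F'. d x * d y * K x y)"
  proof -
    have "(\<Sum>x\<in>insert j F'. \<Sum>y\<in>insert j F'. d x * d y * K x y) =
      (\<Sum>x\<in>F'. \<Sum>y\<in>F'. d x * d y * K x y) + 2 * d j * (\<Sum>x\<in>F'. d x * K x j) + (d j)\<^sup>2 * K j j"
      using F' j by (intro quadratic_form_insert psd_onD(1)[OF K]) auto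
    also have "\<dots> = (\<Sum>x\<in>F'. \<Sum>y\<in>F'. c x * c y * K x y) + 2 * d j * s + (d j)\<^sup>2 * K j j"
      by (simp add: dc s_def)
    also have "\<dots> = (\<Sum>x\<in>F'. \<Sum>y\<in>F'. c x * c y * K x y) - s\<^sup>2 / K j j"
      using j by (simp add: d_def field_simps power2_eq_square)
    finally show ?thesis by simp
  qed
  also have "\<dots> \<ge> 0" using F' j by (intro psd_onD(2)[OF K]) auto
  finally show "0 \<le> (\<Sum>x\<in>F. \<Sum>y\<in>F. c x * c y * ?K' x y)" .
qed (use psd_onD(1)[OF K] in auto)

text \<open>Cholesky factorization: \<open>cholesky_rest K n\<close> is the residual kernel after \<open>n\<close> pivots. A
  vanishing pivot contributes a zero column, since \<open>x / 0 = 0\<close>.\<close>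

fun cholesky_rest :: "(nat \<Rightarrow> nat \<Rightarrow> real) \<Rightarrow> nat \<Rightarrow> nat \<Rightarrow> nat \<Rightarrow> real" where
  "cholesky_rest K 0 = K"
| "cholesky_rest K (Suc n) = (\<lambda>x y. cholesky_rest K n x y -
     cholesky_rest K n x n * cholesky_rest K n y n / cholesky_rest K n n n)"

definition cholesky :: "(nat \<Rightarrow> nat \<Rightarrow> real) \<Rightarrow> nat \<Rightarrow> nat \<Rightarrow> real" where
  "cholesky K x j = cholesky_rest K j x j / sqrt (cholesky_rest K j j j)"

lemma psd_cholesky_rest: "psd_on UNIV K \<Longrightarrow> psd_on UNIV (cholesky_rest K n)"
proof (induction n)
  case (Suc n)
  then have *: "psd_on UNIV (cholesky_rest K n)" by simp
  show ?case
  proof (cases "cholesky_rest K n n n = 0")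
    case True
    then show ?thesis using * by simp
  next
    case False
    then have "cholesky_rest K n n n > 0" using psd_on_diag[OF *, of n] by simp
    then show ?thesis using psd_on_schur_complement[OF *, of n] by simp
  qed
qed simp

text \<open>Step \<open>n\<close> clears column \<open>n\<close>, and it leaves cleared columns
  alone because the pivot row is 0 there by symmetry. If the pivot itself is 0,
  \<open>psd_on_null_row\<close> says that there was nothing to clear.\<close>

lemma cholesky_rest_null:
  assumes "psd_on UNIV K" "i < n"
  shows "cholesky_rest K n x i = 0"
  using assms(2)
proof (induction n arbitrary: x)
  case (Suc n)
  have *: "psd_on UNIV (cholesky_rest K n)" by (rule psd_cholesky_rest[OF assms(1)])
  show ?case
  proof (cases "i = n")
    case True
    show ?thesis
      using psd_on_null_row[OF *, of x n] True by (cases "cholesky_rest K n n n = 0") auto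
  next
    case False
    then show ?thesis using Suc psd_onD(1)[OF *, of i n] by simp
  qed
qed simp

lemma cholesky_rest_eq:
  assumes "psd_on UNIV K"
  shows "K x y = (\<Sum>j<n. cholesky K x j * cholesky K y j) + cholesky_rest K n x y"
proof (induction n)
  case (Suc n)
  have "sqrt (cholesky_rest K n n n) * sqrt (cholesky_rest K n n n) = cholesky_rest K n n n"
    using psd_on_diag[OF psd_cholesky_rest[OF assms]] by simp
  then show ?case using Suc by (simp add: cholesky_def)
qed simp

lemma cholesky_upper:
  assumes "psd_on UNIV K" "x < j"
  shows "cholesky K x j = 0"
  using cholesky_rest_null[OF assms, of j] psd_onD(1)[OF psd_cholesky_rest[OF assms(1)], of x j]
  by (simp add: cholesky_def)

lemma cholesky_null_pivot:
  assumes "psd_on UNIV K" "cholesky K j j = 0"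
  shows "cholesky K x j = 0"
proof -
  have "cholesky_rest K j j j = 0" using assms(2) by (auto simp: cholesky_def)
  then show ?thesis by (simp add: cholesky_def)
qed

text \<open>Row \<open>x\<close> of the residual kernel is exhausted once \<open>n\<close> exceeds
  \<open>x\<close>, so the expansion is finite and exact for arbitrary \<open>y\<close>.\<close>

lemma cholesky_eq:
  assumes "psd_on UNIV K" "x < n"
  shows "K x y = (\<Sum>j<n. cholesky K x j * cholesky K y j)"
  using cholesky_rest_eq[OF assms(1), of x y n] cholesky_rest_null[OF assms, of y]
    psd_onD(1)[OF psd_cholesky_rest[OF assms(1)], of x y] by simp

text \<open>Back substitution. Row \<open>j\<close> divided by its pivot still has entries in
  columns \<open>k < j\<close>; each is cancelled by the combination obtained for \<open>k\<close>,
  or is 0 already when pivot \<open>k\<close> vanishes. Later this lets single coordinates be read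
  off from kernel values.\<close>

lemma cholesky_inverse:
  assumes "psd_on UNIV K" "cholesky K j j \<noteq> 0"
  shows "\<exists>b. \<forall>i. (\<Sum>x\<le>j. b x * cholesky K x i) = (if i = j then 1 else 0)"
  using assms(2)
proof (induction j rule: less_induct)
  case (less j)
  let ?a = "cholesky K"
  have "\<exists>b. \<forall>i. (\<Sum>x<j. b x * ?a x i) = ?a j k * (if i = k then 1 else 0)" if kj: "k < j" for k
  proof (cases "?a k k = 0")
    case True
    then show ?thesis using cholesky_null_pivot[OF assms(1)] by (intro exI[of _ "\<lambda>_. 0"]) simp
  next
    case False
    then obtain b where b: "\<And>i. (\<Sum>x\<le>k. b x * ?a x i) = (if i = k then 1 else 0)"
      using less.IH[OF kj] by blast
    have "(\<Sum>x<j. (if x \<le> k then ?a j k * b x else 0) * ?a x i) = ?a j k * (if i = k then 1 else 0)" for i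
    proof -
      have "(\<Sum>x<j. (if x \<le> k then ?a j k * b x else 0) * ?a x i) = (\<Sum>x\<le>k. ?a j k * (b x * ?a x i))"
        using that by (intro sum.mono_neutral_cong_right) auto
      then show ?thesis unfolding sum_distrib_left[symmetric] b .
    qed
    then show ?thesis by (intro exI[of _ "\<lambda>x. if x \<le> k then ?a j k * b x else 0"]) simp
  qed
  then obtain b where b: "\<And>k i. k < j \<Longrightarrow> (\<Sum>x<j. b k x * ?a x i) = ?a j k * (if i = k then 1 else 0)"
    by metis
  define c where "c = (\<lambda>x. (if x = j then 1 else - (\<Sum>k<j. b k x)) / ?a j j)"
  have "(\<Sum>x\<le>j. c x * ?a x i) = (if i = j then 1 else 0)" for i
  proof -
    have "(\<Sum>x\<le>j. c x * ?a x i) = (\<Sum>x<j. c x * ?a x i) + ?a j i / ?a j j"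
      by (simp add: c_def lessThan_Suc_atMost[symmetric])
    also have "(\<Sum>x<j. c x * ?a x i) = - (\<Sum>x<j. \<Sum>k<j. b k x * ?a x i) / ?a j j"
      by (simp add: c_def sum_distrib_right sum_negf[symmetric] sum_divide_distrib)
    also have "(\<Sum>x<j. \<Sum>k<j. b k x * ?a x i) = (\<Sum>k<j. \<Sum>x<j. b k x * ?a x i)"
      by (rule sum.swap)
    also have "\<dots> = (\<Sum>k<j. ?a j k * (if i = k then 1 else 0))"
      using b by (intro sum.cong) auto
    also have "\<dots> = (if i < j then ?a j i else 0)"
      by (auto simp: if_distrib[of "\<lambda>t. _ * t"] cong: if_cong)
    finally show ?thesis
      using less.prems cholesky_upper[OF assms(1), of j i] by (auto simp: not_less le_less)
  qed
  then show ?case by blast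
qed

lemma psd_on_reindex:
  assumes K: "psd_on A K" and e: "inj_on e Y" "e ` Y \<subseteq> A"
  shows "psd_on Y (\<lambda>m n. K (e m) (e n))"
  unfolding psd_on_def
proof (intro conjI allI impI ballI)
  fix F :: "'b set" and c :: "'b \<Rightarrow> real"
  assume F: "finite F \<and> F \<subseteq> Y"
  then have inj: "inj_on e F" using e inj_on_subset by blast
  define d where "d = (\<lambda>x. c (the_inv_into F e x))"
  have "0 \<le> (\<Sum>x\<in>e`F. \<Sum>y\<in>e`F. d x * d y * K x y)"
    using F e by (intro psd_onD(2)[OF K]) auto
  also have "\<dots> = (\<Sum>x\<in>F. \<Sum>y\<in>F. c x * c y * K (e x) (e y))"
    using inj by (simp add: sum.reindex d_def the_inv_into_f_f)
  finally show "0 \<le> (\<Sum>x\<in>F. \<Sum>y\<in>F. c x * c y * K (e x) (e y))" .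
qed (use psd_onD(1)[OF K] e in blast)

text \<open>The index set \<open>J\<close> consists of the nonzero pivots, so that the rows of the factor span all
  finitely supported vectors on \<open>J\<close>.\<close>

definition kernel_factor ::
  "'a set \<Rightarrow> ('a \<Rightarrow> 'a \<Rightarrow> real) \<Rightarrow> nat set \<Rightarrow> ('a \<Rightarrow> nat \<Rightarrow> real) \<Rightarrow> bool" where
  "kernel_factor A K J a \<longleftrightarrow>
    (\<forall>x\<in>A. finite {j. a x j \<noteq> 0} \<and> {j. a x j \<noteq> 0} \<subseteq> J) \<and>
    (\<forall>x\<in>A. \<forall>y\<in>A. K x y = (\<Sum>j\<in>{j. a x j \<noteq> 0}. a x j * a y j)) \<and>
    (\<forall>j\<in>J. \<exists>F b. finite F \<and> F \<subseteq> A \<and> (\<forall>i. (\<Sum>x\<in>F. b x * a x i) = (if i = j then 1 else 0)))"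

text \<open>The enumeration \<open>e\<close> of the infinite set \<open>A\<close> is a bijection
  with all natural numbers, so the recursion on \<open>nat\<close> applies as it stands, and row
  \<open>x\<close> is supported in the first \<open>r x + 1\<close> columns.\<close>

lemma kernel_factor_exists:
  assumes A: "countable A" "infinite A" and K: "psd_on A K"
  obtains J a where "kernel_factor A K J a"
proof -
  define e where "e = from_nat_into A"
  define r where "r = to_nat_on A"
  have e: "bij_betw e UNIV A" unfolding e_def using A by (rule bij_betw_from_nat_into)
  have er: "x \<in> A \<Longrightarrow> e (r x) = x" and re: "r (e n) = n" for x n
    using A by (auto simp: e_def r_def)
  define L where "L = (\<lambda>m n. K (e m) (e n))"
  have L: "psd_on UNIV L"
    unfolding L_def using e by (intro psd_on_reindex[OF K]) (auto simp: bij_betw_def)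
  define a where "a = (\<lambda>x. cholesky L (r x))"
  define J where "J = {j. cholesky L j j \<noteq> 0}"
  have sub: "{j. a x j \<noteq> 0} \<subseteq> {..<Suc (r x)}" for x
    using cholesky_upper[OF L] by (auto simp: a_def not_less_eq[symmetric] intro: ccontr)
  have "K x y = (\<Sum>j\<in>{j. a x j \<noteq> 0}. a x j * a y j)" if "x \<in> A" "y \<in> A" for x y
  proof -
    have "K x y = L (r x) (r y)" using that er by (simp add: L_def)
    also have "\<dots> = (\<Sum>j<Suc (r x). a x j * a y j)"
      unfolding a_def by (rule cholesky_eq[OF L]) simp
    also have "\<dots> = (\<Sum>j\<in>{j. a x j \<noteq> 0}. a x j * a y j)"
      using sub[of x] by (intro sum.mono_neutral_right) auto
    finally show ?thesis .
  qed
  moreover have "\<exists>F b. finite F \<and> F \<subseteq> A \<and> (\<forall>i. (\<Sum>x\<in>F. b x * a x i) = (if i = j then 1 else 0))"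
    if j: "j \<in> J" for j
  proof -
    obtain b where b: "\<And>i. (\<Sum>x\<le>j. b x * cholesky L x i) = (if i = j then 1 else 0)"
      using cholesky_inverse[OF L] j by (auto simp: J_def)
    have "inj_on e {..j}" using e by (auto simp: bij_betw_def inj_on_def)
    then have "(\<Sum>x\<in>e ` {..j}. b (r x) * a x i) = (if i = j then 1 else 0)" for i
      by (simp add: sum.reindex a_def re b)
    moreover have "e ` {..j} \<subseteq> A" using e by (auto simp: bij_betw_def)
    ultimately show ?thesis by (intro exI[of _ "e ` {..j}"] exI[of _ "\<lambda>x. b (r x)"]) auto
  qed
  moreover have "{j. a x j \<noteq> 0} \<subseteq> J" for x
    using cholesky_null_pivot[OF L] by (auto simp: a_def J_def)
  ultimately have "kernel_factor A K J a"
    unfolding kernel_factor_def using finite_subset[OF sub] by blast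
  then show thesis by (rule that)
qed

section \<open>Characteristic functions determine joint laws\<close>

text \<open>Normalisation reduces this to Levy's theorem for probability measures: the common mass
  \<open>c\<close> is the value of the characteristic functions at 0. Both measures vanish when
  \<open>c = 0\<close>.\<close>

lemma finite_measure_char_unique:
  fixes M N :: "real measure"
  assumes M: "finite_measure M" "sets M = sets borel" and N: "finite_measure N" "sets N = sets borel"
    and eq: "\<And>t. char M t = char N t"
  shows "M = N"
proof -
  have sp: "space M = UNIV" "space N = UNIV"
    using sets_eq_imp_space_eq[OF M(2)] sets_eq_imp_space_eq[OF N(2)] by auto
  define c where "c = measure M UNIV"
  have c: "measure N UNIV = c"
    using eq[of 0] by (simp add: char_def c_def sp complex_eq_iff)
  have eM: "emeasure M UNIV = ennreal c" "emeasure N UNIV = ennreal c"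
    using M(1) N(1) c by (simp_all add: c_def finite_measure.emeasure_eq_measure)
  show ?thesis
  proof (cases "c = 0")
    case True
    have "emeasure M A = 0" for A
      using emeasure_mono[of A UNIV M] M(2) eM True by (cases "A \<in> sets M") (auto simp: emeasure_notin_sets)
    moreover have "emeasure N A = 0" for A
      using emeasure_mono[of A UNIV N] N(2) eM True by (cases "A \<in> sets N") (auto simp: emeasure_notin_sets)
    ultimately show ?thesis using M N by (intro measure_eqI) auto
  next
    case False
    then have pos: "c > 0" by (simp add: c_def zero_less_measure_iff)
    have *: "real_distribution (density L (\<lambda>_. ennreal (1/c)))" "char (density L (\<lambda>_. ennreal (1/c))) = (\<lambda>t. char L t / c)"
      if L: "finite_measure L" "sets L = sets borel" "emeasure L UNIV = ennreal c" for L :: "real measure"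
    proof -
      have sl: "space L = UNIV" using sets_eq_imp_space_eq[OF L(2)] by auto
      have "emeasure (density L (\<lambda>_. ennreal (1/c))) UNIV = 1"
        using L sl pos by (simp add: emeasure_density nn_integral_cmult ennreal_mult[symmetric])
      then show "real_distribution (density L (\<lambda>_. ennreal (1/c)))"
        by (intro real_distribution.intro real_distribution_axioms.intro prob_spaceI) (simp_all add: L(2) sl)
      show "char (density L (\<lambda>_. ennreal (1/c))) = (\<lambda>t. char L t / c)"
      proof
        fix t
        have [measurable_cong]: "sets L = sets borel" by (rule L(2))
        have "char (density L (\<lambda>_. ennreal (1/c))) t = (CLINT x|L. (1/c) *\<^sub>R iexp (t * x))"
          unfolding char_def using pos by (intro integral_density) auto
        then show "char (density L (\<lambda>_. ennreal (1/c))) t = char L t / c"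
          by (simp add: char_def scaleR_conv_of_real)
      qed
    qed
    have "density M (\<lambda>_. ennreal (1/c)) = density N (\<lambda>_. ennreal (1/c))"
      using *[OF M eM(1)] *[OF N eM(2)] by (intro Levy_uniqueness) (simp_all add: eq)
    then have d: "density (density M (\<lambda>_. ennreal (1/c))) (\<lambda>_. ennreal c) =
        density (density N (\<lambda>_. ennreal (1/c))) (\<lambda>_. ennreal c)" by simp
    have "density (density L (\<lambda>_. ennreal (1/c))) (\<lambda>_. ennreal c) = L" for L :: "real measure"
      using pos by (simp add: density_density_eq ennreal_mult[symmetric] density_1)
    then show ?thesis using d by simp
  qed
qed

section \<open>From characteristic functions in one variable to joint laws\<close>

abbreviation cos_weighted :: "'a measure \<Rightarrow> ('a \<Rightarrow> real) \<Rightarrow> real \<Rightarrow> 'a measure" where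
  "cos_weighted L Q \<alpha> \<equiv> density L (\<lambda>z. ennreal (1 + cos (Q z - \<alpha>)))"

abbreviation density_on :: "'a measure \<Rightarrow> ('a \<Rightarrow> real) \<Rightarrow> real set \<Rightarrow> 'a measure" where
  "density_on L W B \<equiv> density L (\<lambda>z. ennreal (indicator B (W z)))"

text \<open>The frequencies 0, 1 and -1 of \<open>q\<close> are kept visible so that, after
  integration, each summand is a joint characteristic function at a point
  \<open>(s, t)\<close>.\<close>

lemma cos_weight_iexp:
  fixes q \<alpha> w :: real
  shows "(1 + cos (q - \<alpha>)) *\<^sub>R iexp w = iexp (w + 0 * q) + exp (- \<i> * \<alpha>) / 2 * iexp (w + 1 * q)
    + exp (\<i> * \<alpha>) / 2 * iexp (w + (-1) * q)"
proof -
  have c: "complex_of_real (cos (q - \<alpha>)) = (exp (\<i> * q - \<i> * \<alpha>) + exp (\<i> * \<alpha> - \<i> * q)) / 2"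
    unfolding cos_of_real[symmetric] cos_exp_eq by (simp add: right_diff_distrib)
  have e: "iexp (w + 1 * q) = iexp w * exp (\<i> * q)" "iexp (w + (-1) * q) = iexp w / exp (\<i> * q)"
    by (simp_all add: distrib_left right_diff_distrib exp_add exp_diff)
  have i: "exp (- \<i> * \<alpha>) = 1 / exp (\<i> * \<alpha>)"
    by (simp add: exp_minus inverse_eq_divide)
  have "(1 + cos (q - \<alpha>)) *\<^sub>R iexp w = iexp w + complex_of_real (cos (q - \<alpha>)) * iexp w"
    by (simp add: scaleR_conv_of_real distrib_right)
  also have "\<dots> = iexp (w + 0 * q) + exp (- \<i> * \<alpha>) / 2 * iexp (w + 1 * q)
    + exp (\<i> * \<alpha>) / 2 * iexp (w + (-1) * q)"
  proof -
    have "v + (a / b + b / a) / 2 * v = v + 1 / b / 2 * (v * a) + b / 2 * (v / a)" for a b v :: complex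
      by (simp add: distrib_left distrib_right add_divide_distrib mult_ac)
    then show ?thesis unfolding c e i exp_diff by simp
  qed
  finally show ?thesis .
qed

text \<open>The weight lies between 0 and 2, so it is the density of a finite measure. The law of
  \<open>W\<close> under it has a characteristic function that combines three values of the joint
  transform of \<open>W\<close> and \<open>Q\<close>.\<close>

lemma
  fixes W Q :: "'a \<Rightarrow> real" and \<alpha> :: real
  assumes L: "finite_measure L" and [measurable]: "W \<in> borel_measurable L" "Q \<in> borel_measurable L" "B \<in> sets borel"
  shows finite_measure_cos_weighted:
      "finite_measure (distr (cos_weighted L Q \<alpha>) borel W)"
    and char_cos_weighted: "char (distr (cos_weighted L Q \<alpha>) borel W) s =
      (CLINT z|L. iexp (s * W z + 0 * Q z)) + exp (- \<i> * \<alpha>) / 2 * (CLINT z|L. iexp (s * W z + 1 * Q z))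
       + exp (\<i> * \<alpha>) / 2 * (CLINT z|L. iexp (s * W z + (-1) * Q z))"
    and measure_cos_weighted: "measure (distr (cos_weighted L Q \<alpha>) borel W) B =
       (\<integral>z. indicator B (W z) * (1 + cos (Q z - \<alpha>)) \<partial>L)"
    and integrable_indicator_trig: "integrable L (\<lambda>z. indicator B (W z) * cos (Q z))"
      "integrable L (\<lambda>z. indicator B (W z) * sin (Q z))" "integrable L (\<lambda>z. indicator B (W z) :: real)"
proof -
  interpret finite_measure L by fact
  have nn: "0 \<le> 1 + cos (x::real)" for x using cos_ge_minus_one[of x] by linarith
  have int1: "integrable L (\<lambda>z. iexp (a * W z + b * Q z))" for a b
    by (intro integrable_const_bound[of _ 1]) auto
  have int2: "integrable L (\<lambda>z. indicator B (W z) * (1 + cos (Q z - \<alpha>)))"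
    by (intro integrable_const_bound[of _ 2])
       (auto simp: abs_mult nn indicator_def abs_le_iff intro!: AE_I2)
  show "integrable L (\<lambda>z. indicator B (W z) * cos (Q z))" "integrable L (\<lambda>z. indicator B (W z) * sin (Q z))"
     "integrable L (\<lambda>z. indicator B (W z) :: real)"
    by (intro integrable_const_bound[of _ 1]; auto simp: abs_mult indicator_def)+
  have int4: "integrable L (\<lambda>z. 1 + cos (Q z - \<alpha>))"
    by (intro integrable_const_bound[of _ 2]) (auto simp: abs_le_iff nn intro!: AE_I2)
  have fin: "finite_measure (cos_weighted L Q \<alpha>)"
    using int4 nn by (intro finite_measureI) (auto simp: emeasure_density nn_integral_eq_integral cong: nn_integral_cong)
  then show "finite_measure (distr (cos_weighted L Q \<alpha>) borel W)"
    by (rule finite_measure.finite_measure_distr) simp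
  have "char (distr (cos_weighted L Q \<alpha>) borel W) s =
      (CLINT z|L. (1 + cos (Q z - \<alpha>)) *\<^sub>R iexp (s * W z))"
    unfolding char_def by (subst integral_distr, simp, simp) (subst integral_density, auto simp: nn)
  also have "\<dots> = (CLINT z|L. iexp (s * W z + 0 * Q z) + exp (- \<i> * \<alpha>) / 2 * iexp (s * W z + 1 * Q z)
     + exp (\<i> * \<alpha>) / 2 * iexp (s * W z + (-1) * Q z))"
    by (intro Bochner_Integration.integral_cong refl cos_weight_iexp)
  also have "\<dots> = (CLINT z|L. iexp (s * W z + 0 * Q z)) + exp (- \<i> * \<alpha>) / 2 * (CLINT z|L. iexp (s * W z + 1 * Q z))
     + exp (\<i> * \<alpha>) / 2 * (CLINT z|L. iexp (s * W z + (-1) * Q z))"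
  proof -
    have i: "integrable L (\<lambda>z. iexp (s * W z + 0 * Q z))"
       "integrable L (\<lambda>z. exp (- \<i> * \<alpha>) / 2 * iexp (s * W z + 1 * Q z))"
       "integrable L (\<lambda>z. exp (\<i> * \<alpha>) / 2 * iexp (s * W z + (-1) * Q z))"
      by (rule int1, (rule integrable_mult_right int1)+)
    show ?thesis
      by (subst Bochner_Integration.integral_add[OF Bochner_Integration.integrable_add[OF i(1,2)] i(3)],
          subst Bochner_Integration.integral_add[OF i(1,2)], (subst integral_mult_right_zero)+, rule refl)
  qed
  finally show "char (distr (cos_weighted L Q \<alpha>) borel W) s = \<dots>" .
  show "measure (distr (cos_weighted L Q \<alpha>) borel W) B =
     (\<integral>z. indicator B (W z) * (1 + cos (Q z - \<alpha>)) \<partial>L)"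
  proof -
    have "measure (distr (cos_weighted L Q \<alpha>) borel W) B =
      measure (cos_weighted L Q \<alpha>) (W -` B \<inter> space L)"
      by (simp add: measure_distr)
    also have "\<dots> = (\<integral>z. indicator (W -` B \<inter> space L) z \<partial>cos_weighted L Q \<alpha>)"
      by simp
    also have "\<dots> = (\<integral>z. (1 + cos (Q z - \<alpha>)) *\<^sub>R indicator (W -` B \<inter> space L) z \<partial>L)"
      by (rule integral_density) (auto simp: nn)
    also have "\<dots> = (\<integral>z. indicator B (W z) * (1 + cos (Q z - \<alpha>)) \<partial>L)"
      by (intro Bochner_Integration.integral_cong) (auto simp: indicator_def)
    finally show ?thesis .
  qed
qed

text \<open>The weights \<open>1 + cos (S - \<alpha>)\<close> are nonnegative, so that Levy's uniqueness theorem applies to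
  the weighted laws of \<open>U\<close>; varying \<open>\<alpha>\<close> recovers the complex weight \<open>exp (\<i> S)\<close>.\<close>

lemma char_eq_imp_partial_char_eq:
  fixes U S :: "'a \<Rightarrow> real" and Y T :: "'b \<Rightarrow> real"
  assumes M: "finite_measure M" and N: "finite_measure N"
    and [measurable]: "U \<in> borel_measurable M" "S \<in> borel_measurable M"
      "Y \<in> borel_measurable N" "T \<in> borel_measurable N" "B \<in> sets borel"
    and eq: "\<And>s t. (CLINT z|M. iexp (s * U z + t * S z)) = (CLINT z|N. iexp (s * Y z + t * T z))"
  shows "(CLINT z|M. indicator B (U z) *\<^sub>R iexp (S z)) = (CLINT z|N. indicator B (Y z) *\<^sub>R iexp (T z))"
proof -
  have J: "(\<integral>z. indicator B (U z) * (1 + cos (S z - \<alpha>)) \<partial>M) = (\<integral>z. indicator B (Y z) * (1 + cos (T z - \<alpha>)) \<partial>N)" for \<alpha>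
  proof -
    have "distr (cos_weighted M S \<alpha>) borel U =
      distr (cos_weighted N T \<alpha>) borel Y"
      by (intro finite_measure_char_unique finite_measure_cos_weighted[OF M assms(3,4,7)]
            finite_measure_cos_weighted[OF N assms(5,6,7)])
         (simp_all only: char_cos_weighted[OF M assms(3,4,7)] char_cos_weighted[OF N assms(5,6,7)] eq sets_distr)
    then show ?thesis
      by (simp only: measure_cos_weighted[OF M, symmetric] measure_cos_weighted[OF N, symmetric] assms)
  qed
  have m: "integrable M (\<lambda>z. indicator B (U z) * cos (S z))" "integrable M (\<lambda>z. indicator B (U z) * sin (S z))"
      "integrable M (\<lambda>z. indicator B (U z) :: real)"
    "integrable N (\<lambda>z. indicator B (Y z) * cos (T z))" "integrable N (\<lambda>z. indicator B (Y z) * sin (T z))"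
      "integrable N (\<lambda>z. indicator B (Y z) :: real)"
    using integrable_indicator_trig[OF M assms(3,4,7)] integrable_indicator_trig[OF N assms(5,6,7)] by auto
  have expand: "(\<integral>z. indicator B (W z) * (1 + cos (Q z - \<alpha>)) \<partial>L) = (\<integral>z. indicator B (W z) \<partial>L) +
      (cos \<alpha> * (\<integral>z. indicator B (W z) * cos (Q z) \<partial>L) + sin \<alpha> * (\<integral>z. indicator B (W z) * sin (Q z) \<partial>L))"
    if int: "integrable L (\<lambda>z. indicator B (W z) * cos (Q z))" "integrable L (\<lambda>z. indicator B (W z) * sin (Q z))"
      "integrable L (\<lambda>z. indicator B (W z) :: real)"
    for L :: "'c measure" and W Q :: "'c \<Rightarrow> real" and \<alpha>
  proof -
    have "(\<integral>z. indicator B (W z) * (1 + cos (Q z - \<alpha>)) \<partial>L) = (\<integral>z. indicator B (W z) +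
      (cos \<alpha> * (indicator B (W z) * cos (Q z)) + sin \<alpha> * (indicator B (W z) * sin (Q z))) \<partial>L)"
      by (intro Bochner_Integration.integral_cong refl) (simp add: cos_diff distrib_left mult_ac)
    also have "\<dots> = (\<integral>z. indicator B (W z) \<partial>L) + (\<integral>z. cos \<alpha> * (indicator B (W z) * cos (Q z)) +
        sin \<alpha> * (indicator B (W z) * sin (Q z)) \<partial>L)"
      by (intro Bochner_Integration.integral_add Bochner_Integration.integrable_add integrable_mult_right int)
    also have "\<dots> = (\<integral>z. indicator B (W z) \<partial>L) + ((\<integral>z. cos \<alpha> * (indicator B (W z) * cos (Q z)) \<partial>L) +
        (\<integral>z. sin \<alpha> * (indicator B (W z) * sin (Q z)) \<partial>L))"
      by (intro arg_cong2[of _ _ _ _ "(+)"] refl Bochner_Integration.integral_add integrable_mult_right int)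
    finally show ?thesis by (simp only: integral_mult_right_zero)
  qed
  have J': "(\<integral>z. indicator B (U z) \<partial>M) +
      (cos \<alpha> * (\<integral>z. indicator B (U z) * cos (S z) \<partial>M) + sin \<alpha> * (\<integral>z. indicator B (U z) * sin (S z) \<partial>M)) =
      (\<integral>z. indicator B (Y z) \<partial>N) +
      (cos \<alpha> * (\<integral>z. indicator B (Y z) * cos (T z) \<partial>N) + sin \<alpha> * (\<integral>z. indicator B (Y z) * sin (T z) \<partial>N))" for \<alpha>
    using J[of \<alpha>] unfolding expand[OF m(1,2,3)] expand[OF m(4,5,6)] .
  have dec: "(CLINT z|L. indicator B (W z) *\<^sub>R iexp (Q z)) =
     complex_of_real (\<integral>z. indicator B (W z) * cos (Q z) \<partial>L) + \<i> * complex_of_real (\<integral>z. indicator B (W z) * sin (Q z) \<partial>L)"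
    if "integrable L (\<lambda>z. indicator B (W z) * cos (Q z))" "integrable L (\<lambda>z. indicator B (W z) * sin (Q z))"
    for L :: "'c measure" and W Q
  proof -
    have "(CLINT z|L. indicator B (W z) *\<^sub>R iexp (Q z)) =
      (CLINT z|L. complex_of_real (indicator B (W z) * cos (Q z)) + \<i> * complex_of_real (indicator B (W z) * sin (Q z)))"
      by (intro Bochner_Integration.integral_cong)
         (auto simp: scaleR_conv_of_real exp_Euler cos_of_real sin_of_real algebra_simps)
    also have "\<dots> = (CLINT z|L. complex_of_real (indicator B (W z) * cos (Q z))) + (CLINT z|L. \<i> * complex_of_real (indicator B (W z) * sin (Q z)))"
      using that by (intro Bochner_Integration.integral_add integrable_of_real integrable_mult_right) auto
    finally show ?thesis by (simp del: of_real_mult)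
  qed
  show ?thesis
  proof -
    \<comment> \<open>At \<open>\<alpha> = 0\<close> and \<open>\<alpha> = pi\<close> the sine term
      is absent and the cosine term changes sign, so mass and cosine part separate;
      \<open>pi/2\<close> then isolates the sine part.\<close>
    have "(\<integral>z. indicator B (U z) * cos (S z) \<partial>M) = (\<integral>z. indicator B (Y z) * cos (T z) \<partial>N)"
      using J'[of 0] J'[of pi] by simp
    moreover have "(\<integral>z. indicator B (U z) * sin (S z) \<partial>M) = (\<integral>z. indicator B (Y z) * sin (T z) \<partial>N)"
      using J'[of 0] J'[of pi] J'[of "pi/2"] by simp
    ultimately show ?thesis unfolding dec[OF m(1,2)] dec[OF m(4,5)] by simp
  qed
qed

text \<open>Conditioning on the event that \<open>W\<close> lies in \<open>B\<close>, without
  normalisation, so that it can be iterated over the coordinates.\<close>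

lemma
  fixes W Q :: "'a \<Rightarrow> real"
  assumes L: "finite_measure L" and [measurable]: "W \<in> borel_measurable L" "B \<in> sets borel"
  shows finite_measure_indicator_weighted:
      "finite_measure (density_on L W B)"
    and measure_indicator_weighted: "A \<in> sets L \<Longrightarrow>
      measure (density_on L W B) A = measure L {z \<in> A. W z \<in> B}"
    and char_indicator_weighted: "Q \<in> borel_measurable L \<Longrightarrow>
      (CLINT z|density_on L W B. iexp (Q z)) =
      (CLINT z|L. indicator B (W z) *\<^sub>R iexp (Q z))"
proof -
  interpret finite_measure L by fact
  have e: "emeasure (density_on L W B) A = emeasure L {z \<in> A. W z \<in> B}"
    if [measurable]: "A \<in> sets L" for A
  proof -
    have "emeasure (density_on L W B) A =
      (\<integral>\<^sup>+z. ennreal (indicator B (W z)) * indicator A z \<partial>L)"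
      by (rule emeasure_density) auto
    also have "\<dots> = (\<integral>\<^sup>+z. indicator {z \<in> A. W z \<in> B} z \<partial>L)"
      by (intro nn_integral_cong) (auto simp: indicator_def)
    finally have "emeasure (density_on L W B) A =
      (\<integral>\<^sup>+z. indicator {z \<in> A. W z \<in> B} z \<partial>L)" .
    then show ?thesis by simp
  qed
  show "finite_measure (density_on L W B)"
    using e[of "space L"] by (intro finite_measureI) simp
  show "measure (density_on L W B) A = measure L {z \<in> A. W z \<in> B}"
    if "A \<in> sets L"
    using e[OF that] by (simp add: measure_def)
  show "(CLINT z|density_on L W B. iexp (Q z)) =
      (CLINT z|L. indicator B (W z) *\<^sub>R iexp (Q z))" if [measurable]: "Q \<in> borel_measurable L"
    by (rule integral_density) auto
qed

text \<open>Induction on the coordinates: both measures are restricted to the event that coordinate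
  \<open>k\<close> lies in \<open>B k\<close>, and \<open>char_eq_imp_partial_char_eq\<close>
  carries the hypothesis over to the remaining ones. Restrictions lose mass, hence finite measures
  in the statement.\<close>

lemma char_eq_imp_rectangle_eq:
  fixes U :: "'i \<Rightarrow> 'a \<Rightarrow> real" and Y :: "'i \<Rightarrow> 'b \<Rightarrow> real"
  assumes "finite I" "finite_measure M" "finite_measure N"
    and "\<And>i. i \<in> I \<Longrightarrow> U i \<in> borel_measurable M" "\<And>i. i \<in> I \<Longrightarrow> Y i \<in> borel_measurable N"
    and "\<And>i. i \<in> I \<Longrightarrow> B i \<in> sets borel"
    and "\<And>t. (CLINT z|M. iexp (\<Sum>i\<in>I. t i * U i z)) = (CLINT z|N. iexp (\<Sum>i\<in>I. t i * Y i z))"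
  shows "measure M {z \<in> space M. \<forall>i\<in>I. U i z \<in> B i} = measure N {z \<in> space N. \<forall>i\<in>I. Y i z \<in> B i}"
  using assms
proof (induction I arbitrary: M N rule: finite_induct)
  case empty
  then show ?case by (simp add: complex_eq_iff)
next
  case (insert k I)
  have [measurable]: "U i \<in> borel_measurable M" "Y i \<in> borel_measurable N" "B i \<in> sets borel" if "i \<in> insert k I" for i
    using that insert.prems by auto
  have [measurable]: "U k \<in> borel_measurable M" "Y k \<in> borel_measurable N" "B k \<in> sets borel" by simp_all
  define M' where "M' = density_on M (U k) (B k)"
  define N' where "N' = density_on N (Y k) (B k)"
  have "measure M' {z \<in> space M'. \<forall>i\<in>I. U i z \<in> B i} = measure N' {z \<in> space N'. \<forall>i\<in>I. Y i z \<in> B i}"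
  proof (rule insert.IH)
    fix t :: "'i \<Rightarrow> real"
    have [measurable]: "(\<lambda>z. \<Sum>i\<in>I. t i * U i z) \<in> borel_measurable M" "(\<lambda>z. \<Sum>i\<in>I. t i * Y i z) \<in> borel_measurable N"
      by (auto intro!: borel_measurable_sum borel_measurable_times)
    have "(CLINT z|M. indicator (B k) (U k z) *\<^sub>R iexp (\<Sum>i\<in>I. t i * U i z)) =
        (CLINT z|N. indicator (B k) (Y k z) *\<^sub>R iexp (\<Sum>i\<in>I. t i * Y i z))"
    proof (rule char_eq_imp_partial_char_eq)
      fix s u :: real
      \<comment> \<open>The updated function gives coordinate \<open>k\<close> the coefficient
        \<open>s\<close> and scales the others by \<open>u\<close>, so that the two-parameter
        transform is an instance of the hypothesis for \<open>insert k I\<close>.\<close>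
      have "s * U k z + u * (\<Sum>i\<in>I. t i * U i z) = (\<Sum>i\<in>insert k I. ((\<lambda>i. u * t i)(k := s)) i * U i z)"
        "s * Y k w + u * (\<Sum>i\<in>I. t i * Y i w) = (\<Sum>i\<in>insert k I. ((\<lambda>i. u * t i)(k := s)) i * Y i w)" for z w
        using insert.hyps by (auto simp: sum_distrib_left mult.assoc intro!: sum.cong)
      then show "(CLINT z|M. iexp (s * U k z + u * (\<Sum>i\<in>I. t i * U i z))) =
          (CLINT z|N. iexp (s * Y k z + u * (\<Sum>i\<in>I. t i * Y i z)))"
        using insert.prems(6) by simp
    qed (simp_all add: insert.prems(1,2))
    then show "(CLINT z|M'. iexp (\<Sum>i\<in>I. t i * U i z)) = (CLINT z|N'. iexp (\<Sum>i\<in>I. t i * Y i z))"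
      unfolding M'_def N'_def by (subst (1 2) char_indicator_weighted) (simp_all add: insert.prems(1,2))
  qed (simp_all add: M'_def N'_def finite_measure_indicator_weighted insert.prems(1,2))
  moreover have "measure M' {z \<in> space M'. \<forall>i\<in>I. U i z \<in> B i} = measure M {z \<in> space M. \<forall>i\<in>insert k I. U i z \<in> B i}"
  proof -
    have "{z \<in> space M. \<forall>i\<in>I. U i z \<in> B i} \<in> sets M"
      using insert.hyps by (intro sets.sets_Collect_finite_All) simp_all
    then show ?thesis
      unfolding M'_def space_density
      by (subst measure_indicator_weighted) (simp_all add: insert.prems(1) Collect_conj_eq[symmetric] conj_ac)
  qed
  moreover have "measure N' {z \<in> space N'. \<forall>i\<in>I. Y i z \<in> B i} = measure N {z \<in> space N. \<forall>i\<in>insert k I. Y i z \<in> B i}"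
  proof -
    have "{z \<in> space N. \<forall>i\<in>I. Y i z \<in> B i} \<in> sets N"
      using insert.hyps by (intro sets.sets_Collect_finite_All) simp_all
    then show ?thesis
      unfolding N'_def space_density
      by (subst measure_indicator_weighted) (simp_all add: insert.prems(2) Collect_conj_eq[symmetric] conj_ac)
  qed
  ultimately show ?case by simp
qed

section \<open>Gaussian laws with a given covariance kernel\<close>

definition iid_normal :: "(nat \<Rightarrow> real) measure" where
  "iid_normal = PiM UNIV (\<lambda>_. std_normal_distribution)"

lemma prob_space_iid_normal: "prob_space iid_normal"
  unfolding iid_normal_def
  by (intro prob_space_PiM real_distribution.axioms(1) real_dist_normal_dist)

lemma measurable_iid_normal_coordinate: "(\<lambda>z. z j) \<in> borel_measurable iid_normal"
proof -
  have "(\<lambda>z. z j) \<in> measurable iid_normal std_normal_distribution"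
    unfolding iid_normal_def by (rule measurable_component_singleton) simp
  then show ?thesis by simp
qed

lemma distr_iid_normal_coordinate:
  "distr iid_normal std_normal_distribution (\<lambda>z. z j) = std_normal_distribution"
  unfolding iid_normal_def
  by (intro distr_PiM_component real_distribution.axioms(1) real_dist_normal_dist) simp_all

lemma indep_iid_normal:
  "prob_space.indep_vars iid_normal (\<lambda>_. std_normal_distribution) (\<lambda>j z. z j) UNIV"
proof -
  interpret prob_space iid_normal by (rule prob_space_iid_normal)
  have "(\<lambda>z. \<lambda>j\<in>UNIV. z j) = (\<lambda>z :: nat \<Rightarrow> real. z)"
    by (simp add: restrict_def fun_eq_iff)
  then have "distr iid_normal (Pi\<^sub>M UNIV (\<lambda>_. std_normal_distribution)) (\<lambda>z. \<lambda>j\<in>UNIV. z j) =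
      Pi\<^sub>M UNIV (\<lambda>j. distr iid_normal std_normal_distribution (\<lambda>z. z j))"
    unfolding distr_iid_normal_coordinate by (simp add: iid_normal_def)
  moreover have "(\<lambda>z. z j) \<in> measurable iid_normal std_normal_distribution" for j
    using measurable_iid_normal_coordinate by simp
  ultimately show ?thesis by (subst indep_vars_iff_distr_eq_PiM') auto
qed

lemma char_iid_normal:
  assumes "finite J"
  shows "(CLINT z|iid_normal. iexp (\<Sum>j\<in>J. d j * z j)) = exp (- (\<Sum>j\<in>J. (d j)\<^sup>2) / 2)"
proof -
  interpret prob_space iid_normal by (rule prob_space_iid_normal)
  note [measurable] = measurable_iid_normal_coordinate
  have "indep_vars (\<lambda>_. borel) (\<lambda>j z. d j * z j) UNIV"
    by (rule indep_vars_compose2[OF indep_iid_normal]) simp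
  then have ind: "indep_vars (\<lambda>_. borel) (\<lambda>j z. d j * z j) J"
    by (rule indep_vars_subset) simp
  have "char (distr iid_normal borel (\<lambda>z. d j * z j)) 1 = exp (- (d j)\<^sup>2 / 2)" for j
  proof -
    have "char (distr iid_normal borel (\<lambda>z. d j * z j)) 1 = (CLINT z|iid_normal. iexp (d j * z j))"
      unfolding char_def by (subst integral_distr) auto
    also have "\<dots> = (CLINT y|distr iid_normal std_normal_distribution (\<lambda>z. z j). iexp (d j * y))"
      by (subst integral_distr) auto
    also have "\<dots> = char std_normal_distribution (d j)" by (simp add: char_def distr_iid_normal_coordinate)
    finally show ?thesis by (simp add: char_std_normal_distribution exp_of_real)
  qed
  then have "char (distr iid_normal borel (\<lambda>z. \<Sum>j\<in>J. d j * z j)) 1 = (\<Prod>j\<in>J. exp (- (d j)\<^sup>2 / 2))"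
    using char_distr_sum[OF ind, of 1] by simp
  moreover have "char (distr iid_normal borel (\<lambda>z. \<Sum>j\<in>J. d j * z j)) 1 =
      (CLINT z|iid_normal. iexp (\<Sum>j\<in>J. d j * z j))"
    unfolding char_def by (subst integral_distr) auto
  ultimately show ?thesis
    using assms by (simp add: exp_sum[symmetric] sum_negf sum_divide_distrib[symmetric])
qed

text \<open>Centred Gaussian process with covariance \<open>K\<close>, described by the
  characteristic functions of its finite linear combinations. In this form existence, uniqueness and
  invariance become computations with exponents.\<close>

definition gaussian_law :: "'a set \<Rightarrow> ('a \<Rightarrow> 'a \<Rightarrow> real) \<Rightarrow> ('a \<Rightarrow> real) measure \<Rightarrow> bool" where
  "gaussian_law A K L \<longleftrightarrow> prob_space L \<and> sets L = sets (PiM A (\<lambda>_. borel)) \<and>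
    (\<forall>F t. finite F \<and> F \<subseteq> A \<longrightarrow>
      (CLINT w|L. iexp (\<Sum>x\<in>F. t x * w x)) = exp (- (\<Sum>x\<in>F. \<Sum>y\<in>F. t x * t y * K x y) / 2))"

lemma gaussian_law_char:
  "gaussian_law A K L \<Longrightarrow> finite F \<Longrightarrow> F \<subseteq> A \<Longrightarrow>
    (CLINT w|L. iexp (\<Sum>x\<in>F. t x * w x)) = exp (- (\<Sum>x\<in>F. \<Sum>y\<in>F. t x * t y * K x y) / 2)"
  unfolding gaussian_law_def by blast

text \<open>The variable at \<open>x\<close> is a finite combination \<open>Z x\<close> of i.i.d.
  normal variables, with row \<open>x\<close> of the factor as coefficients; the covariances
  multiply out to \<open>K\<close>.\<close>

lemma gaussian_law_exists:
  assumes "countable A" "infinite A" "psd_on A K"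
  obtains L where "gaussian_law A K L"
proof -
  obtain J a where "kernel_factor A K J a" using kernel_factor_exists[OF assms] .
  then have fin: "\<And>x. x \<in> A \<Longrightarrow> finite {j. a x j \<noteq> 0}"
    and K: "\<And>x y. x \<in> A \<Longrightarrow> y \<in> A \<Longrightarrow> K x y = (\<Sum>j\<in>{j. a x j \<noteq> 0}. a x j * a y j)"
    unfolding kernel_factor_def by blast+
  define Z where "Z = (\<lambda>x z. \<Sum>j\<in>{j. a x j \<noteq> 0}. a x j * z j)"
  define L where "L = distr iid_normal (PiM A (\<lambda>_. borel)) (\<lambda>z. \<lambda>x\<in>A. Z x z)"
  interpret prob_space iid_normal by (rule prob_space_iid_normal)
  note [measurable] = measurable_iid_normal_coordinate
  have [measurable]: "Z x \<in> borel_measurable iid_normal" for x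
    unfolding Z_def by measurable
  have "(CLINT w|L. iexp (\<Sum>x\<in>F. t x * w x)) = exp (- (\<Sum>x\<in>F. \<Sum>y\<in>F. t x * t y * K x y) / 2)"
    if F: "finite F" "F \<subseteq> A" for F t
  proof -
    define I where "I = (\<Union>x\<in>F. {j. a x j \<noteq> 0})"
    define d where "d = (\<lambda>j. \<Sum>x\<in>F. t x * a x j)"
    have I: "finite I" using F fin by (auto simp: I_def)
    have [measurable]: "(\<lambda>w. w x) \<in> borel_measurable (PiM A (\<lambda>_. borel))" if "x \<in> F" for x
      using F that by (intro measurable_component_singleton) auto
    have "(CLINT w|L. iexp (\<Sum>x\<in>F. t x * w x)) = (CLINT z|iid_normal. iexp (\<Sum>x\<in>F. t x * (\<lambda>x\<in>A. Z x z) x))"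
      unfolding L_def by (intro integral_distr) auto
    also have "\<dots> = (CLINT z|iid_normal. iexp (\<Sum>j\<in>I. d j * z j))"
    proof (intro Bochner_Integration.integral_cong refl arg_cong[of _ _ "\<lambda>r. iexp r"])
      fix z
      have "(\<Sum>x\<in>F. t x * (\<lambda>x\<in>A. Z x z) x) = (\<Sum>x\<in>F. \<Sum>j\<in>I. t x * a x j * z j)"
      proof (rule sum.cong[OF refl])
        fix x assume x: "x \<in> F"
        then have "Z x z = (\<Sum>j\<in>I. a x j * z j)"
          unfolding Z_def using I by (intro sum.mono_neutral_left) (auto simp: I_def)
        then show "t x * (\<lambda>x\<in>A. Z x z) x = (\<Sum>j\<in>I. t x * a x j * z j)"
          using x F by (auto simp: sum_distrib_left mult.assoc)
      qed
      also have "\<dots> = (\<Sum>j\<in>I. \<Sum>x\<in>F. t x * a x j * z j)" by (rule sum.swap)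
      finally show "(\<Sum>x\<in>F. t x * (\<lambda>x\<in>A. Z x z) x) = (\<Sum>j\<in>I. d j * z j)"
        by (simp add: d_def sum_distrib_right)
    qed
    also have "\<dots> = exp (- (\<Sum>j\<in>I. (d j)\<^sup>2) / 2)" by (rule char_iid_normal[OF I])
    also have "(\<Sum>j\<in>I. (d j)\<^sup>2) = (\<Sum>x\<in>F. \<Sum>y\<in>F. t x * t y * K x y)"
    proof -
      have "(\<Sum>j\<in>I. (d j)\<^sup>2) = (\<Sum>j\<in>I. \<Sum>x\<in>F. \<Sum>y\<in>F. t x * t y * (a x j * a y j))"
        by (simp add: d_def power2_eq_square sum_product mult_ac)
      also have "\<dots> = (\<Sum>x\<in>F. \<Sum>j\<in>I. \<Sum>y\<in>F. t x * t y * (a x j * a y j))" by (rule sum.swap)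
      also have "\<dots> = (\<Sum>x\<in>F. \<Sum>y\<in>F. \<Sum>j\<in>I. t x * t y * (a x j * a y j))"
        by (intro sum.cong refl sum.swap)
      also have "\<dots> = (\<Sum>x\<in>F. \<Sum>y\<in>F. t x * t y * K x y)"
      proof (intro sum.cong refl)
        fix x y assume "x \<in> F" "y \<in> F"
        moreover from this have "K x y = (\<Sum>j\<in>I. a x j * a y j)"
          using F I by (subst K) (auto simp: I_def intro!: sum.mono_neutral_left)
        ultimately show "(\<Sum>j\<in>I. t x * t y * (a x j * a y j)) = t x * t y * K x y"
          by (simp add: sum_distrib_left)
      qed
      finally show ?thesis .
    qed
    finally show ?thesis .
  qed
  moreover have "prob_space L" unfolding L_def by (rule prob_space_distr) simp
  moreover have "sets L = sets (PiM A (\<lambda>_. borel))" by (simp add: L_def)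
  ultimately have "gaussian_law A K L" by (simp add: gaussian_law_def)
  then show thesis by (rule that)
qed

lemma gaussian_law_measurable:
  assumes "gaussian_law A K L" "x \<in> A"
  shows "(\<lambda>w. w x) \<in> borel_measurable L"
proof -
  have "sets L = sets (PiM A (\<lambda>_. borel))" using assms by (simp add: gaussian_law_def)
  then have "measurable L borel = (measurable (PiM A (\<lambda>_. borel)) borel :: (_ \<Rightarrow> real) set)"
    by (rule measurable_cong_sets) simp
  then show ?thesis using assms(2) measurable_component_singleton[of x A "\<lambda>_. borel"] by simp
qed

text \<open>Rectangles over finitely many coordinates determine a measure on the product, and the
  characteristic functions fix their measure.\<close>

lemma gaussian_law_unique:
  assumes L: "gaussian_law A K L" and L': "gaussian_law A K L'"
  shows "L = L'"
proof (rule measure_eqI_PiM_infinite)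
  show "sets L = sets (PiM A (\<lambda>_. borel))" "sets L' = sets (PiM A (\<lambda>_. borel))"
    using L L' by (simp_all add: gaussian_law_def)
  interpret L: prob_space L using L by (simp add: gaussian_law_def)
  interpret L': prob_space L' using L' by (simp add: gaussian_law_def)
  show "finite_measure L" by unfold_locales
  fix B :: "_ \<Rightarrow> real set" and I
  assume I: "finite I" "I \<subseteq> A" and B: "\<And>i. i \<in> I \<Longrightarrow> B i \<in> sets borel"
  have sp: "space L = space (PiM A (\<lambda>_. borel))" "space L' = space (PiM A (\<lambda>_. borel))"
    using L L' by (auto simp: gaussian_law_def dest: sets_eq_imp_space_eq)
  have emb: "prod_emb A (\<lambda>_. borel) I (Pi\<^sub>E I B) = {z \<in> space (PiM A (\<lambda>_. borel)). \<forall>i\<in>I. z i \<in> B i}"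
    using I by (auto simp: prod_emb_def space_PiM)
  have "measure L {z \<in> space L. \<forall>i\<in>I. z i \<in> B i} = measure L' {z \<in> space L'. \<forall>i\<in>I. z i \<in> B i}"
  proof (rule char_eq_imp_rectangle_eq)
    fix t
    show "(CLINT z|L. iexp (\<Sum>i\<in>I. t i * z i)) = (CLINT z|L'. iexp (\<Sum>i\<in>I. t i * z i))"
      by (simp only: gaussian_law_char[OF L I] gaussian_law_char[OF L' I])
  qed (use I B gaussian_law_measurable[OF L] gaussian_law_measurable[OF L'] in auto)
  then show "emeasure L (prod_emb A (\<lambda>_. borel) I (Pi\<^sub>E I B)) =
      emeasure L' (prod_emb A (\<lambda>_. borel) I (Pi\<^sub>E I B))"
    unfolding emb L.emeasure_eq_measure L'.emeasure_eq_measure sp by simp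
qed

lemma gaussian_law_invariant:
  fixes K :: "'a \<Rightarrow> 'a \<Rightarrow> real"
  assumes L: "gaussian_law A K L" and f: "inj_on f A" "f ` A \<subseteq> A"
    and K: "\<And>x y. x \<in> A \<Longrightarrow> y \<in> A \<Longrightarrow> K (f x) (f y) = K x y"
  shows "distr L L (\<lambda>w. \<lambda>x\<in>A. w (f x)) = L"
proof (rule gaussian_law_unique[OF _ L])
  interpret prob_space L using L by (simp add: gaussian_law_def)
  have s: "sets L = sets (PiM A (\<lambda>_. borel))" using L by (simp add: gaussian_law_def)
  have [measurable]: "(\<lambda>w. \<lambda>x\<in>A. w (f x)) \<in> measurable L L"
  proof -
    have "(\<lambda>w. \<lambda>x\<in>A. w (f x)) \<in> measurable L (PiM A (\<lambda>_. borel))"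
      using f by (intro measurable_restrict gaussian_law_measurable[OF L]) auto
    then show ?thesis using measurable_cong_sets[OF refl s] by blast
  qed
  show "gaussian_law A K (distr L L (\<lambda>w. \<lambda>x\<in>A. w (f x)))"
    unfolding gaussian_law_def
  proof (intro conjI allI impI)
    show "prob_space (distr L L (\<lambda>w. \<lambda>x\<in>A. w (f x)))" by (rule prob_space_distr) simp
    show "sets (distr L L (\<lambda>w. \<lambda>x\<in>A. w (f x))) = sets (PiM A (\<lambda>_. borel))" using s by simp
    fix F and t :: "'a \<Rightarrow> real"
    assume F: "finite F \<and> F \<subseteq> A"
    then have inj: "inj_on f F" using f inj_on_subset by blast
    have m: "(\<lambda>w. w x) \<in> borel_measurable L" if "x \<in> F" for x
      using F that by (intro gaussian_law_measurable[OF L]) auto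
    \<comment> \<open>The coefficients are moved along \<open>f\<close>; injectivity on
      \<open>F\<close> keeps them from being merged.\<close>
    define t' where "t' = (\<lambda>y. t (the_inv_into F f y))"
    have "(CLINT w|distr L L (\<lambda>w. \<lambda>x\<in>A. w (f x)). iexp (\<Sum>x\<in>F. t x * w x)) =
        (CLINT w|L. iexp (\<Sum>x\<in>F. t x * (\<lambda>x\<in>A. w (f x)) x))"
      using m by (intro integral_distr) (auto intro!: borel_measurable_sum borel_measurable_times)
    also have "\<dots> = (CLINT w|L. iexp (\<Sum>x\<in>f`F. t' x * w x))"
    proof (intro Bochner_Integration.integral_cong refl arg_cong[of _ _ "\<lambda>r. iexp r"])
      fix w :: "'a \<Rightarrow> real"
      have "(\<Sum>x\<in>f`F. t' x * w x) = (\<Sum>x\<in>F. t x * w (f x))"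
        using inj by (simp add: sum.reindex t'_def the_inv_into_f_f)
      also have "\<dots> = (\<Sum>x\<in>F. t x * (\<lambda>x\<in>A. w (f x)) x)"
        using F by (intro sum.cong refl) auto
      finally show "(\<Sum>x\<in>F. t x * (\<lambda>x\<in>A. w (f x)) x) = (\<Sum>x\<in>f`F. t' x * w x)" by simp
    qed
    also have "\<dots> = exp (- (\<Sum>x\<in>f`F. \<Sum>y\<in>f`F. t' x * t' y * K x y) / 2)"
      using F f by (intro gaussian_law_char[OF L]) auto
    also have "(\<Sum>x\<in>f`F. \<Sum>y\<in>f`F. t' x * t' y * K x y) = (\<Sum>x\<in>F. \<Sum>y\<in>F. t x * t y * K x y)"
    proof -
      have "(\<Sum>x\<in>f`F. \<Sum>y\<in>f`F. t' x * t' y * K x y) = (\<Sum>x\<in>F. \<Sum>y\<in>F. t x * t y * K (f x) (f y))"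
        using inj by (simp add: sum.reindex t'_def the_inv_into_f_f)
      also have "\<dots> = (\<Sum>x\<in>F. \<Sum>y\<in>F. t x * t y * K x y)"
        using F by (intro sum.cong refl) (simp add: K subset_iff)
      finally show ?thesis .
    qed
    finally show "(CLINT w|distr L L (\<lambda>w. \<lambda>x\<in>A. w (f x)). iexp (\<Sum>x\<in>F. t x * w x)) =
      exp (- (\<Sum>x\<in>F. \<Sum>y\<in>F. t x * t y * K x y) / 2)" .
  qed
qed

text \<open>Stating the law as that of \<open>\<sigma> * z\<close> covers degenerate increments,
  where \<open>\<sigma> = 0\<close> and there is no density. The case \<open>x = y\<close> is
  separate because \<open>{x, y}\<close> is then a singleton.\<close>

lemma gaussian_law_increment:
  assumes L: "gaussian_law A K L" and xy: "x \<in> A" "y \<in> A" and sym: "K y x = K x y"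
    and \<sigma>: "\<sigma>\<^sup>2 = K x x - 2 * K x y + K y y"
  shows "distr L borel (\<lambda>w. w x - w y) = distr std_normal_distribution borel (\<lambda>z. \<sigma> * z)"
proof -
  interpret prob_space L using L by (simp add: gaussian_law_def)
  interpret N: real_distribution std_normal_distribution by (rule real_dist_normal_dist)
  have [measurable]: "(\<lambda>w. w x) \<in> borel_measurable L" "(\<lambda>w. w y) \<in> borel_measurable L"
    using gaussian_law_measurable[OF L] xy by auto
  show ?thesis
  proof (rule Levy_uniqueness)
    show "real_distribution (distr L borel (\<lambda>w. w x - w y))" by (rule real_distribution_distr) simp
    show "real_distribution (distr std_normal_distribution borel (\<lambda>z. \<sigma> * z))"
      by (rule N.real_distribution_distr) simp
    show "char (distr L borel (\<lambda>w. w x - w y)) = char (distr std_normal_distribution borel (\<lambda>z. \<sigma> * z))"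
    proof
      fix t
      have "char (distr L borel (\<lambda>w. w x - w y)) t = (CLINT w|L. iexp (t * (w x - w y)))"
        unfolding char_def by (subst integral_distr) auto
      also have "\<dots> = exp (- (\<sigma> * t)\<^sup>2 / 2)"
      proof (cases "x = y")
        case True
        then show ?thesis using \<sigma> by (simp add: prob_space)
      next
        case False
        define u where "u = (\<lambda>z. if z = x then t else - t)"
        have "(CLINT w|L. iexp (t * (w x - w y))) = (CLINT w|L. iexp (\<Sum>z\<in>{x,y}. u z * w z))"
          using False by (simp add: u_def algebra_simps)
        also have "\<dots> = exp (- (\<Sum>z\<in>{x,y}. \<Sum>z'\<in>{x,y}. u z * u z' * K z z') / 2)"
          using xy by (intro gaussian_law_char[OF L]) auto
        also have "(\<Sum>z\<in>{x,y}. \<Sum>z'\<in>{x,y}. u z * u z' * K z z') = (\<sigma> * t)\<^sup>2"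
          using False sym by (simp add: u_def power_mult_distrib \<sigma>) (simp add: power2_eq_square algebra_simps)
        finally show ?thesis .
      qed
      also have "\<dots> = char std_normal_distribution (\<sigma> * t)"
        by (simp add: char_std_normal_distribution exp_of_real)
      also have "\<dots> = char (distr std_normal_distribution borel (\<lambda>z. \<sigma> * z)) t"
        unfolding char_def by (subst integral_distr) (auto simp: mult_ac)
      finally show "char (distr L borel (\<lambda>w. w x - w y)) t = char (distr std_normal_distribution borel (\<lambda>z. \<sigma> * z)) t" .
    qed
  qed
qed

text \<open>The mean absolute value of a standard normal variable is \<open>sqrt (2 / pi)\<close>,
  which is below 1. This linear dependence on \<open>\<sigma>\<close> makes the total cost of all
  coordinates summable.\<close>

lemma gaussian_law_mean_increment:
  assumes "gaussian_law A K L" "x \<in> A" "y \<in> A" "K y x = K x y"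
    and "\<sigma>\<^sup>2 = K x x - 2 * K x y + K y y" "\<sigma> \<ge> 0"
  shows "(\<integral>\<^sup>+w. ennreal \<bar>w x - w y\<bar> \<partial>L) \<le> ennreal \<sigma>"
proof -
  have [measurable]: "(\<lambda>w. w x) \<in> borel_measurable L" "(\<lambda>w. w y) \<in> borel_measurable L"
    using gaussian_law_measurable[OF assms(1)] assms by auto
  have "(\<integral>\<^sup>+w. ennreal \<bar>w x - w y\<bar> \<partial>L) = (\<integral>\<^sup>+r. ennreal \<bar>r\<bar> \<partial>distr L borel (\<lambda>w. w x - w y))"
    by (subst nn_integral_distr) auto
  also have "\<dots> = (\<integral>\<^sup>+z. ennreal \<bar>\<sigma> * z\<bar> \<partial>std_normal_distribution)"
    by (subst gaussian_law_increment[OF assms(1-5)], subst nn_integral_distr) auto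
  also have "\<dots> = ennreal \<sigma> * (\<integral>\<^sup>+z. ennreal \<bar>z\<bar> \<partial>std_normal_distribution)"
    using assms(6) by (subst nn_integral_cmult[symmetric]) (auto simp: abs_mult ennreal_mult)
  also have "(\<integral>\<^sup>+z. ennreal \<bar>z\<bar> \<partial>std_normal_distribution) = ennreal (sqrt (2 / pi))"
  proof -
    have "integrable std_normal_distribution (\<lambda>z. \<bar>z\<bar>)"
      using integrable_std_normal_distribution_moment[of 1] by simp
    then show ?thesis
      using std_normal_distribution_odd_moments_abs[of 0] by (subst nn_integral_eq_integral) auto
  qed
  also have "ennreal \<sigma> * ennreal (sqrt (2 / pi)) \<le> ennreal \<sigma> * 1"
  proof (rule mult_left_mono)
    have "sqrt (2 / pi) \<le> sqrt 1" using pi_ge_two by (intro real_sqrt_le_mono) simp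
    then show "ennreal (sqrt (2 / pi)) \<le> 1" by simp
  qed simp
  finally show ?thesis by simp
qed

text \<open>The standard normal density is at most \<open>1 / sqrt (2 * pi)\<close>, hence at most
  1/2, and the normalised increment has to hit an interval of length
  \<open>2 / \<sigma>\<close>.\<close>

lemma gaussian_law_small_increment:
  assumes "gaussian_law A K L" "x \<in> A" "y \<in> A" "K y x = K x y"
    and "\<sigma>\<^sup>2 = K x x - 2 * K x y + K y y" "\<sigma> > 0"
  shows "measure L {w \<in> space L. \<bar>w x - w y\<bar> < 1} \<le> 1 / \<sigma>"
proof -
  interpret N: real_distribution std_normal_distribution by (rule real_dist_normal_dist)
  have [measurable]: "(\<lambda>w. w x) \<in> borel_measurable L" "(\<lambda>w. w y) \<in> borel_measurable L"
    using gaussian_law_measurable[OF assms(1)] assms by auto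
  let ?I = "{-1/\<sigma> .. 1/\<sigma>}"
  have "measure L {w \<in> space L. \<bar>w x - w y\<bar> < 1} = measure (distr L borel (\<lambda>w. w x - w y)) {r. \<bar>r\<bar> < 1}"
    by (subst measure_distr) (auto intro!: arg_cong[of _ _ "measure L"])
  also have "\<dots> = measure std_normal_distribution {z. \<bar>\<sigma> * z\<bar> < 1}"
    by (subst gaussian_law_increment[OF assms(1-5)], subst measure_distr)
       (auto intro!: arg_cong[of _ _ "measure std_normal_distribution"])
  also have "\<dots> \<le> measure std_normal_distribution ?I"
    using assms(6) by (intro N.finite_measure_mono) (auto simp: abs_less_iff field_simps)
  also have "\<dots> \<le> 1 / \<sigma>"
  proof -
    have "emeasure std_normal_distribution ?I = (\<integral>\<^sup>+z. ennreal (std_normal_density z) * indicator ?I z \<partial>lborel)"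
      by (rule emeasure_density) auto
    also have "\<dots> \<le> (\<integral>\<^sup>+z. ennreal (1/2) * indicator ?I z \<partial>lborel)"
    proof (intro nn_integral_mono mult_right_mono ennreal_leI)
      fix z :: real
      have "2 \<le> sqrt (2 * pi)" using pi_ge_two by (intro real_le_rsqrt) (simp add: power2_eq_square)
      then have "1 / sqrt (2 * pi) \<le> 1 / 2" by (intro divide_left_mono) auto
      moreover have "exp (- z\<^sup>2 / 2) \<le> 1" by simp
      ultimately have "1 / sqrt (2 * pi) * exp (- z\<^sup>2 / 2) \<le> 1 / 2 * 1" by (intro mult_mono) auto
      then show "std_normal_density z \<le> 1/2" by (simp add: std_normal_density_def)
    qed simp
    also have "\<dots> = ennreal (1 / 2) * ennreal (2 / \<sigma>)"
      using assms(6) by (subst nn_integral_cmult_indicator) (auto simp: field_simps)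
    also have "\<dots> = ennreal (1 / \<sigma>)" using assms(6)
      by (subst ennreal_mult[symmetric]) (auto intro!: arg_cong[of _ _ ennreal])
    finally show ?thesis using assms(6) by (simp add: N.emeasure_eq_measure)
  qed
  finally show ?thesis .
qed

section \<open>Unbounded almost invariant vectors\<close>

context complex_hilbert_space
begin

lemma ring_of_type_algebra_simps [simp]:
  "carrier (ring_of_type_algebra :: complex ring) = UNIV"
  "\<zero>\<^bsub>(ring_of_type_algebra :: complex ring)\<^esub> = 0"
  "\<one>\<^bsub>(ring_of_type_algebra :: complex ring)\<^esub> = 1"
  "x \<oplus>\<^bsub>(ring_of_type_algebra :: complex ring)\<^esub> y = x + y"
  "x \<otimes>\<^bsub>(ring_of_type_algebra :: complex ring)\<^esub> y = x * y"
  by (simp_all add: ring_of_type_algebra_def)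

lemma ip_add_left:
  "x \<in> carrier V \<Longrightarrow> y \<in> carrier V \<Longrightarrow> z \<in> carrier V \<Longrightarrow> ip V (x \<oplus> y) z = ip V x z + ip V y z"
  using ip_commute[of z "x \<oplus> y"] ip_commute[of z x] ip_commute[of z y] ip_add[of z x y] by simp

lemma ip_smult_left:
  "x \<in> carrier V \<Longrightarrow> y \<in> carrier V \<Longrightarrow> ip V (c \<odot> x) y = cnj c * ip V x y"
  using ip_commute[of y "c \<odot> x"] ip_commute[of y x] ip_smult[of y x c] by simp

lemma ip_zero_right: "x \<in> carrier V \<Longrightarrow> ip V x \<zero> = 0"
  using ip_add[of x "\<zero>" "\<zero>"] by simp

lemma ip_minus_right:
  "x \<in> carrier V \<Longrightarrow> y \<in> carrier V \<Longrightarrow> z \<in> carrier V \<Longrightarrow> ip V x (y \<ominus> z) = ip V x y - ip V x z"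
  using ip_add[of x z "\<ominus> z"] ip_add[of x y "\<ominus> z"] ip_zero_right[of x]
  by (simp add: a_minus_def M.r_neg add_eq_0_iff2)

lemma ip_minus_left:
  "x \<in> carrier V \<Longrightarrow> y \<in> carrier V \<Longrightarrow> z \<in> carrier V \<Longrightarrow> ip V (x \<ominus> y) z = ip V x z - ip V y z"
  using ip_commute[of z "x \<ominus> y"] ip_commute[of z x] ip_commute[of z y] ip_minus_right[of z x y] by simp

lemma ip_self_nonneg: "x \<in> carrier V \<Longrightarrow> 0 \<le> Re (ip V x x)"
  using ip_pos[of x] ip_zero_right[of x] by (cases "x = \<zero>") auto

lemma hnorm_power2: "x \<in> carrier V \<Longrightarrow> (hnorm V x)\<^sup>2 = Re (ip V x x)"
  by (simp add: hnorm_def ip_self_nonneg)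

lemma hnorm_nonneg: "x \<in> carrier V \<Longrightarrow> 0 \<le> hnorm V x"
  by (simp add: hnorm_def ip_self_nonneg)

lemma Re_ip_commute: "x \<in> carrier V \<Longrightarrow> y \<in> carrier V \<Longrightarrow> Re (ip V x y) = Re (ip V y x)"
  using ip_commute[of x y] by simp

lemma hnorm_minus_power2:
  assumes "x \<in> carrier V" "y \<in> carrier V"
  shows "(hnorm V (x \<ominus> y))\<^sup>2 = Re (ip V x x) - 2 * Re (ip V x y) + Re (ip V y y)"
  using assms Re_ip_commute[of x y]
  by (simp add: hnorm_power2 ip_minus_left ip_minus_right)

lemma hnorm_smult_real:
  assumes "x \<in> carrier V"
  shows "hnorm V (complex_of_real r \<odot> x) = \<bar>r\<bar> * hnorm V x"
proof -
  have "ip V (complex_of_real r \<odot> x) (complex_of_real r \<odot> x) = complex_of_real (r * r) * ip V x x"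
    using assms by (simp add: ip_smult ip_smult_left)
  then show ?thesis
    by (simp add: hnorm_def real_sqrt_mult)
qed

text \<open>Cauchy-Schwarz for the real inner product: the squared norm of \<open>x\<close> plus
  \<open>t\<close> times \<open>y\<close> is a nonnegative polynomial in \<open>t\<close>. It is
  evaluated at its minimum or, if the leading coefficient vanishes, at a point where a non-constant
  affine polynomial would be -1.\<close>

lemma abs_Re_ip_le:
  assumes "x \<in> carrier V" "y \<in> carrier V"
  shows "\<bar>Re (ip V x y)\<bar> \<le> hnorm V x * hnorm V y"
proof -
  have q: "0 \<le> Re (ip V x x) + 2 * t * Re (ip V x y) + t\<^sup>2 * Re (ip V y y)" for t
  proof -
    let ?w = "x \<oplus> complex_of_real t \<odot> y"
    have "Re (ip V ?w ?w) = Re (ip V x x) + 2 * t * Re (ip V x y) + t\<^sup>2 * Re (ip V y y)"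
      using assms Re_ip_commute[of x y]
      by (simp add: ip_add ip_add_left ip_smult ip_smult_left power2_eq_square algebra_simps)
    moreover have "0 \<le> Re (ip V ?w ?w)" using assms by (intro ip_self_nonneg) simp
    ultimately show ?thesis by simp
  qed
  have "(Re (ip V x y))\<^sup>2 \<le> Re (ip V x x) * Re (ip V y y)"
  proof (cases "Re (ip V y y) = 0")
    case True
    have "Re (ip V x y) = 0"
    proof (rule ccontr)
      assume nz: "Re (ip V x y) \<noteq> 0"
      show False
        using q[of "- (Re (ip V x x) + 1) / (2 * Re (ip V x y))"] True nz by (simp add: field_simps)
    qed
    then show ?thesis using True by simp
  next
    case False
    then have p: "Re (ip V y y) > 0" using ip_self_nonneg[OF assms(2)] by simp
    then show ?thesis
      using q[of "- Re (ip V x y) / Re (ip V y y)"] by (simp add: field_simps power2_eq_square)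
  qed
  then have "sqrt ((Re (ip V x y))\<^sup>2) \<le> sqrt (Re (ip V x x) * Re (ip V y y))"
    by (rule real_sqrt_le_mono)
  then show ?thesis by (simp add: hnorm_def real_sqrt_mult)
qed

lemma hnorm_triangle_minus:
  assumes "x \<in> carrier V" "y \<in> carrier V"
  shows "hnorm V x \<le> hnorm V (x \<ominus> y) + hnorm V y"
proof (rule power2_le_imp_le)
  let ?d = "x \<ominus> y"
  have "(hnorm V x)\<^sup>2 = (hnorm V ?d)\<^sup>2 + 2 * Re (ip V ?d y) + (hnorm V y)\<^sup>2"
    using assms Re_ip_commute[of x y]
    by (simp add: hnorm_minus_power2) (simp add: hnorm_power2 ip_minus_left)
  also have "\<dots> \<le> (hnorm V ?d)\<^sup>2 + 2 * (hnorm V ?d * hnorm V y) + (hnorm V y)\<^sup>2"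
    using abs_Re_ip_le[of ?d y] assms by (simp add: abs_le_iff)
  finally show "(hnorm V x)\<^sup>2 \<le> (hnorm V ?d + hnorm V y)\<^sup>2"
    by (simp add: power2_sum algebra_simps)
  show "0 \<le> hnorm V ?d + hnorm V y" using assms by (simp add: hnorm_nonneg)
qed

lemma hnorm_eq_0: "x \<in> carrier V \<Longrightarrow> hnorm V x = 0 \<Longrightarrow> x = \<zero>"
  using ip_pos[of x] by (auto simp: hnorm_def)

lemma Re_ip_finsum:
  assumes "finite F" "v \<in> F \<rightarrow> carrier V" "w \<in> carrier V"
  shows "Re (ip V w (\<Oplus>x\<in>F. complex_of_real (c x) \<odot> v x)) = (\<Sum>x\<in>F. c x * Re (ip V w (v x)))"
  using assms(1,2)
proof (induction F)
  case empty
  then show ?case using assms(3) by (simp add: ip_zero_right)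
next
  case (insert a F)
  have "(\<lambda>x. complex_of_real (c x) \<odot> v x) \<in> F \<rightarrow> carrier V" "complex_of_real (c a) \<odot> v a \<in> carrier V"
    using insert.prems by (auto simp: Pi_iff)
  then show ?case
    using insert assms(3) by (simp add: M.finsum_insert ip_add ip_smult Pi_iff)
qed

text \<open>With real coefficients the form is the squared norm of a linear combination; taking
  \<open>Re\<close> gives the real covariance that a real Gaussian process needs.\<close>

lemma psd_on_ip:
  assumes v: "v \<in> A \<rightarrow> carrier V"
  shows "psd_on A (\<lambda>x y. Re (ip V (v x) (v y)))"
  unfolding psd_on_def
proof (intro conjI allI impI ballI)
  fix F c
  assume F: "finite F \<and> F \<subseteq> A"
  let ?w = "\<Oplus>x\<in>F. complex_of_real (c x) \<odot> v x"
  have vF: "v \<in> F \<rightarrow> carrier V" using v F by auto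
  then have w: "?w \<in> carrier V" by (intro M.finsum_closed) (auto simp: Pi_iff)
  have "0 \<le> Re (ip V ?w ?w)" by (rule ip_self_nonneg[OF w])
  also have "\<dots> = (\<Sum>x\<in>F. c x * Re (ip V ?w (v x)))" using F vF w by (intro Re_ip_finsum) auto
  also have "\<dots> = (\<Sum>x\<in>F. \<Sum>y\<in>F. c x * c y * Re (ip V (v x) (v y)))"
  proof (rule sum.cong[OF refl])
    fix x assume x: "x \<in> F"
    then have vx: "v x \<in> carrier V" using vF by auto
    have "Re (ip V ?w (v x)) = Re (ip V (v x) ?w)" using vx w by (intro Re_ip_commute)
    also have "\<dots> = (\<Sum>y\<in>F. c y * Re (ip V (v x) (v y)))" using F vF vx by (intro Re_ip_finsum) auto
    finally show "c x * Re (ip V ?w (v x)) = (\<Sum>y\<in>F. c x * c y * Re (ip V (v x) (v y)))"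
      by (simp add: sum_distrib_left mult.assoc)
  qed
  finally show "0 \<le> (\<Sum>x\<in>F. \<Sum>y\<in>F. c x * c y * Re (ip V (v x) (v y)))" .
qed (use v Re_ip_commute in auto)

end

text \<open>Stands in for the closed convex hull: the parallelogram law only uses midpoints, and a
  minimising sequence replaces closedness.\<close>

inductive_set midpoint_hull :: "('v, 'm) inner_module_scheme \<Rightarrow> 'v set \<Rightarrow> 'v set"
  for V and B where
  base: "x \<in> B \<Longrightarrow> x \<in> midpoint_hull V B"
| mid: "x \<in> midpoint_hull V B \<Longrightarrow> y \<in> midpoint_hull V B \<Longrightarrow>
    (1 / 2) \<odot>\<^bsub>V\<^esub> (x \<oplus>\<^bsub>V\<^esub> y) \<in> midpoint_hull V B"

context complex_hilbert_space
begin

lemma midpoint_hull_closed: "x \<in> midpoint_hull V B \<Longrightarrow> B \<subseteq> carrier V \<Longrightarrow> x \<in> carrier V"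
  by (induction rule: midpoint_hull.induct) auto

text \<open>By the parallelogram law, two vectors whose norms almost attain the infimum over a
  midpoint-convex set are close to each other.\<close>

lemma hnorm_minus_near_infimum:
  assumes "x \<in> carrier V" "y \<in> carrier V"
    and m: "m \<le> Re (ip V ((1/2) \<odot> (x \<oplus> y)) ((1/2) \<odot> (x \<oplus> y)))"
    and "Re (ip V x x) \<le> m + \<delta>" "Re (ip V y y) \<le> m + \<delta>"
  shows "(hnorm V (x \<ominus> y))\<^sup>2 \<le> 4 * \<delta>"
proof -
  have "Re (ip V ((1/2) \<odot> (x \<oplus> y)) ((1/2) \<odot> (x \<oplus> y))) =
      (Re (ip V x x) + 2 * Re (ip V x y) + Re (ip V y y)) / 4"
    using assms(1,2) Re_ip_commute[of x y]
    by (simp add: ip_smult ip_smult_left ip_add ip_add_left) (simp add: field_simps)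
  then show ?thesis
    using assms hnorm_minus_power2[of x y] by simp
qed

text \<open>Vectors of almost minimal norm in the midpoint hull of the \<open>H\<close>-orbit of
  \<open>\<phi>\<close> form a Cauchy sequence. Its limit is fixed, since each
  \<open>\<pi> h\<close> preserves the hull and the norm, and it is not zero, since the lower bound
  \<open>r\<close> for \<open>Re (ip V \<phi> x)\<close> passes from the orbit to midpoints and to
  the limit.\<close>

lemma nonzero_invariant_vectorI:
  assumes rep: "unitary_representation G V \<pi>" and H: "subgroup H G"
    and \<phi>: "\<phi> \<in> carrier V" and r: "r > 0" and ge: "\<And>h. h \<in> H \<Longrightarrow> r \<le> Re (ip V \<phi> (\<pi> h \<phi>))"
  shows "nonzero_invariant_vector H V \<pi>"
proof -
  interpret act: group_action G "carrier V" \<pi> using rep by (simp add: unitary_representation_def)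
  interpret G: group G using act.group_hom by (simp add: group_hom_def)
  have HG: "h \<in> H \<Longrightarrow> h \<in> carrier G" for h using H subgroup.subset by blast
  have U: "unitary_operator V (\<pi> g)" if "g \<in> carrier G" for g
    using rep that by (simp add: unitary_representation_def)
  have cl: "\<pi> g x \<in> carrier V" if "g \<in> carrier G" "x \<in> carrier V" for g x
    using that by (rule act.element_image) simp
  have Uip: "ip V (\<pi> g x) (\<pi> g y) = ip V x y" if "g \<in> carrier G" "x \<in> carrier V" "y \<in> carrier V" for g x y
    using U[OF that(1)] that by (simp add: unitary_operator_def)
  have Uadd: "\<pi> g (x \<oplus> y) = \<pi> g x \<oplus> \<pi> g y" if "g \<in> carrier G" "x \<in> carrier V" "y \<in> carrier V" for g x y
    using U[OF that(1)] that by (simp add: unitary_operator_def)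
  have Usm: "\<pi> g (c \<odot> x) = c \<odot> \<pi> g x" if "g \<in> carrier G" "x \<in> carrier V" for g c x
    using U[OF that(1)] that by (simp add: unitary_operator_def)
  define B where "B = (\<lambda>h. \<pi> h \<phi>) ` H"
  define C where "C = midpoint_hull V B"
  have BV: "B \<subseteq> carrier V" using HG cl \<phi> by (auto simp: B_def)
  have CV: "x \<in> C \<Longrightarrow> x \<in> carrier V" for x using midpoint_hull_closed[OF _ BV] by (simp add: C_def)
  have Cge: "r \<le> Re (ip V \<phi> x)" if "x \<in> C" for x
    using that unfolding C_def
  proof (induction rule: midpoint_hull.induct)
    case (base x)
    then show ?case using ge by (auto simp: B_def)
  next
    case (mid x y)
    then have "x \<in> carrier V" "y \<in> carrier V" using CV by (simp_all add: C_def)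
    then show ?case using mid \<phi> by (simp add: ip_smult ip_add)
  qed
  have Cinv: "\<pi> h x \<in> C" if h: "h \<in> H" and "x \<in> C" for h x
    using that(2) unfolding C_def
  proof (induction rule: midpoint_hull.induct)
    case (base x)
    then obtain k where k: "k \<in> H" "x = \<pi> k \<phi>" by (auto simp: B_def)
    then have "\<pi> h x = \<pi> (h \<otimes>\<^bsub>G\<^esub> k) \<phi>"
      using act.composition_rule[OF \<phi>, of h k] HG h by simp
    then have "\<pi> h x \<in> B" using subgroup.m_closed[OF H h k(1)] by (auto simp: B_def)
    then show ?case by (rule midpoint_hull.base)
  next
    case (mid x y)
    have "x \<in> carrier V" "y \<in> carrier V" using mid CV by (simp_all add: C_def)
    then have "\<pi> h ((1/2) \<odot> (x \<oplus> y)) = (1/2) \<odot> (\<pi> h x \<oplus> \<pi> h y)"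
      using HG[OF h] by (simp add: Uadd Usm)
    then show ?case using midpoint_hull.mid[OF mid.IH] by simp
  qed
  define m where "m = (INF x\<in>C. Re (ip V x x))"
  have "\<pi> \<one>\<^bsub>G\<^esub> \<phi> \<in> C" unfolding C_def
    by (intro midpoint_hull.base) (use subgroup.one_closed[OF H] in \<open>auto simp: B_def\<close>)
  then have Cne: "C \<noteq> {}" by auto
  have bdd: "bdd_below ((\<lambda>x. Re (ip V x x)) ` C)"
    using ip_self_nonneg CV by (intro bdd_belowI[of _ 0]) auto
  have m: "m \<le> Re (ip V x x)" if "x \<in> C" for x
    unfolding m_def using bdd that by (rule cINF_lower)
  have near: "\<exists>x\<in>C. Re (ip V x x) < m + e" if "e > 0" for e
    using cINF_less_iff[OF Cne bdd, of "m + e"] that unfolding m_def by simp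
  have "\<exists>x. \<forall>n. x n \<in> C \<and> Re (ip V (x n) (x n)) < m + 1 / Suc n"
    using near by (intro choice allI) (simp add: Bex_def)
  then obtain x where x: "\<And>n. x n \<in> C" "\<And>n. Re (ip V (x n) (x n)) < m + 1 / Suc n" by blast
  have close: "(hnorm V (u \<ominus> w))\<^sup>2 \<le> 4 * \<delta>"
    if "u \<in> C" "w \<in> C" "Re (ip V u u) \<le> m + \<delta>" "Re (ip V w w) \<le> m + \<delta>" for u w \<delta>
    using that CV midpoint_hull.mid[of u V B w]
    by (intro hnorm_minus_near_infimum) (simp_all add: C_def[symmetric] m)
  have xV: "x n \<in> carrier V" for n using x(1) CV by blast
  have inv_small: "1 / real (Suc n) \<le> 1 / real (Suc N)" if "N \<le> n" for n N
    using that by (simp add: frac_le)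
  have "\<exists>v\<in>carrier V. (\<lambda>n. hnorm V (x n \<ominus> v)) \<longlonglongrightarrow> 0"
  proof (rule complete)
    fix e :: real assume e: "e > 0"
    obtain N where N: "1 / real (Suc N) < e\<^sup>2 / 4"
      using nat_approx_posE[of "e\<^sup>2 / 4"] e by auto
    show "\<exists>N. \<forall>k\<ge>N. \<forall>n\<ge>N. hnorm V (x k \<ominus> x n) < e"
    proof (intro exI[of _ N] allI impI)
      fix k n assume "N \<le> k" "N \<le> n"
      then have "(hnorm V (x k \<ominus> x n))\<^sup>2 \<le> 4 * (1 / real (Suc N))"
        using x inv_small by (intro close x(1)) (meson add_left_mono less_imp_le order_trans)+
      then have "(hnorm V (x k \<ominus> x n))\<^sup>2 < e\<^sup>2" using N by simp
      then show "hnorm V (x k \<ominus> x n) < e" using e by (simp add: power2_less_imp_less)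
    qed
  qed (rule xV)
  then obtain v where v: "v \<in> carrier V" and lim: "(\<lambda>n. hnorm V (x n \<ominus> v)) \<longlonglongrightarrow> 0" by blast
  have "\<pi> h v = v" if h: "h \<in> H" for h
  proof -
    have hG: "h \<in> carrier G" using HG h by simp
    have V': "\<pi> h v \<in> carrier V" "\<pi> h (x n) \<in> carrier V" for n using cl hG v xV by auto
    have Udiff: "hnorm V (\<pi> h a \<ominus> \<pi> h b) = hnorm V (a \<ominus> b)" if "a \<in> carrier V" "b \<in> carrier V" for a b
    proof -
      have "(hnorm V (\<pi> h a \<ominus> \<pi> h b))\<^sup>2 = (hnorm V (a \<ominus> b))\<^sup>2"
        using that cl[OF hG] by (simp add: hnorm_minus_power2 Uip hG)
      then show ?thesis using that cl[OF hG] by (simp add: hnorm_nonneg power2_eq_iff_nonneg)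
    qed
    have sym: "hnorm V (a \<ominus> b) = hnorm V (b \<ominus> a)" if "a \<in> carrier V" "b \<in> carrier V" for a b
    proof -
      have "(hnorm V (a \<ominus> b))\<^sup>2 = (hnorm V (b \<ominus> a))\<^sup>2"
        using that Re_ip_commute[of a b] by (simp add: hnorm_minus_power2)
      then show ?thesis using that by (simp add: hnorm_nonneg power2_eq_iff_nonneg)
    qed
    have tri: "hnorm V (a \<ominus> b) \<le> hnorm V (a \<ominus> c) + hnorm V (c \<ominus> b)"
      if "a \<in> carrier V" "b \<in> carrier V" "c \<in> carrier V" for a b c
    proof -
      have "(a \<ominus> b) \<ominus> (c \<ominus> b) = a \<ominus> c"
        using that by (simp add: a_minus_def M.minus_add M.a_ac M.r_neg2 M.r_neg1)
      then show ?thesis using hnorm_triangle_minus[of "a \<ominus> b" "c \<ominus> b"] that by simp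
    qed
    have b: "hnorm V (\<pi> h v \<ominus> v) \<le> 2 * hnorm V (x n \<ominus> v) + 2 * sqrt (1 / Suc n)" for n
    proof -
      \<comment> \<open>\<open>\<pi> h (x n)\<close> lies in the hull and has the norm of
        \<open>x n\<close>, so it is an equally good almost-minimiser.\<close>
      have "(hnorm V (\<pi> h (x n) \<ominus> x n))\<^sup>2 \<le> 4 * (1 / Suc n)"
        using x(2)[of n] Cinv[OF h x(1)] Uip[OF hG xV xV] by (intro close x(1)) auto
      then have "hnorm V (\<pi> h (x n) \<ominus> x n) \<le> 2 * sqrt (1 / Suc n)"
        using real_le_rsqrt real_sqrt_mult[of 4 "1 / Suc n"] by fastforce
      moreover have "hnorm V (\<pi> h v \<ominus> v) \<le> hnorm V (\<pi> h v \<ominus> \<pi> h (x n)) +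
          (hnorm V (\<pi> h (x n) \<ominus> x n) + hnorm V (x n \<ominus> v))"
        using tri[of "\<pi> h v" v "\<pi> h (x n)"] tri[of "\<pi> h (x n)" v "x n"] V' v xV by fastforce
      ultimately show ?thesis using Udiff[OF v xV] sym[OF v xV] by simp
    qed
    have "(\<lambda>n. 2 * hnorm V (x n \<ominus> v) + 2 * sqrt (1 / Suc n)) \<longlonglongrightarrow> 2 * 0 + 2 * sqrt 0"
      by (intro tendsto_intros lim LIMSEQ_Suc[OF lim_1_over_n])
    then have "hnorm V (\<pi> h v \<ominus> v) \<le> 2 * 0 + 2 * sqrt 0"
      using b by (intro LIMSEQ_le_const) auto
    then have "hnorm V (\<pi> h v \<ominus> v) = 0" using hnorm_nonneg[of "\<pi> h v \<ominus> v"] V' v by simp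
    then have "\<pi> h v \<ominus> v = \<zero>" using V' v by (intro hnorm_eq_0) auto
    then show ?thesis
      using M.minus_equality[of "\<pi> h v" "\<ominus> v"] V'(1) v by (simp add: a_minus_def)
  qed
  moreover have "v \<noteq> \<zero>"
  proof
    assume v0: "v = \<zero>"
    have "r \<le> hnorm V \<phi> * hnorm V (x n \<ominus> v)" for n
    proof -
      have "r \<le> Re (ip V \<phi> (x n \<ominus> v))"
        using Cge[OF x(1)[of n]] \<phi> xV v0 by (simp add: ip_minus_right ip_zero_right)
      also have "\<dots> \<le> hnorm V \<phi> * hnorm V (x n \<ominus> v)"
        using abs_Re_ip_le[of \<phi> "x n \<ominus> v"] \<phi> xV v by simp
      finally show ?thesis .
    qed
    moreover have "(\<lambda>n. hnorm V \<phi> * hnorm V (x n \<ominus> v)) \<longlonglongrightarrow> hnorm V \<phi> * 0"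
      by (intro tendsto_intros lim)
    ultimately have "r \<le> hnorm V \<phi> * 0" by (intro LIMSEQ_le_const) auto
    then show False using r by simp
  qed
  ultimately show ?thesis using v by (auto simp: nonzero_invariant_vector_def)
qed

text \<open>Some \<open>h\<close> in \<open>H\<close> has
  \<open>Re (ip V \<phi> (\<pi> h \<phi>)) < 1/2\<close>, for otherwise
  \<open>nonzero_invariant_vectorI\<close> applies. It moves the unit vector \<open>\<phi>\<close>
  by at least 1, because the squared distance is 2 minus twice that number. Multiplication by
  \<open>R\<close> turns this into \<open>R\<close>, which is why \<open>\<phi>\<close> is taken
  invariant up to \<open>\<epsilon> / R\<close>.\<close>

lemma almost_invariant_unbounded_vector:
  assumes rep: "unitary_representation G V \<pi>" and H: "subgroup H G"
    and almost: "almost_invariant_vectors G V \<pi>" and no: "\<not> nonzero_invariant_vector H V \<pi>"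
    and S: "finite S" "S \<subseteq> carrier G" and pos: "\<epsilon> > 0" "R > 0"
  shows "\<exists>\<psi>\<in>carrier V. (\<forall>s\<in>S. hnorm V (\<pi> s \<psi> \<ominus> \<psi>) \<le> \<epsilon>) \<and> (\<exists>h\<in>H. R \<le> hnorm V (\<pi> h \<psi> \<ominus> \<psi>))"
proof -
  interpret act: group_action G "carrier V" \<pi> using rep by (simp add: unitary_representation_def)
  have HG: "H \<subseteq> carrier G" using H subgroup.subset by blast
  obtain \<phi> where \<phi>: "\<phi> \<in> carrier V" "hnorm V \<phi> = 1" and s: "\<And>s. s \<in> S \<Longrightarrow> hnorm V (\<pi> s \<phi> \<ominus> \<phi>) < \<epsilon> / R"
    using almost S pos unfolding almost_invariant_vectors_def by (metis divide_pos_pos)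
  have "\<exists>h\<in>H. Re (ip V \<phi> (\<pi> h \<phi>)) < 1 / 2"
  proof (rule ccontr)
    assume "\<not> ?thesis"
    then have "1 / 2 \<le> Re (ip V \<phi> (\<pi> h \<phi>))" if "h \<in> H" for h using that by (meson not_less)
    then show False using nonzero_invariant_vectorI[OF rep H \<phi>(1), of "1/2"] no by simp
  qed
  then obtain h where h: "h \<in> H" "Re (ip V \<phi> (\<pi> h \<phi>)) < 1 / 2" by blast
  have cl: "\<pi> g \<phi> \<in> carrier V" if "g \<in> carrier G" for g
    using that \<phi>(1) by (rule act.element_image) simp
  have hV: "\<pi> h \<phi> \<in> carrier V" using cl HG h(1) by blast
  have U: "unitary_operator V (\<pi> g)" if "g \<in> carrier G" for g
    using rep that by (simp add: unitary_representation_def)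
  define \<psi> where "\<psi> = complex_of_real R \<odot> \<phi>"
  have scale: "hnorm V (\<pi> g \<psi> \<ominus> \<psi>) = R * hnorm V (\<pi> g \<phi> \<ominus> \<phi>)" if g: "g \<in> carrier G" for g
  proof -
    have "\<pi> g \<psi> = complex_of_real R \<odot> \<pi> g \<phi>"
      using U[OF g] \<phi>(1) by (simp add: \<psi>_def unitary_operator_def)
    then have "\<pi> g \<psi> \<ominus> \<psi> = complex_of_real R \<odot> (\<pi> g \<phi> \<ominus> \<phi>)"
      using \<phi>(1) cl[OF g] by (simp add: \<psi>_def a_minus_def smult_r_distr smult_r_minus)
    then show ?thesis using \<phi>(1) cl[OF g] pos hnorm_smult_real[of "\<pi> g \<phi> \<ominus> \<phi>" R] by simp
  qed
  have "Re (ip V (\<pi> h \<phi>) (\<pi> h \<phi>)) = Re (ip V \<phi> \<phi>)"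
    using U[of h] HG h(1) \<phi>(1) by (auto simp: unitary_operator_def)
  moreover have "Re (ip V \<phi> \<phi>) = 1" using hnorm_power2[OF \<phi>(1)] \<phi>(2) by simp
  ultimately have "1 \<le> (hnorm V (\<pi> h \<phi> \<ominus> \<phi>))\<^sup>2"
    using h(2) hV \<phi>(1) Re_ip_commute[of \<phi> "\<pi> h \<phi>"] by (simp add: hnorm_minus_power2)
  then have "1 \<le> hnorm V (\<pi> h \<phi> \<ominus> \<phi>)"
    using hV \<phi>(1) hnorm_nonneg[of "\<pi> h \<phi> \<ominus> \<phi>"]
      power2_le_imp_le[of 1 "hnorm V (\<pi> h \<phi> \<ominus> \<phi>)"] by simp
  then have "R \<le> hnorm V (\<pi> h \<psi> \<ominus> \<psi>)" using scale[of h] HG h(1) pos by auto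
  moreover have "hnorm V (\<pi> s \<psi> \<ominus> \<psi>) \<le> \<epsilon>" if "s \<in> S" for s
    using s[OF that] scale[of s] S(2) that pos by (auto simp: field_simps)
  moreover have "\<psi> \<in> carrier V" using \<phi>(1) by (simp add: \<psi>_def)
  ultimately show ?thesis using h(1) by blast
qed

end

section \<open>Clusters and the two-point function\<close>

text \<open>The factor cuts the form into one diagonal block per value of \<open>f\<close>. With
  \<open>f = cluster \<omega>\<close> this is why multiplication by connectivity indicators
  preserves positive semidefiniteness.\<close>

lemma psd_on_block_sum_nonneg:
  assumes K: "psd_on A K" and F: "finite F" "F \<subseteq> A"
  shows "0 \<le> (\<Sum>x\<in>F. \<Sum>y\<in>F. c x * c y * ((if f x = f y then 1 else 0) * K x y))"
proof -
  have inner: "(\<Sum>y\<in>F. c x * c y * ((if f x = f y then 1 else 0) * K x y)) =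
      (\<Sum>y\<in>{y\<in>F. f y = f x}. c x * c y * K x y)" for x
    using F by (intro sum.mono_neutral_cong_right) auto
  have "(\<Sum>x\<in>F. \<Sum>y\<in>F. c x * c y * ((if f x = f y then 1 else 0) * K x y)) =
      (\<Sum>x\<in>F. \<Sum>y\<in>{y\<in>F. f y = f x}. c x * c y * K x y)"
    unfolding inner ..
  also have "\<dots> = (\<Sum>b\<in>f`F. \<Sum>x\<in>{x\<in>F. f x = b}. \<Sum>y\<in>{y\<in>F. f y = f x}. c x * c y * K x y)"
    by (rule sum.image_gen[OF F(1)])
  also have "\<dots> = (\<Sum>b\<in>f`F. \<Sum>x\<in>{x\<in>F. f x = b}. \<Sum>y\<in>{y\<in>F. f y = b}. c x * c y * K x y)"
    by (intro sum.cong refl) auto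
  also have "\<dots> \<ge> 0" using F by (intro sum_nonneg psd_onD(2)[OF K]) auto
  finally show ?thesis .
qed

definition connected_in :: "'g set set \<Rightarrow> 'g \<Rightarrow> 'g \<Rightarrow> bool" where
  "connected_in \<omega> x y \<longleftrightarrow> y \<in> cluster \<omega> x"

lemma connected_in_refl [simp]: "connected_in \<omega> x x"
  by (simp add: connected_in_def cluster_def)

lemma connected_in_trans: "connected_in \<omega> x y \<Longrightarrow> connected_in \<omega> y z \<Longrightarrow> connected_in \<omega> x z"
  by (auto simp: connected_in_def cluster_def)

lemma connected_in_sym: "connected_in \<omega> x y \<Longrightarrow> connected_in \<omega> y x"
proof -
  have "sym ({(u, v). {u, v} \<in> \<omega>}\<^sup>*)"
    by (intro sym_rtrancl) (auto simp: sym_def insert_commute)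
  then show "connected_in \<omega> x y \<Longrightarrow> connected_in \<omega> y x"
    by (auto simp: connected_in_def cluster_def dest: symD)
qed

lemma connected_in_iff_cluster_eq: "connected_in \<omega> x y \<longleftrightarrow> cluster \<omega> x = cluster \<omega> y"
proof
  assume *: "connected_in \<omega> x y"
  have "z \<in> cluster \<omega> x \<longleftrightarrow> z \<in> cluster \<omega> y" for z
    using connected_in_trans[OF *, of z] connected_in_trans[OF connected_in_sym[OF *], of z]
    unfolding connected_in_def by blast
  then show "cluster \<omega> x = cluster \<omega> y" by blast
next
  assume "cluster \<omega> x = cluster \<omega> y"
  then show "connected_in \<omega> x y" using connected_in_refl[of \<omega> y] unfolding connected_in_def by metis
qed

lemma connected_in_edge: "{x, y} \<in> \<omega> \<Longrightarrow> connected_in \<omega> x y"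
  by (auto simp: connected_in_def cluster_def)

text \<open>Connectivity is bounded from above through quantities that open edges preserve; the grid
  cell will be such a quantity.\<close>

lemma connected_in_imp_eq:
  assumes "connected_in \<omega> x y" and "\<And>u v. {u, v} \<in> \<omega> \<Longrightarrow> f u = f v"
  shows "f x = f y"
proof -
  have "(x, y) \<in> {(u, v). {u, v} \<in> \<omega>}\<^sup>*" using assms(1) by (simp add: connected_in_def cluster_def)
  then show ?thesis by (induction rule: rtrancl_induct) (auto dest: assms(2))
qed

section \<open>Edges of the Cayley graph and their translates\<close>

locale cayley_graph = group G for G :: "('g, 'b) monoid_scheme" (structure) +
  fixes S :: "'g set"
  assumes fin_S: "finite S" and S_subset: "S \<subseteq> carrier G"
    and S_inv: "s \<in> S \<Longrightarrow> inv s \<in> S" and S_gen: "generate G S = carrier G"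
begin

text \<open>Products of words over \<open>S\<close> exhaust the group; closure of \<open>S\<close>
  under inverses turns the inverses in \<open>generate\<close> into letters.\<close>

lemma countable_carrier: "countable (carrier G)"
proof -
  let ?f = "\<lambda>xs. foldr (\<otimes>) xs \<one>"
  have closed: "?f xs \<in> carrier G" if "set xs \<subseteq> S" for xs
    using that S_subset by (induction xs) auto
  have app: "?f (xs @ ys) = ?f xs \<otimes> ?f ys" if "set xs \<subseteq> S" "set ys \<subseteq> S" for xs ys
    using that(1)
  proof (induction xs)
    case Nil
    then show ?case using closed[OF that(2)] by simp
  next
    case (Cons a xs)
    then show ?case using closed[OF that(2)] closed[of xs] S_subset by (auto simp: m_assoc)
  qed
  have "x \<in> ?f ` lists S" if "x \<in> generate G S" for x
    using that
  proof (induction rule: generate.induct)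
    case one
    then show ?case by (intro image_eqI[of _ _ "[]"]) auto
  next
    case (incl h)
    then show ?case using S_subset by (intro image_eqI[of _ _ "[h]"]) auto
  next
    case (inv h)
    then show ?case using S_subset S_inv by (intro image_eqI[of _ _ "[inv h]"]) auto
  next
    case (eng h1 h2)
    then obtain xs ys where "xs \<in> lists S" "ys \<in> lists S" "h1 = ?f xs" "h2 = ?f ys" by auto
    moreover from this have "?f (xs @ ys) = h1 \<otimes> h2" using app[of xs ys] by auto
    ultimately show ?case by (intro image_eqI[of _ _ "xs @ ys"]) auto
  qed
  then have "carrier G \<subseteq> ?f ` lists S" using S_gen by auto
  then show ?thesis
    using fin_S by (meson countable_finite countable_image countable_lists countable_subset)
qed

abbreviation "edges \<equiv> cayley_edges G S"

lemma edge_subset: "e \<in> edges \<Longrightarrow> e \<subseteq> carrier G"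
  using S_subset by (auto simp: cayley_edges_def)

lemma edges_translate:
  assumes "g \<in> carrier G" "e \<in> edges"
  shows "(\<lambda>x. g \<otimes> x) ` e \<in> edges"
proof -
  obtain a s where a: "a \<in> carrier G" "s \<in> S" "e = {a, a \<otimes> s}" using assms by (auto simp: cayley_edges_def)
  then have "(\<lambda>x. g \<otimes> x) ` e = {g \<otimes> a, (g \<otimes> a) \<otimes> s}"
    using assms S_subset by (auto simp: m_assoc)
  then show ?thesis using a assms unfolding cayley_edges_def by blast
qed

lemma translate_image_inverse:
  assumes "g \<in> carrier G" "e \<subseteq> carrier G"
  shows "(\<lambda>x. inv g \<otimes> x) ` (\<lambda>x. g \<otimes> x) ` e = e" "(\<lambda>x. g \<otimes> x) ` (\<lambda>x. inv g \<otimes> x) ` e = e"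
proof -
  have "inv g \<otimes> (g \<otimes> x) = x" "g \<otimes> (inv g \<otimes> x) = x" if "x \<in> e" for x
    using that assms m_assoc[of "inv g" g x] m_assoc[of g "inv g" x] by auto
  then show "(\<lambda>x. inv g \<otimes> x) ` (\<lambda>x. g \<otimes> x) ` e = e" "(\<lambda>x. g \<otimes> x) ` (\<lambda>x. inv g \<otimes> x) ` e = e"
    unfolding image_image by (simp_all cong: image_cong)
qed

lemma translate_subset: "g \<in> carrier G \<Longrightarrow> \<omega> \<subseteq> edges \<Longrightarrow> translate G g \<omega> \<subseteq> edges"
  using edges_translate by (auto simp: translate_def)

lemma mem_translate_iff:
  assumes "g \<in> carrier G" "\<omega> \<subseteq> edges" "e \<subseteq> carrier G"
  shows "e \<in> translate G g \<omega> \<longleftrightarrow> (\<lambda>x. inv g \<otimes> x) ` e \<in> \<omega>"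
proof
  assume "e \<in> translate G g \<omega>"
  then obtain e' where "e' \<in> \<omega>" "e = (\<lambda>x. g \<otimes> x) ` e'" by (auto simp: translate_def)
  then show "(\<lambda>x. inv g \<otimes> x) ` e \<in> \<omega>"
    using translate_image_inverse(1)[of g e'] assms edge_subset by auto
next
  assume "(\<lambda>x. inv g \<otimes> x) ` e \<in> \<omega>"
  then show "e \<in> translate G g \<omega>"
    using translate_image_inverse(2)[OF assms(1,3)] unfolding translate_def by (metis image_eqI)
qed

lemma connected_in_translate:
  assumes "g \<in> carrier G" "connected_in \<omega> x y"
  shows "connected_in (translate G g \<omega>) (g \<otimes> x) (g \<otimes> y)"
proof -
  have "(x, y) \<in> {(u, v). {u, v} \<in> \<omega>}\<^sup>*" using assms(2) by (simp add: connected_in_def cluster_def)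
  then show ?thesis
  proof (induction rule: rtrancl_induct)
    case (step u v)
    then have "{u, v} \<in> \<omega>" by simp
    then have "(\<lambda>x. g \<otimes> x) ` {u, v} \<in> translate G g \<omega>" unfolding translate_def by (rule imageI)
    then have "{g \<otimes> u, g \<otimes> v} \<in> translate G g \<omega>" by simp
    then show ?case using step.IH connected_in_edge connected_in_trans by metis
  qed simp
qed

lemma connected_in_translate_iff:
  assumes "g \<in> carrier G" "\<omega> \<subseteq> edges" "x \<in> carrier G" "y \<in> carrier G"
  shows "connected_in (translate G g \<omega>) (g \<otimes> x) (g \<otimes> y) \<longleftrightarrow> connected_in \<omega> x y"
proof
  assume *: "connected_in (translate G g \<omega>) (g \<otimes> x) (g \<otimes> y)"
  have "translate G (inv g) (translate G g \<omega>) = \<omega>"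
  proof -
    have "translate G (inv g) (translate G g \<omega>) = (\<lambda>e. (\<lambda>x. inv g \<otimes> x) ` (\<lambda>x. g \<otimes> x) ` e) ` \<omega>"
      by (simp add: translate_def image_image)
    also have "\<dots> = (\<lambda>e. e) ` \<omega>"
      using assms(2) by (intro image_cong refl translate_image_inverse(1)[OF assms(1)] edge_subset) auto
    finally show ?thesis by simp
  qed
  then show "connected_in \<omega> x y"
    using connected_in_translate[OF _ *, of "inv g"] assms m_assoc[of "inv g" g x] m_assoc[of "inv g" g y] by simp
qed (rule connected_in_translate[OF assms(1)])

lemma edges_one: "{e \<in> edges. \<one> \<in> e} = (\<lambda>s. {\<one>, s}) ` S"
proof safe
  fix e assume e: "e \<in> edges" "\<one> \<in> e"
  then obtain a s where a: "a \<in> carrier G" "s \<in> S" "e = {a, a \<otimes> s}" by (auto simp: cayley_edges_def)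
  have s: "s \<in> carrier G" using a S_subset by auto
  show "e \<in> (\<lambda>s. {\<one>, s}) ` S"
  proof (cases "a = \<one>")
    case True
    then show ?thesis using a s by auto
  next
    case False
    then have as: "a \<otimes> s = \<one>" using e(2) a(3) by auto
    \<comment> \<open>The edge is met from its other end; symmetry of \<open>S\<close> supplies the
      generator \<open>inv s\<close> that leads back along it.\<close>
    then have "inv s = a" using a(1) s by (intro inv_equality)
    then have "e = {\<one>, inv s}" unfolding a(3) as by (simp add: insert_commute)
    then show ?thesis using S_inv[OF a(2)] by blast
  qed
next
  fix s assume "s \<in> S"
  then have "{\<one>, s} = {\<one>, \<one> \<otimes> s}" using S_subset by auto
  then show "{\<one>, s} \<in> edges" using \<open>s \<in> S\<close> unfolding cayley_edges_def by blast
qed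

lemma edge_degree_one:
  assumes "\<omega> \<subseteq> edges"
  shows "real (edge_degree \<omega> \<one>) = (\<Sum>e\<in>(\<lambda>s. {\<one>, s}) ` S. indicator \<omega> e)"
proof -
  have "{e \<in> \<omega>. \<one> \<in> e} = {e \<in> edges. \<one> \<in> e} \<inter> \<omega>" using assms by auto
  then have "{e \<in> \<omega>. \<one> \<in> e} = (\<lambda>s. {\<one>, s}) ` S \<inter> \<omega>" unfolding edges_one .
  then show ?thesis using fin_S by (simp add: edge_degree_def indicator_def)
qed

lemma edge_degree_one_edges: "edge_degree edges \<one> = card ((\<lambda>s. {\<one>, s}) ` S)"
  by (simp add: edge_degree_def edges_one)

end

section \<open>Two-point function of an invariant percolation\<close>

locale bond_percolation = cayley_graph G S
  for G :: "('g, 'b) monoid_scheme" (structure) and S +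
  fixes P :: "'g set set measure"
  assumes perc: "invariant_bond_percolation G S P"
begin

lemma prob_P: "prob_space P" and space_P: "space P = Pow edges"
  and sets_P: "sets P = sigma_sets (Pow edges) {{\<omega> \<in> Pow edges. e \<in> \<omega>} | e. e \<in> edges}"
  and distr_P: "g \<in> carrier G \<Longrightarrow> distr P P (translate G g) = P"
  using perc by (simp_all add: invariant_bond_percolation_def)

sublocale prob_space P by (rule prob_P)

lemma edge_event [measurable]: "{\<omega> \<in> space P. e \<in> \<omega>} \<in> sets P"
proof (cases "e \<in> edges")
  case True
  then show ?thesis unfolding sets_P space_P by (intro sigma_sets.Basic) auto
next
  case False
  then have *: "{\<omega> \<in> space P. e \<in> \<omega>} = {}" by (auto simp: space_P)
  show ?thesis unfolding * by simp
qed

text \<open>Paths are sorted by length: before its last edge a path passes through one of countably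
  many vertices, so only countable unions and finite intersections of edge events occur.\<close>

lemma connected_event [measurable]: "{\<omega> \<in> space P. connected_in \<omega> x y} \<in> sets P"
proof -
  let ?R = "\<lambda>\<omega>. {(u, v). {u, v} \<in> \<omega>}"
  have "{\<omega> \<in> space P. (x, y) \<in> ?R \<omega> ^^ n} \<in> sets P" for n y
  proof (induction n arbitrary: y)
    case (Suc n)
    have "{\<omega> \<in> space P. (x, y) \<in> ?R \<omega> ^^ Suc n} =
        (\<Union>z\<in>carrier G. {\<omega> \<in> space P. (x, z) \<in> ?R \<omega> ^^ n} \<inter> {\<omega> \<in> space P. {z, y} \<in> \<omega>})"
      using edge_subset by (fastforce simp: space_P relcomp_unfold)
    also have "\<dots> \<in> sets P"
      by (intro sets.countable_UN'' countable_carrier sets.Int Suc edge_event)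
    finally show ?case .
  qed (cases "x = y"; simp)
  then have "(\<Union>n. {\<omega> \<in> space P. (x, y) \<in> ?R \<omega> ^^ n}) \<in> sets P" by blast
  moreover have "{\<omega> \<in> space P. connected_in \<omega> x y} = (\<Union>n. {\<omega> \<in> space P. (x, y) \<in> ?R \<omega> ^^ n})"
    by (auto simp: connected_in_def cluster_def rtrancl_power)
  ultimately show ?thesis by simp
qed

abbreviation "\<tau> \<equiv> two_point_function P"

lemma tau_eq: "\<tau> x y = prob {\<omega> \<in> space P. connected_in \<omega> x y}"
  by (simp add: two_point_function_def connected_in_def)

lemma tau_nonneg: "0 \<le> \<tau> x y" and tau_le_1: "\<tau> x y \<le> 1"
  by (simp_all add: tau_eq)

lemma tau_refl [simp]: "\<tau> x x = 1"
  by (simp add: tau_eq prob_space)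

lemma tau_sym: "\<tau> x y = \<tau> y x"
  unfolding tau_eq by (intro arg_cong[of _ _ prob] Collect_cong) (blast intro: connected_in_sym)

lemma one_minus_tau: "1 - \<tau> x y = prob {\<omega> \<in> space P. \<not> connected_in \<omega> x y}"
proof -
  have "{\<omega> \<in> space P. \<not> connected_in \<omega> x y} = space P - {\<omega> \<in> space P. connected_in \<omega> x y}" by auto
  then show ?thesis unfolding tau_eq using prob_compl[OF connected_event] by simp
qed

lemma disconnected_event [measurable]: "{\<omega> \<in> space P. \<not> connected_in \<omega> x y} \<in> sets P"
  by (intro sets.sets_Collect_neg connected_event)

lemma tau_triangle: "1 - \<tau> x z \<le> (1 - \<tau> x y) + (1 - \<tau> y z)"
proof -
  have "prob {\<omega> \<in> space P. \<not> connected_in \<omega> x z} \<le>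
      prob ({\<omega> \<in> space P. \<not> connected_in \<omega> x y} \<union> {\<omega> \<in> space P. \<not> connected_in \<omega> y z})"
    by (intro finite_measure_mono) (auto dest: connected_in_trans)
  also have "\<dots> \<le> prob {\<omega> \<in> space P. \<not> connected_in \<omega> x y} + prob {\<omega> \<in> space P. \<not> connected_in \<omega> y z}"
    by (intro measure_Un_le) auto
  finally show ?thesis by (simp add: one_minus_tau)
qed

lemma measurable_translate: "g \<in> carrier G \<Longrightarrow> translate G g \<in> measurable P P"
proof (rule measurable_sigma_sets[OF sets_P])
  assume g: "g \<in> carrier G"
  show "translate G g \<in> space P \<rightarrow> Pow edges" using translate_subset[OF g] by (auto simp: space_P)
  fix Y assume "Y \<in> {{\<omega> \<in> Pow edges. e \<in> \<omega>} | e. e \<in> edges}"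
  then obtain e where e: "e \<in> edges" "Y = {\<omega> \<in> Pow edges. e \<in> \<omega>}" by blast
  have "translate G g -` Y \<inter> space P = {\<omega> \<in> space P. (\<lambda>x. inv g \<otimes> x) ` e \<in> \<omega>}"
    using mem_translate_iff[OF g _ edge_subset[OF e(1)]] translate_subset[OF g] e by (auto simp: space_P)
  then show "translate G g -` Y \<inter> space P \<in> sets P" by simp
qed auto

lemma tau_invariant:
  assumes "g \<in> carrier G" "x \<in> carrier G" "y \<in> carrier G"
  shows "\<tau> (g \<otimes> x) (g \<otimes> y) = \<tau> x y"
proof -
  let ?A = "{\<omega> \<in> space P. connected_in \<omega> (g \<otimes> x) (g \<otimes> y)}"
  have "\<tau> (g \<otimes> x) (g \<otimes> y) = measure (distr P P (translate G g)) ?A"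
    using assms by (simp add: tau_eq distr_P)
  also have "\<dots> = prob (translate G g -` ?A \<inter> space P)"
    using measurable_translate assms by (intro measure_distr) auto
  also have "translate G g -` ?A \<inter> space P = {\<omega> \<in> space P. connected_in \<omega> x y}"
    using connected_in_translate_iff[OF assms(1) _ assms(2,3)] translate_subset[OF assms(1)] by (auto simp: space_P)
  finally show ?thesis by (simp add: tau_eq)
qed

lemma expectation_edge_degree:
  "expectation (\<lambda>\<omega>. real (edge_degree \<omega> \<one>)) =
    (\<Sum>e\<in>(\<lambda>s. {\<one>, s}) ` S. prob {\<omega> \<in> space P. e \<in> \<omega>})"
proof -
  have "expectation (\<lambda>\<omega>. real (edge_degree \<omega> \<one>)) =
      expectation (\<lambda>\<omega>. \<Sum>e\<in>(\<lambda>s. {\<one>, s}) ` S. indicator {\<omega> \<in> space P. e \<in> \<omega>} \<omega>)"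
    by (intro Bochner_Integration.integral_cong refl) (auto simp: edge_degree_one space_P indicator_def intro!: sum.cong)
  also have "\<dots> = (\<Sum>e\<in>(\<lambda>s. {\<one>, s}) ` S. expectation (indicator {\<omega> \<in> space P. e \<in> \<omega>}))"
    by (intro Bochner_Integration.integral_sum integrable_real_indicator) (auto simp: emeasure_eq_measure)
  finally show ?thesis by simp
qed

text \<open>The degree deficit is the sum, over the edges at the identity, of the probabilities of
  being closed. The edge \<open>{\<one>, s}\<close> contributes one of these nonnegative terms, and
  an open edge connects its ends.\<close>

lemma one_minus_tau_generator:
  assumes s: "s \<in> S"
  shows "1 - \<tau> \<one> s \<le> real (edge_degree edges \<one>) - expectation (\<lambda>\<omega>. real (edge_degree \<omega> \<one>))"
proof -
  have "1 - \<tau> \<one> s \<le> 1 - prob {\<omega> \<in> space P. {\<one>, s} \<in> \<omega>}"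
    unfolding tau_eq by (intro diff_left_mono finite_measure_mono) (auto intro: connected_in_edge)
  also have "\<dots> \<le> (\<Sum>e\<in>(\<lambda>s. {\<one>, s}) ` S. 1 - prob {\<omega> \<in> space P. e \<in> \<omega>})"
    using s fin_S by (intro member_le_sum[where f = "\<lambda>e. 1 - prob {\<omega> \<in> space P. e \<in> \<omega>}"]) auto
  also have "\<dots> = real (edge_degree edges \<one>) - expectation (\<lambda>\<omega>. real (edge_degree \<omega> \<one>))"
    by (simp add: sum_subtractf edge_degree_one_edges expectation_edge_degree)
  finally show ?thesis .
qed

text \<open>The two-point function is an average of indicators of equivalence relations.\<close>

lemma psd_on_tau_mult:
  assumes K: "psd_on A K"
  shows "psd_on A (\<lambda>x y. \<tau> x y * K x y)"
  unfolding psd_on_def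
proof (intro conjI allI impI ballI)
  fix F and c :: "'g \<Rightarrow> real"
  assume F: "finite F \<and> F \<subseteq> A"
  have int: "integrable P (indicator {\<omega> \<in> space P. connected_in \<omega> x y} :: _ \<Rightarrow> real)" for x y
    by (intro integrable_real_indicator connected_event) (simp add: emeasure_eq_measure)
  have "0 \<le> expectation (\<lambda>\<omega>. \<Sum>x\<in>F. \<Sum>y\<in>F. c x * c y * (indicator {\<omega> \<in> space P. connected_in \<omega> x y} \<omega> * K x y))"
  proof (rule Bochner_Integration.integral_nonneg)
    fix \<omega> assume \<omega>: "\<omega> \<in> space P"
    have "(\<Sum>x\<in>F. \<Sum>y\<in>F. c x * c y * (indicator {\<omega> \<in> space P. connected_in \<omega> x y} \<omega> * K x y)) =
       (\<Sum>x\<in>F. \<Sum>y\<in>F. c x * c y * ((if cluster \<omega> x = cluster \<omega> y then 1 else 0) * K x y))"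
      using \<omega> by (intro sum.cong refl) (simp add: indicator_def connected_in_iff_cluster_eq)
    then show "0 \<le> (\<Sum>x\<in>F. \<Sum>y\<in>F. c x * c y * (indicator {\<omega> \<in> space P. connected_in \<omega> x y} \<omega> * K x y))"
      using psd_on_block_sum_nonneg[OF K, of F c "cluster \<omega>"] F by simp
  qed
  also have "\<dots> = (\<Sum>x\<in>F. \<Sum>y\<in>F. expectation (\<lambda>\<omega>. c x * c y * (indicator {\<omega> \<in> space P. connected_in \<omega> x y} \<omega> * K x y)))"
    by (intro trans[OF Bochner_Integration.integral_sum] sum.cong refl Bochner_Integration.integral_sum
        Bochner_Integration.integrable_sum integrable_mult_right integrable_mult_left int)
  also have "\<dots> = (\<Sum>x\<in>F. \<Sum>y\<in>F. c x * c y * (\<tau> x y * K x y))"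
    by (simp add: tau_eq)
  finally show "0 \<le> (\<Sum>x\<in>F. \<Sum>y\<in>F. c x * c y * (\<tau> x y * K x y))" .
next
  fix x y assume "x \<in> A" "y \<in> A"
  then show "\<tau> x y * K x y = \<tau> y x * K y x"
    by (simp only: psd_onD(1)[OF K, of x y] tau_sym[of x y])
qed

text \<open>Disconnection probabilities are subadditive along words, so a bound at the generators
  spreads to each group element with a factor that does not depend on the percolation.\<close>

lemma one_minus_tau_mult:
  assumes "x \<in> carrier G" "y \<in> carrier G"
  shows "1 - \<tau> \<one> (x \<otimes> y) \<le> (1 - \<tau> \<one> x) + (1 - \<tau> \<one> y)"
  using tau_triangle[of \<one> "x \<otimes> y" x] tau_invariant[of x \<one> y] assms by simp

end

section \<open>Percolation from Gaussian processes\<close>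

text \<open>On the unit interval \<open>\<lfloor>a + u\<rfloor>\<close> jumps once, at
  \<open>1 - frac a\<close>, from \<open>\<lfloor>a\<rfloor>\<close> to the next integer. Rounding
  down after a uniform shift is therefore exact on average.\<close>

lemma has_integral_floor_shift: "((\<lambda>u. real_of_int \<lfloor>a + u\<rfloor>) has_integral a) {0..1}"
proof -
  define k where "k = \<lfloor>a\<rfloor>"
  define f where "f = frac a"
  have f: "0 \<le> f" "f < 1" "a = of_int k + f" using frac_lt_1[of a] by (simp_all add: f_def k_def frac_def)
  have "((\<lambda>u. real_of_int \<lfloor>a + u\<rfloor>) has_integral (1 - f) * k) (cbox 0 (1 - f))"
  proof (rule has_integral_spike_interior)
    show "((\<lambda>u. real_of_int k) has_integral (1 - f) * k) (cbox 0 (1 - f))"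
      using has_integral_const_real[of "real_of_int k" 0 "1 - f"] f by simp
    show "real_of_int \<lfloor>a + u\<rfloor> = real_of_int k" if "u \<in> box 0 (1 - f)" for u
    proof -
      have "\<lfloor>a + u\<rfloor> = k" using f that by (intro floor_unique) auto
      then show ?thesis by simp
    qed
  qed
  moreover have "((\<lambda>u. real_of_int \<lfloor>a + u\<rfloor>) has_integral f * (k + 1)) (cbox (1 - f) 1)"
  proof (rule has_integral_spike_interior)
    show "((\<lambda>u. real_of_int k + 1) has_integral f * (k + 1)) (cbox (1 - f) 1)"
      using has_integral_const_real[of "real_of_int k + 1" "1 - f" 1] f by simp
    show "real_of_int \<lfloor>a + u\<rfloor> = real_of_int k + 1" if "u \<in> box (1 - f) 1" for u
    proof -
      have "\<lfloor>a + u\<rfloor> = k + 1" using f that by (intro floor_unique) auto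
      then show ?thesis by simp
    qed
  qed
  ultimately have "((\<lambda>u. real_of_int \<lfloor>a + u\<rfloor>) has_integral ((1 - f) * k + f * (k + 1))) {0..1}"
    using f by (intro has_integral_combine[of 0 "1 - f" 1]) auto
  then show ?thesis using f by (simp add: algebra_simps)
qed

text \<open>For \<open>a \<le> b\<close> the difference of the two floors is a nonnegative integer,
  so it dominates the indicator that they differ; its integral is \<open>b - a\<close>.\<close>

lemma nn_integral_floor_shift_differs:
  fixes a b :: real
  shows "(\<integral>\<^sup>+u. indicator {0..1} u * (if \<lfloor>a + u\<rfloor> \<noteq> \<lfloor>b + u\<rfloor> then 1 else 0) \<partial>lborel) \<le> ennreal \<bar>a - b\<bar>"
proof (induction a b rule: linorder_wlog)
  case (le a b)
  let ?d = "\<lambda>u. real_of_int \<lfloor>b + u\<rfloor> - real_of_int \<lfloor>a + u\<rfloor>"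
  let ?g = "\<lambda>u. if u \<in> {0..1} then ?d u else 0"
  have d: "0 \<le> ?d u" "\<lfloor>a + u\<rfloor> \<noteq> \<lfloor>b + u\<rfloor> \<Longrightarrow> 1 \<le> ?d u" for u
  proof -
    have "\<lfloor>a + u\<rfloor> \<le> \<lfloor>b + u\<rfloor>" using le by (intro floor_mono) simp
    then show "0 \<le> ?d u" "\<lfloor>a + u\<rfloor> \<noteq> \<lfloor>b + u\<rfloor> \<Longrightarrow> 1 \<le> ?d u" by linarith+
  qed
  have "(?g has_integral (b - a)) UNIV"
    unfolding has_integral_restrict_UNIV
    by (intro has_integral_diff has_integral_floor_shift)
  then have "(\<integral>\<^sup>+u. ennreal (?g u) \<partial>lborel) = ennreal (b - a)"
  proof (intro nn_integral_has_integral_lborel)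
    show "?g \<in> borel_measurable borel" by measurable
  qed (use d(1) in auto)
  moreover have "(\<integral>\<^sup>+u. indicator {0..1} u * (if \<lfloor>a + u\<rfloor> \<noteq> \<lfloor>b + u\<rfloor> then 1 else 0) \<partial>lborel) \<le> (\<integral>\<^sup>+u. ennreal (?g u) \<partial>lborel)"
  proof (intro nn_integral_mono)
    fix u :: real
    show "indicator {0..1} u * (if \<lfloor>a + u\<rfloor> \<noteq> \<lfloor>b + u\<rfloor> then 1 else 0) \<le> ennreal (?g u)"
      using d(2)[of u] ennreal_leI[of 1 "?d u"] by (auto simp: indicator_def)
  qed
  ultimately show ?case using le by simp
next
  case (sym a b)
  then show ?case by (simp add: abs_minus_commute eq_commute)
qed

context cayley_graph
begin

text \<open>All pairs of endpoints are compared because an edge is a bare set, without orientation.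
  The offset \<open>u\<close> is shared by all coordinates \<open>n\<close>, so one real number has
  to be good for the whole sequence of vectors.\<close>

definition cell_configuration :: "real \<Rightarrow> ('g \<times> nat \<Rightarrow> real) \<Rightarrow> 'g set set" where
  "cell_configuration u w = {e \<in> edges. \<forall>x\<in>e. \<forall>y\<in>e. \<forall>n. \<lfloor>w (x, n) + u\<rfloor> = \<lfloor>w (y, n) + u\<rfloor>}"

abbreviation cut_event :: "('g \<times> nat \<Rightarrow> real) measure \<Rightarrow> real \<Rightarrow> 'g \<Rightarrow> ('g \<times> nat \<Rightarrow> real) set" where
  "cut_event L u s \<equiv> {w \<in> space L. \<exists>n. \<lfloor>w (\<one>, n) + u\<rfloor> \<noteq> \<lfloor>w (s, n) + u\<rfloor>}"

definition configuration_space :: "'g set set measure" where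
  "configuration_space = sigma (Pow edges) {{\<omega> \<in> Pow edges. e \<in> \<omega>} | e. e \<in> edges}"

lemma configuration_space_gen: "{{\<omega> \<in> Pow edges. e \<in> \<omega>} | e. e \<in> edges} \<subseteq> Pow (Pow edges)"
  by auto

lemma space_configuration_space: "space configuration_space = Pow edges"
  unfolding configuration_space_def using configuration_space_gen by (rule space_measure_of)

lemma sets_configuration_space:
  "sets configuration_space = sigma_sets (Pow edges) {{\<omega> \<in> Pow edges. e \<in> \<omega>} | e. e \<in> edges}"
  unfolding configuration_space_def using configuration_space_gen by (rule sets_measure_of)

lemma measurable_cell_configuration:
  assumes L: "gaussian_law (carrier G \<times> UNIV) K L"
  shows "cell_configuration u \<in> measurable L configuration_space"
  unfolding configuration_space_def
proof (rule measurable_measure_of[OF configuration_space_gen])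
  show "cell_configuration u \<in> space L \<rightarrow> Pow edges" by (auto simp: cell_configuration_def)
  fix Y assume "Y \<in> {{\<omega> \<in> Pow edges. e \<in> \<omega>} | e. e \<in> edges}"
  then obtain e where e: "e \<in> edges" and Y: "Y = {\<omega> \<in> Pow edges. e \<in> \<omega>}" by blast
  obtain a s where a: "a \<in> carrier G" "s \<in> S" "e = {a, a \<otimes> s}" using e by (auto simp: cayley_edges_def)
  then have as: "a \<otimes> s \<in> carrier G" using S_subset by auto
  have [measurable]: "(\<lambda>w. w (a, n)) \<in> borel_measurable L" "(\<lambda>w. w (a \<otimes> s, n)) \<in> borel_measurable L" for n
    using a as by (auto intro!: gaussian_law_measurable[OF L])
  have "cell_configuration u -` Y \<inter> space L = {w \<in> space L. \<forall>n. \<lfloor>w (a, n) + u\<rfloor> = \<lfloor>w (a \<otimes> s, n) + u\<rfloor>}"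
    using e unfolding Y a(3) by (auto simp: cell_configuration_def)
  also have "\<dots> \<in> sets L" by measurable
  finally show "cell_configuration u -` Y \<inter> space L \<in> sets L" .
qed

text \<open>Equivariance: it turns invariance of the Gaussian law under shifts of the group argument
  into invariance of the percolation.\<close>

lemma translate_cell_configuration:
  assumes "g \<in> carrier G"
  shows "translate G g (cell_configuration u w) =
    cell_configuration u (\<lambda>p\<in>carrier G \<times> UNIV. w (inv g \<otimes> fst p, snd p))"
proof (rule Set.set_eqI)
  fix e
  have sub: "cell_configuration u w \<subseteq> edges" by (auto simp: cell_configuration_def)
  show "e \<in> translate G g (cell_configuration u w) \<longleftrightarrow>
      e \<in> cell_configuration u (\<lambda>p\<in>carrier G \<times> UNIV. w (inv g \<otimes> fst p, snd p))"
  proof (cases "e \<in> edges")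
    case True
    then have e: "e \<subseteq> carrier G" by (rule edge_subset)
    have "e \<in> translate G g (cell_configuration u w) \<longleftrightarrow> (\<lambda>x. inv g \<otimes> x) ` e \<in> cell_configuration u w"
      by (rule mem_translate_iff[OF assms sub e])
    also have "\<dots> \<longleftrightarrow> (\<forall>x\<in>e. \<forall>y\<in>e. \<forall>n. \<lfloor>w (inv g \<otimes> x, n) + u\<rfloor> = \<lfloor>w (inv g \<otimes> y, n) + u\<rfloor>)"
      using edges_translate[of "inv g" e] assms True by (simp add: cell_configuration_def)
    also have "\<dots> \<longleftrightarrow> e \<in> cell_configuration u (\<lambda>p\<in>carrier G \<times> UNIV. w (inv g \<otimes> fst p, snd p))"
    proof -
      have "(\<lambda>p\<in>carrier G \<times> UNIV. w (inv g \<otimes> fst p, snd p)) (x, n) = w (inv g \<otimes> x, n)" if "x \<in> e" for x n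
        using that e by auto
      then show ?thesis using True by (simp add: cell_configuration_def)
    qed
    finally show ?thesis .
  next
    case False
    then show ?thesis using translate_subset[OF assms sub] by (auto simp: cell_configuration_def)
  qed
qed

lemma invariant_cell_percolation:
  assumes L: "gaussian_law (carrier G \<times> UNIV) K L"
    and K: "\<And>g x y n m. g \<in> carrier G \<Longrightarrow> x \<in> carrier G \<Longrightarrow> y \<in> carrier G \<Longrightarrow>
      K (g \<otimes> x, n) (g \<otimes> y, m) = K (x, n) (y, m)"
  shows "invariant_bond_percolation G S (distr L configuration_space (cell_configuration u))"
proof -
  let ?P = "distr L configuration_space (cell_configuration u)"
  interpret L: prob_space L using L by (simp add: gaussian_law_def)
  note m = measurable_cell_configuration[OF L, of u]
  have "distr ?P ?P (translate G g) = ?P" if g: "g \<in> carrier G" for g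
  proof -
    let ?f = "\<lambda>p :: 'g \<times> nat. (inv g \<otimes> fst p, snd p)"
    let ?sh = "\<lambda>w. \<lambda>p\<in>carrier G \<times> UNIV. w (?f p)"
    have inj: "inj_on ?f (carrier G \<times> UNIV)" "?f ` (carrier G \<times> UNIV) \<subseteq> carrier G \<times> UNIV"
      using g by (auto simp: inj_on_def)
    have sh: "distr L L ?sh = L"
      using g K by (intro gaussian_law_invariant[OF L inj]) auto
    have s: "sets L = sets (PiM (carrier G \<times> UNIV) (\<lambda>_. borel))" using L by (simp add: gaussian_law_def)
    have "?sh \<in> measurable L (PiM (carrier G \<times> UNIV) (\<lambda>_. borel))"
      using inj(2) by (intro measurable_restrict gaussian_law_measurable[OF L]) auto
    then have shm: "?sh \<in> measurable L L" using measurable_cong_sets[OF refl s] by blast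
    have comp: "translate G g \<circ> cell_configuration u = cell_configuration u \<circ> ?sh"
      using translate_cell_configuration[OF g] by (simp add: fun_eq_iff)
    have tm: "translate G g \<in> measurable configuration_space configuration_space"
    proof (rule measurable_sigma_sets[OF sets_configuration_space configuration_space_gen])
      show "translate G g \<in> space configuration_space \<rightarrow> Pow edges"
        using translate_subset[OF g] by (auto simp: space_configuration_space)
      fix Y assume "Y \<in> {{\<omega> \<in> Pow edges. e \<in> \<omega>} | e. e \<in> edges}"
      then obtain e where e: "e \<in> edges" "Y = {\<omega> \<in> Pow edges. e \<in> \<omega>}" by blast
      have "translate G g -` Y \<inter> space configuration_space = {\<omega> \<in> Pow edges. (\<lambda>x. inv g \<otimes> x) ` e \<in> \<omega>}"
        using mem_translate_iff[OF g _ edge_subset[OF e(1)]] translate_subset[OF g] e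
        by (auto simp: space_configuration_space)
      also have "\<dots> \<in> sets configuration_space"
        unfolding sets_configuration_space
        using edges_translate[of "inv g" e] g e(1) by (intro sigma_sets.Basic) auto
      finally show "translate G g -` Y \<inter> space configuration_space \<in> sets configuration_space" .
    qed
    have "distr ?P ?P (translate G g) = distr ?P configuration_space (translate G g)"
      by (rule distr_cong) simp_all
    also have "\<dots> = distr L configuration_space (translate G g \<circ> cell_configuration u)"
      by (rule distr_distr[OF tm m])
    also have "\<dots> = distr (distr L L ?sh) configuration_space (cell_configuration u)"
      unfolding comp by (rule distr_distr[symmetric, OF m shm])
    finally show ?thesis unfolding sh .
  qed
  moreover have "prob_space ?P" by (rule L.prob_space_distr[OF m])
  ultimately show ?thesis
    by (simp add: invariant_bond_percolation_def space_configuration_space sets_configuration_space)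
qed

text \<open>Averaging over the shift \<open>u\<close> of the integer grid, the probability that an edge is cut in the
  \<open>n\<close>-th coordinate is at most the mean absolute increment.\<close>

lemma exists_good_shift:
  fixes \<delta> :: "nat \<Rightarrow> real" and D :: real
  assumes L: "gaussian_law (carrier G \<times> UNIV) K L"
    and K: "\<And>p q. p \<in> carrier G \<times> UNIV \<Longrightarrow> q \<in> carrier G \<times> UNIV \<Longrightarrow> K p q = K q p"
    and \<delta>: "\<And>n. 0 \<le> \<delta> n" "\<delta> sums D" "D > 0"
    and d: "\<And>s n. s \<in> S \<Longrightarrow> K (\<one>, n) (\<one>, n) - 2 * K (\<one>, n) (s, n) + K (s, n) (s, n) \<le> (\<delta> n)\<^sup>2"
    and nonneg: "\<And>s n. s \<in> S \<Longrightarrow> 0 \<le> K (\<one>, n) (\<one>, n) - 2 * K (\<one>, n) (s, n) + K (s, n) (s, n)"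
    and S: "S \<noteq> {}"
  shows "\<exists>u. (\<Sum>s\<in>S. measure L (cut_event L u s)) \<le> 2 * card S * D"
proof (rule ccontr)
  assume "\<not> ?thesis"
  \<comment> \<open>The integral over \<open>u\<close> in the unit interval will be at most
    \<open>card S * D\<close>. The factor 2 leaves a gap, so the contradiction survives the passage
    to non-strict inequalities under the integral.\<close>
  then have big: "2 * card S * D < (\<Sum>s\<in>S. measure L (cut_event L u s))" for u
    by (meson not_le)
  interpret L: prob_space L using L by (simp add: gaussian_law_def)
  interpret LB: pair_sigma_finite L lborel by unfold_locales
  have [measurable]: "(\<lambda>w. w (\<one>, n)) \<in> borel_measurable L" for n
    by (auto intro!: gaussian_law_measurable[OF L])
  have ms[measurable]: "(\<lambda>w. w (s, n)) \<in> borel_measurable L" if "s \<in> S" for s n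
    using that S_subset by (auto intro!: gaussian_law_measurable[OF L])
  define B where "B = (\<lambda>s n (w :: 'g \<times> nat \<Rightarrow> real) (u :: real). indicator {0..1} u * (if \<lfloor>w (\<one>, n) + u\<rfloor> \<noteq> \<lfloor>w (s, n) + u\<rfloor> then 1 else 0) :: ennreal)"
  have Bm: "case_prod (B s n) \<in> borel_measurable (L \<Otimes>\<^sub>M lborel)" if s: "s \<in> S" for s n
  proof -
    have [measurable]: "(\<lambda>w. w (s, n)) \<in> borel_measurable L" by (rule ms[OF s])
    show ?thesis unfolding B_def by measurable
  qed
  have Bm1: "B s n w \<in> borel_measurable lborel" for s n w
    unfolding B_def by measurable
  have Bm2: "(\<lambda>u. \<integral>\<^sup>+w. B s n w u \<partial>L) \<in> borel_measurable lborel" if "s \<in> S" for s n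
  proof -
    have "(\<lambda>(u, w). B s n w u) \<in> borel_measurable (lborel \<Otimes>\<^sub>M L)"
      using measurable_comp[OF measurable_pair_swap' Bm[OF that]] by (simp add: comp_def split_def)
    then show ?thesis by (rule L.borel_measurable_nn_integral)
  qed
  have swap: "(\<integral>\<^sup>+u. \<integral>\<^sup>+w. B s n w u \<partial>L \<partial>lborel) \<le> ennreal (\<delta> n)" if s: "s \<in> S" for s n
  proof -
    have sG: "s \<in> carrier G" using s S_subset by auto
    let ?v = "K (\<one>, n) (\<one>, n) - 2 * K (\<one>, n) (s, n) + K (s, n) (s, n)"
    have "(\<integral>\<^sup>+u. \<integral>\<^sup>+w. B s n w u \<partial>L \<partial>lborel) = (\<integral>\<^sup>+w. \<integral>\<^sup>+u. B s n w u \<partial>lborel \<partial>L)"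
      by (rule LB.Fubini'[OF Bm[OF s]])
    also have "\<dots> \<le> (\<integral>\<^sup>+w. ennreal \<bar>w (\<one>, n) - w (s, n)\<bar> \<partial>L)"
      unfolding B_def by (intro nn_integral_mono nn_integral_floor_shift_differs)
    also have "\<dots> \<le> ennreal (sqrt ?v)"
      using nonneg[OF s, of n] sG by (intro gaussian_law_mean_increment[OF L] K) auto
    also have "\<dots> \<le> ennreal (\<delta> n)"
      using d[OF s, of n] \<delta>(1)[of n] by (intro ennreal_leI real_le_lsqrt)
    finally show ?thesis .
  qed
  have "ennreal (2 * card S * D) = (\<integral>\<^sup>+u. ennreal (2 * card S * D) * indicator {0..1::real} u \<partial>lborel)"
    by (subst nn_integral_cmult_indicator) auto
  also have "\<dots> \<le> (\<integral>\<^sup>+u. (\<Sum>s\<in>S. \<Sum>n. \<integral>\<^sup>+w. B s n w u \<partial>L) \<partial>lborel)"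
  proof (intro nn_integral_mono)
    fix u :: real
    show "ennreal (2 * card S * D) * indicator {0..1} u \<le> (\<Sum>s\<in>S. \<Sum>n. \<integral>\<^sup>+w. B s n w u \<partial>L)"
    proof (cases "u \<in> {0..1}")
      case True
      have "ennreal (2 * card S * D) \<le>
          ennreal (\<Sum>s\<in>S. measure L (cut_event L u s))"
        using big[of u] by (intro ennreal_leI) simp
      also have "\<dots> = (\<Sum>s\<in>S. emeasure L (cut_event L u s))"
        by (simp add: L.emeasure_eq_measure sum_ennreal)
      also have "\<dots> \<le> (\<Sum>s\<in>S. \<Sum>n. \<integral>\<^sup>+w. B s n w u \<partial>L)"
      proof (rule sum_mono)
        fix s assume s: "s \<in> S"
        have [measurable]: "(\<lambda>w. w (s, n)) \<in> borel_measurable L" for n by (rule ms[OF s])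
        have "cut_event L u s =
            (\<Union>n. {w \<in> space L. \<lfloor>w (\<one>, n) + u\<rfloor> \<noteq> \<lfloor>w (s, n) + u\<rfloor>})" by auto
        then have "emeasure L (cut_event L u s) \<le>
            (\<Sum>n. emeasure L {w \<in> space L. \<lfloor>w (\<one>, n) + u\<rfloor> \<noteq> \<lfloor>w (s, n) + u\<rfloor>})"
          by (simp only:) (intro emeasure_subadditive_countably, auto)
        also have "\<dots> = (\<Sum>n. \<integral>\<^sup>+w. B s n w u \<partial>L)"
        proof (rule suminf_cong)
          fix n
          have "emeasure L {w \<in> space L. \<lfloor>w (\<one>, n) + u\<rfloor> \<noteq> \<lfloor>w (s, n) + u\<rfloor>} =
              (\<integral>\<^sup>+w. indicator {w \<in> space L. \<lfloor>w (\<one>, n) + u\<rfloor> \<noteq> \<lfloor>w (s, n) + u\<rfloor>} w \<partial>L)"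
            by (rule nn_integral_indicator[symmetric]) measurable
          also have "\<dots> = (\<integral>\<^sup>+w. B s n w u \<partial>L)"
            using True by (intro nn_integral_cong) (simp add: B_def indicator_def)
          finally show "emeasure L {w \<in> space L. \<lfloor>w (\<one>, n) + u\<rfloor> \<noteq> \<lfloor>w (s, n) + u\<rfloor>} = (\<integral>\<^sup>+w. B s n w u \<partial>L)" .
        qed
        finally show "emeasure L (cut_event L u s) \<le>
            (\<Sum>n. \<integral>\<^sup>+w. B s n w u \<partial>L)" .
      qed
      finally show ?thesis using True by simp
    qed simp
  qed
  also have "\<dots> = (\<Sum>s\<in>S. \<integral>\<^sup>+u. (\<Sum>n. \<integral>\<^sup>+w. B s n w u \<partial>L) \<partial>lborel)"
    by (intro nn_integral_sum borel_measurable_suminf_order Bm2)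
  also have "\<dots> = (\<Sum>s\<in>S. \<Sum>n. \<integral>\<^sup>+u. \<integral>\<^sup>+w. B s n w u \<partial>L \<partial>lborel)"
    by (intro sum.cong refl nn_integral_suminf Bm2)
  also have "\<dots> \<le> (\<Sum>s\<in>S. \<Sum>n. ennreal (\<delta> n))"
    by (intro sum_mono suminf_le swap) auto
  also have "\<dots> = (\<Sum>s\<in>S. ennreal D)"
    using \<delta> sums_unique[OF \<delta>(2)] by (simp add: suminf_ennreal2 sums_summable)
  also have "\<dots> = ennreal (card S * D)"
    by (simp add: ennreal_mult' ennreal_of_nat_eq_real_of_nat)
  finally have "2 * card S * D \<le> card S * D"
    using \<delta>(3) by (simp add: ennreal_le_iff)
  then show False using S fin_S \<delta>(3) by (simp add: card_gt_0_iff)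
qed

text \<open>The positive root \<open>\<sigma>\<close> of the variance is quantified, so that a
  Hilbert space distance can be inserted directly.\<close>

lemma percolation_of_kernel:
  fixes \<delta> :: "nat \<Rightarrow> real" and D :: real
  assumes inf: "infinite (carrier G)" and psd: "psd_on (carrier G \<times> (UNIV :: nat set)) K"
    and inv: "\<And>g x y n m. g \<in> carrier G \<Longrightarrow> x \<in> carrier G \<Longrightarrow> y \<in> carrier G \<Longrightarrow>
      K (g \<otimes> x, n) (g \<otimes> y, m) = K (x, n) (y, m)"
    and \<delta>: "\<And>n. 0 \<le> \<delta> n" "\<delta> sums D" "D > 0"
    and d: "\<And>s n. s \<in> S \<Longrightarrow> K (\<one>, n) (\<one>, n) - 2 * K (\<one>, n) (s, n) + K (s, n) (s, n) \<le> (\<delta> n)\<^sup>2"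
    and nonneg: "\<And>s n. s \<in> carrier G \<Longrightarrow> 0 \<le> K (\<one>, n) (\<one>, n) - 2 * K (\<one>, n) (s, n) + K (s, n) (s, n)"
  shows "\<exists>P. invariant_bond_percolation G S P \<and>
    real (edge_degree edges \<one>) - prob_space.expectation P (\<lambda>\<omega>. real (edge_degree \<omega> \<one>)) \<le> 2 * card S * D \<and>
    (\<forall>x\<in>carrier G. \<forall>n. \<forall>\<sigma>>0. \<sigma>\<^sup>2 = K (\<one>, n) (\<one>, n) - 2 * K (\<one>, n) (x, n) + K (x, n) (x, n) \<longrightarrow>
      two_point_function P \<one> x \<le> 1 / \<sigma>)"
proof -
  have "countable (carrier G \<times> (UNIV :: nat set))" using countable_carrier by (intro countable_SIGMA) auto
  moreover have "infinite (carrier G \<times> (UNIV :: nat set))"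
    using inf by (auto simp: finite_cartesian_product_iff)
  ultimately obtain L where L: "gaussian_law (carrier G \<times> UNIV) K L"
    using gaussian_law_exists psd by blast
  have sym: "K p q = K q p" if "p \<in> carrier G \<times> UNIV" "q \<in> carrier G \<times> UNIV" for p q
    using psd_onD(1)[OF psd that] .
  have Sne: "S \<noteq> {}"
  proof
    assume "S = {}"
    then have "carrier G = {\<one>}" using S_gen generate_empty by simp
    then show False using inf by simp
  qed
  obtain u where u: "(\<Sum>s\<in>S. measure L (cut_event L u s)) \<le> 2 * card S * D"
    using exists_good_shift[OF L sym \<delta> d nonneg Sne] S_subset by blast
  define P where "P = distr L configuration_space (cell_configuration u)"
  have P: "invariant_bond_percolation G S P"
    unfolding P_def using L inv by (rule invariant_cell_percolation)
  interpret L: prob_space L using L by (simp add: gaussian_law_def)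
  interpret bp: bond_percolation G S P by unfold_locales (rule P)
  note m = measurable_cell_configuration[OF L, of u]
  have PL: "measure P Y = measure L {w \<in> space L. cell_configuration u w \<in> Y}" if "Y \<in> sets P" for Y
  proof -
    have "measure P Y = measure L (cell_configuration u -` Y \<inter> space L)"
      using that unfolding P_def by (intro measure_distr[OF m]) simp
    also have "cell_configuration u -` Y \<inter> space L = {w \<in> space L. cell_configuration u w \<in> Y}" by auto
    finally show ?thesis .
  qed
  have cs: "cell_configuration u w \<in> space P" for w
    unfolding bp.space_P by (auto simp: cell_configuration_def)
  have "real (edge_degree edges \<one>) - bp.expectation (\<lambda>\<omega>. real (edge_degree \<omega> \<one>)) =
      (\<Sum>e\<in>(\<lambda>s. {\<one>, s}) ` S. 1 - measure P {\<omega> \<in> space P. e \<in> \<omega>})"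
    by (simp add: sum_subtractf edge_degree_one_edges bp.expectation_edge_degree)
  also have "\<dots> \<le> (\<Sum>s\<in>S. 1 - measure P {\<omega> \<in> space P. {\<one>, s} \<in> \<omega>})"
    using fin_S by (intro sum_image_le[THEN order_trans]) auto
  also have "\<dots> = (\<Sum>s\<in>S. measure L (cut_event L u s))"
  proof (rule sum.cong[OF refl])
    fix s assume s: "s \<in> S"
    then have e: "{\<one>, s} \<in> edges" using edges_one by blast
    have sG: "s \<in> carrier G" using s S_subset by auto
    have [measurable]: "(\<lambda>w. w (\<one>, n)) \<in> borel_measurable L" "(\<lambda>w. w (s, n)) \<in> borel_measurable L" for n
      using sG by (auto intro!: gaussian_law_measurable[OF L])
    have "measure P {\<omega> \<in> space P. {\<one>, s} \<in> \<omega>} = measure L {w \<in> space L. \<forall>n. \<lfloor>w (\<one>, n) + u\<rfloor> = \<lfloor>w (s, n) + u\<rfloor>}"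
      using e cs by (subst PL) (auto intro!: arg_cong[of _ _ "measure L"] simp: cell_configuration_def)
    moreover have "cut_event L u s =
        space L - {w \<in> space L. \<forall>n. \<lfloor>w (\<one>, n) + u\<rfloor> = \<lfloor>w (s, n) + u\<rfloor>}" by auto
    moreover have "{w \<in> space L. \<forall>n. \<lfloor>w (\<one>, n) + u\<rfloor> = \<lfloor>w (s, n) + u\<rfloor>} \<in> sets L" by measurable
    ultimately show "1 - measure P {\<omega> \<in> space P. {\<one>, s} \<in> \<omega>} =
        measure L (cut_event L u s)"
      using L.prob_compl by simp
  qed
  finally have deg: "real (edge_degree edges \<one>) - bp.expectation (\<lambda>\<omega>. real (edge_degree \<omega> \<one>)) \<le> 2 * card S * D"
    using u by simp
  have "two_point_function P \<one> x \<le> 1 / \<sigma>"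
    if x: "x \<in> carrier G" and \<sigma>: "\<sigma> > 0" "\<sigma>\<^sup>2 = K (\<one>, n) (\<one>, n) - 2 * K (\<one>, n) (x, n) + K (x, n) (x, n)" for x n \<sigma>
  proof -
    have [measurable]: "(\<lambda>w. w (\<one>, n)) \<in> borel_measurable L" "(\<lambda>w. w (x, n)) \<in> borel_measurable L"
      using x by (auto intro!: gaussian_law_measurable[OF L])
    have "two_point_function P \<one> x = measure L {w \<in> space L. connected_in (cell_configuration u w) \<one> x}"
      unfolding bp.tau_eq using cs by (subst PL) auto
    also have "\<dots> \<le> measure L {w \<in> space L. \<bar>w (\<one>, n) - w (x, n)\<bar> < 1}"
    proof (intro L.finite_measure_mono subsetI)
      fix w assume "w \<in> {w \<in> space L. connected_in (cell_configuration u w) \<one> x}"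
      then have w: "w \<in> space L" "connected_in (cell_configuration u w) \<one> x" by auto
      have "\<lfloor>w (\<one>, n) + u\<rfloor> = \<lfloor>w (x, n) + u\<rfloor>"
      proof (rule connected_in_imp_eq[OF w(2)])
        fix a b assume "{a, b} \<in> cell_configuration u w"
        then show "\<lfloor>w (a, n) + u\<rfloor> = \<lfloor>w (b, n) + u\<rfloor>" unfolding cell_configuration_def by blast
      qed
      then have "\<bar>w (\<one>, n) - w (x, n)\<bar> < 1" by linarith
      then show "w \<in> {w \<in> space L. \<bar>w (\<one>, n) - w (x, n)\<bar> < 1}" using w by simp
    qed measurable
    also have "\<dots> \<le> 1 / \<sigma>"
      using x \<sigma> sym by (intro gaussian_law_small_increment[OF L]) auto
    finally show ?thesis .
  qed
  then show ?thesis using P deg by blast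
qed

end

section \<open>The space of square-summable sequences\<close>

text \<open>\<open>J\<close> will be the set of pivots. Coordinates outside \<open>J\<close> are
  invisible to the kernel vectors, so they must be 0 for a vector to be determined by its
  values.\<close>

definition l2_on :: "nat set \<Rightarrow> (nat \<Rightarrow> complex) set" where
  "l2_on J = {f. (\<forall>j. j \<notin> J \<longrightarrow> f j = 0) \<and> summable (\<lambda>j. (cmod (f j))\<^sup>2)}"

definition l2_ip :: "(nat \<Rightarrow> complex) \<Rightarrow> (nat \<Rightarrow> complex) \<Rightarrow> complex" where
  "l2_ip f g = (\<Sum>j. cnj (f j) * g j)"

definition l2_sq :: "(nat \<Rightarrow> complex) \<Rightarrow> real" where
  "l2_sq f = (\<Sum>j. (cmod (f j))\<^sup>2)"

lemma l2_onD: "f \<in> l2_on J \<Longrightarrow> j \<notin> J \<Longrightarrow> f j = 0" "f \<in> l2_on J \<Longrightarrow> summable (\<lambda>j. (cmod (f j))\<^sup>2)"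
  by (auto simp: l2_on_def)

lemma l2_zero: "(\<lambda>_. 0) \<in> l2_on J"
  by (simp add: l2_on_def)

lemma l2_smult: "f \<in> l2_on J \<Longrightarrow> (\<lambda>j. c * f j) \<in> l2_on J"
  by (auto simp: l2_on_def norm_mult power_mult_distrib intro: summable_mult)

lemma l2_add:
  assumes "f \<in> l2_on J" "g \<in> l2_on J"
  shows "(\<lambda>j. f j + g j) \<in> l2_on J"
proof -
  have "summable (\<lambda>j. (cmod (f j + g j))\<^sup>2)"
  proof (rule summable_comparison_test[rule_format], intro exI allI impI)
    fix j :: nat
    have "(cmod (f j + g j))\<^sup>2 \<le> (cmod (f j) + cmod (g j))\<^sup>2"
      by (intro power_mono norm_triangle_ineq) simp
    also have "\<dots> \<le> 2 * (cmod (f j))\<^sup>2 + 2 * (cmod (g j))\<^sup>2"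
      using sum_squares_bound[of "cmod (f j)" "cmod (g j)"] by (simp add: power2_sum)
    finally show "norm ((cmod (f j + g j))\<^sup>2) \<le> 2 * (cmod (f j))\<^sup>2 + 2 * (cmod (g j))\<^sup>2" by simp
  next
    show "summable (\<lambda>j. 2 * (cmod (f j))\<^sup>2 + 2 * (cmod (g j))\<^sup>2)"
      using assms by (intro summable_add summable_mult) (auto dest: l2_onD)
  qed
  then show ?thesis using assms by (auto simp: l2_on_def)
qed

lemma l2_minus: "f \<in> l2_on J \<Longrightarrow> g \<in> l2_on J \<Longrightarrow> (\<lambda>j. f j - g j) \<in> l2_on J"
  using l2_add[of f J "\<lambda>j. - 1 * g j"] l2_smult[of g J "- 1"] by simp

lemma l2_ip_summable:
  assumes "f \<in> l2_on J" "g \<in> l2_on J"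
  shows "summable (\<lambda>j. cnj (f j) * g j)"
proof (rule summable_comparison_test[rule_format], intro exI allI impI)
  fix j :: nat
  have "norm (cnj (f j) * g j) = cmod (f j) * cmod (g j)" by (simp add: norm_mult)
  also have "\<dots> \<le> (cmod (f j))\<^sup>2 + (cmod (g j))\<^sup>2"
  proof -
    have "0 \<le> cmod (f j) * cmod (g j)" by simp
    then show ?thesis using sum_squares_bound[of "cmod (f j)" "cmod (g j)"] unfolding mult.assoc by linarith
  qed
  finally show "norm (cnj (f j) * g j) \<le> (cmod (f j))\<^sup>2 + (cmod (g j))\<^sup>2" .
next
  show "summable (\<lambda>j. (cmod (f j))\<^sup>2 + (cmod (g j))\<^sup>2)"
    using assms by (intro summable_add) (auto dest: l2_onD)
qed

lemma l2_ip_self: "f \<in> l2_on J \<Longrightarrow> l2_ip f f = complex_of_real (l2_sq f)"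
proof -
  assume f: "f \<in> l2_on J"
  have "(\<lambda>j. cnj (f j) * f j) = (\<lambda>j. complex_of_real ((cmod (f j))\<^sup>2))"
    by (simp only: complex_norm_square mult.commute)
  then show ?thesis
    unfolding l2_ip_def l2_sq_def by (simp only: suminf_of_real[OF l2_onD(2)[OF f]])
qed

lemma l2_ip_add:
  "f \<in> l2_on J \<Longrightarrow> g \<in> l2_on J \<Longrightarrow> h \<in> l2_on J \<Longrightarrow> l2_ip f (\<lambda>j. g j + h j) = l2_ip f g + l2_ip f h"
  unfolding l2_ip_def by (subst suminf_add) (auto simp: l2_ip_summable distrib_left)

lemma l2_ip_smult:
  assumes "f \<in> l2_on J" "g \<in> l2_on J"
  shows "l2_ip f (\<lambda>j. c * g j) = c * l2_ip f g"
proof -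
  have "(\<lambda>j. cnj (f j) * (c * g j)) = (\<lambda>j. c * (cnj (f j) * g j))" by (simp add: fun_eq_iff)
  then show ?thesis unfolding l2_ip_def using suminf_mult[OF l2_ip_summable[OF assms]] by simp
qed

lemma l2_ip_commute:
  assumes "f \<in> l2_on J" "g \<in> l2_on J"
  shows "l2_ip g f = cnj (l2_ip f g)"
proof -
  have "(\<lambda>j. cnj (f j) * g j) sums l2_ip f g"
    unfolding l2_ip_def using l2_ip_summable[OF assms] by (rule summable_sums)
  then have "(\<lambda>j. cnj (cnj (f j) * g j)) sums cnj (l2_ip f g)" by (rule sums_cnj[THEN iffD2])
  then show ?thesis by (simp add: l2_ip_def sums_iff mult.commute)
qed

lemma l2_sq_nonneg: "f \<in> l2_on J \<Longrightarrow> 0 \<le> l2_sq f"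
  unfolding l2_sq_def by (intro suminf_nonneg) (auto dest: l2_onD)

lemma l2_sq_eq_0: "f \<in> l2_on J \<Longrightarrow> l2_sq f = 0 \<Longrightarrow> f = (\<lambda>_. 0)"
  unfolding l2_sq_def by (subst (asm) suminf_eq_zero_iff) (auto dest: l2_onD)

lemma l2_partial_sum_le: "f \<in> l2_on J \<Longrightarrow> finite I \<Longrightarrow> (\<Sum>j\<in>I. (cmod (f j))\<^sup>2) \<le> l2_sq f"
  unfolding l2_sq_def by (intro sum_le_suminf) (auto dest: l2_onD)

lemma l2_sq_leI:
  assumes "\<And>j. j \<notin> J \<Longrightarrow> f j = 0" and "\<And>n. (\<Sum>j<n. (cmod (f j))\<^sup>2) \<le> C"
  shows "f \<in> l2_on J" "l2_sq f \<le> C"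
proof -
  have s: "summable (\<lambda>j. (cmod (f j))\<^sup>2)"
  proof (rule bounded_imp_summable[of _ C])
    show "(\<Sum>j\<le>n. (cmod (f j))\<^sup>2) \<le> C" for n
      using assms(2)[of "Suc n"] by (simp only: lessThan_Suc_atMost)
  qed simp
  then show "f \<in> l2_on J" using assms(1) by (simp add: l2_on_def)
  show "l2_sq f \<le> C" unfolding l2_sq_def using s assms(2) by (intro suminf_le_const)
qed

lemma l2_sq_add:
  assumes "f \<in> l2_on J" "g \<in> l2_on J"
  shows "l2_sq (\<lambda>j. f j + g j) = l2_sq f + 2 * Re (l2_ip f g) + l2_sq g"
proof -
  let ?s = "\<lambda>j. f j + g j"
  note s = l2_add[OF assms]
  have "l2_ip ?s ?s = l2_ip ?s f + l2_ip ?s g" by (rule l2_ip_add[OF s assms])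
  also have "l2_ip ?s f = cnj (l2_ip f f + l2_ip f g)"
    using l2_ip_commute[OF assms(1) s] l2_ip_add[OF assms(1) assms] by simp
  also have "l2_ip ?s g = cnj (l2_ip g f + l2_ip g g)"
    using l2_ip_commute[OF assms(2) s] l2_ip_add[OF assms(2) assms] by simp
  finally have "Re (l2_ip ?s ?s) = l2_sq f + 2 * Re (l2_ip f g) + l2_sq g"
    using l2_ip_commute[OF assms] by (simp add: l2_ip_self[OF assms(1)] l2_ip_self[OF assms(2)])
  then show ?thesis by (simp add: l2_ip_self[OF s])
qed

text \<open>Polarisation: the norms of the two sums determine the real and the imaginary part. It
  upgrades preservation of norms to preservation of inner products.\<close>

lemma l2_ip_eq_of_sq_eq:
  assumes "f \<in> l2_on J" "g \<in> l2_on J" "f' \<in> l2_on J" "g' \<in> l2_on J"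
    and f: "l2_sq f = l2_sq f'" and g: "l2_sq g = l2_sq g'"
    and s: "l2_sq (\<lambda>j. f j + g j) = l2_sq (\<lambda>j. f' j + g' j)"
    and i: "l2_sq (\<lambda>j. f j + \<i> * g j) = l2_sq (\<lambda>j. f' j + \<i> * g' j)"
  shows "l2_ip f g = l2_ip f' g'"
proof -
  have r: "Re (l2_ip f g) = Re (l2_ip f' g')"
    using s f g l2_sq_add[OF assms(1,2)] l2_sq_add[OF assms(3,4)] by simp
  have sq: "l2_sq (\<lambda>j. \<i> * h j) = l2_sq h" for h by (simp add: l2_sq_def norm_mult)
  have "Re (l2_ip f (\<lambda>j. \<i> * g j)) = Re (l2_ip f' (\<lambda>j. \<i> * g' j))"
    using i f g l2_sq_add[OF assms(1) l2_smult[OF assms(2)], of \<i>]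
      l2_sq_add[OF assms(3) l2_smult[OF assms(4)], of \<i>] by (simp add: sq)
  then have "Im (l2_ip f g) = Im (l2_ip f' g')"
    by (simp add: l2_ip_smult[OF assms(1,2)] l2_ip_smult[OF assms(3,4)])
  then show ?thesis using r by (simp add: complex_eq_iff)
qed

lemma l2_complete:
  assumes x: "\<And>n. x n \<in> l2_on J"
    and cauchy: "\<And>e. e > 0 \<Longrightarrow> \<exists>N. \<forall>m\<ge>N. \<forall>n\<ge>N. sqrt (l2_sq (\<lambda>j. x m j - x n j)) < e"
  shows "\<exists>y\<in>l2_on J. (\<lambda>n. sqrt (l2_sq (\<lambda>j. x n j - y j))) \<longlonglongrightarrow> 0"
proof -
  note d = l2_minus[OF x x]
  have "convergent (\<lambda>n. x n j)" for j
  proof (rule Cauchy_convergent, rule metric_CauchyI)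
    fix e :: real assume "e > 0"
    then obtain N where N: "\<And>m n. m \<ge> N \<Longrightarrow> n \<ge> N \<Longrightarrow> sqrt (l2_sq (\<lambda>j. x m j - x n j)) < e"
      using cauchy by blast
    show "\<exists>M. \<forall>m\<ge>M. \<forall>n\<ge>M. dist (x m j) (x n j) < e"
    proof (intro exI[of _ N] allI impI)
      fix m n assume "N \<le> m" "N \<le> n"
      have "(cmod (x m j - x n j))\<^sup>2 \<le> l2_sq (\<lambda>j. x m j - x n j)"
        using l2_partial_sum_le[OF d, of "{j}" m n] by simp
      then have "cmod (x m j - x n j) \<le> sqrt (l2_sq (\<lambda>j. x m j - x n j))"
        by (rule real_le_rsqrt)
      then show "dist (x m j) (x n j) < e" using N[OF \<open>N \<le> m\<close> \<open>N \<le> n\<close>] by (simp add: dist_norm)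
    qed
  qed
  then have "\<exists>y. \<forall>j. (\<lambda>n. x n j) \<longlonglongrightarrow> y j" unfolding convergent_def by (rule choice[OF allI])
  then obtain y where y: "\<And>j. (\<lambda>n. x n j) \<longlonglongrightarrow> y j" by blast
  have close: "(\<lambda>j. x n j - y j) \<in> l2_on J \<and> l2_sq (\<lambda>j. x n j - y j) \<le> e\<^sup>2"
    if N: "\<And>m n. m \<ge> N \<Longrightarrow> n \<ge> N \<Longrightarrow> sqrt (l2_sq (\<lambda>j. x m j - x n j)) < e" and n: "n \<ge> N" for N n e
  proof -
    have J: "x n j - y j = 0" if "j \<notin> J" for j
    proof -
      have "(\<lambda>n. x n j) = (\<lambda>_. 0)" using l2_onD(1)[OF x that] by simp
      then have "y j = 0" using y[of j] LIMSEQ_const_iff[of 0 "y j"] by simp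
      then show ?thesis using l2_onD(1)[OF x that] by simp
    qed
    \<comment> \<open>On finitely many coordinates the Cauchy bound passes to the limit in
      \<open>m\<close>; bounded partial sums then put the difference into the space, with norm at
      most \<open>e\<close>.\<close>
    have bound: "(\<Sum>j<k. (cmod (x n j - y j))\<^sup>2) \<le> e\<^sup>2" for k
    proof (rule LIMSEQ_le_const2)
      show "(\<lambda>m. \<Sum>j<k. (cmod (x n j - x m j))\<^sup>2) \<longlonglongrightarrow> (\<Sum>j<k. (cmod (x n j - y j))\<^sup>2)"
        by (intro tendsto_intros y)
      show "\<exists>N. \<forall>m\<ge>N. (\<Sum>j<k. (cmod (x n j - x m j))\<^sup>2) \<le> e\<^sup>2"
      proof (intro exI[of _ N] allI impI)
        fix m assume "N \<le> m"
        have "(\<Sum>j<k. (cmod (x n j - x m j))\<^sup>2) \<le> l2_sq (\<lambda>j. x n j - x m j)"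
          by (rule l2_partial_sum_le[OF d]) simp
        also have "\<dots> = (sqrt (l2_sq (\<lambda>j. x n j - x m j)))\<^sup>2" using l2_sq_nonneg[OF d] by simp
        also have "\<dots> \<le> e\<^sup>2"
          using N[OF n \<open>N \<le> m\<close>] l2_sq_nonneg[OF d, of n m] by (intro power_mono) auto
        finally show "(\<Sum>j<k. (cmod (x n j - x m j))\<^sup>2) \<le> e\<^sup>2" .
      qed
    qed
    show ?thesis using l2_sq_leI[of J "\<lambda>j. x n j - y j", OF J bound] by blast
  qed
  obtain N0 where "\<And>m n. m \<ge> N0 \<Longrightarrow> n \<ge> N0 \<Longrightarrow> sqrt (l2_sq (\<lambda>j. x m j - x n j)) < 1"
    using cauchy[of 1] by auto
  then have "(\<lambda>j. x N0 j - y j) \<in> l2_on J" using close by blast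
  then have yL: "y \<in> l2_on J" using l2_minus[OF x[of N0], of "\<lambda>j. x N0 j - y j"] by simp
  have "(\<lambda>n. sqrt (l2_sq (\<lambda>j. x n j - y j))) \<longlonglongrightarrow> 0"
  proof (rule LIMSEQ_I)
    fix e :: real assume e: "e > 0"
    then obtain N where N: "\<And>m n. m \<ge> N \<Longrightarrow> n \<ge> N \<Longrightarrow> sqrt (l2_sq (\<lambda>j. x m j - x n j)) < e / 2"
      using cauchy[of "e / 2"] by auto
    show "\<exists>N. \<forall>n\<ge>N. norm (sqrt (l2_sq (\<lambda>j. x n j - y j)) - 0) < e"
    proof (intro exI[of _ N] allI impI)
      fix n assume "N \<le> n"
      then have "l2_sq (\<lambda>j. x n j - y j) \<le> (e / 2)\<^sup>2" using close[OF N] by blast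
      then have "sqrt (l2_sq (\<lambda>j. x n j - y j)) \<le> e / 2" using e by (intro real_le_lsqrt) auto
      then show "norm (sqrt (l2_sq (\<lambda>j. x n j - y j)) - 0) < e"
        using e l2_sq_nonneg[OF l2_minus[OF x yL]] by simp
    qed
  qed
  then show ?thesis using yL by blast
qed

text \<open>The Hilbert space \<open>l2_on J\<close>, transported along an injection into a type that serves as the
  universe of vectors.\<close>

definition l2_module :: "nat set \<Rightarrow> ((nat \<Rightarrow> complex) \<Rightarrow> 'v) \<Rightarrow> 'v inner_module" where
  "l2_module J \<iota> = \<lparr>carrier = \<iota> ` l2_on J, monoid.mult = undefined, one = undefined,
     ring.zero = \<iota> (\<lambda>_. 0), add = (\<lambda>x y. \<iota> (\<lambda>j. inv_into UNIV \<iota> x j + inv_into UNIV \<iota> y j)),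
     module.smult = (\<lambda>c x. \<iota> (\<lambda>j. c * inv_into UNIV \<iota> x j)), ip = (\<lambda>x y. l2_ip (inv_into UNIV \<iota> x) (inv_into UNIV \<iota> y))\<rparr>"

context
  fixes J :: "nat set" and \<iota> :: "(nat \<Rightarrow> complex) \<Rightarrow> 'v"
  assumes inj: "inj \<iota>"
begin

lemma l2_module_simps:
  "carrier (l2_module J \<iota>) = \<iota> ` l2_on J"
  "\<zero>\<^bsub>l2_module J \<iota>\<^esub> = \<iota> (\<lambda>_. 0)"
  "\<iota> f \<oplus>\<^bsub>l2_module J \<iota>\<^esub> \<iota> g = \<iota> (\<lambda>j. f j + g j)"
  "c \<odot>\<^bsub>l2_module J \<iota>\<^esub> \<iota> f = \<iota> (\<lambda>j. c * f j)"
  "ip (l2_module J \<iota>) (\<iota> f) (\<iota> g) = l2_ip f g"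
  using inj by (simp_all add: l2_module_def)

lemma abelian_group_l2_module: "abelian_group (l2_module J \<iota>)"
proof (rule abelian_groupI)
  fix x assume "x \<in> carrier (l2_module J \<iota>)"
  then obtain f where f: "f \<in> l2_on J" "x = \<iota> f" by (auto simp: l2_module_simps)
  have "(\<lambda>j. - f j) \<in> l2_on J" using l2_smult[OF f(1), of "- 1"] by simp
  then show "\<exists>y\<in>carrier (l2_module J \<iota>). y \<oplus>\<^bsub>l2_module J \<iota>\<^esub> x = \<zero>\<^bsub>l2_module J \<iota>\<^esub>"
    using f by (intro bexI[of _ "\<iota> (\<lambda>j. - f j)"]) (auto simp: l2_module_simps)
qed (auto simp: l2_module_simps l2_zero add_ac intro: l2_add)

lemma l2_module_minus:
  assumes "f \<in> l2_on J" "g \<in> l2_on J"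
  shows "\<iota> f \<ominus>\<^bsub>l2_module J \<iota>\<^esub> \<iota> g = \<iota> (\<lambda>j. f j - g j)"
proof -
  interpret abelian_group "l2_module J \<iota>" by (rule abelian_group_l2_module)
  have n: "(\<lambda>j. - g j) \<in> l2_on J" using l2_smult[OF assms(2), of "- 1"] by simp
  have "\<ominus>\<^bsub>l2_module J \<iota>\<^esub> \<iota> g = \<iota> (\<lambda>j. - g j)"
    using assms n by (intro minus_equality) (auto simp: l2_module_simps)
  then show ?thesis by (simp add: a_minus_def l2_module_simps)
qed

lemma hnorm_l2_module: "f \<in> l2_on J \<Longrightarrow> hnorm (l2_module J \<iota>) (\<iota> f) = sqrt (l2_sq f)"
  by (simp add: hnorm_def l2_module_simps l2_ip_self)

lemma complex_hilbert_space_l2_module: "complex_hilbert_space (l2_module J \<iota>)"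
proof -
  interpret abelian_group "l2_module J \<iota>" by (rule abelian_group_l2_module)
  have mod: "module (ring_of_type_algebra :: complex ring) (l2_module J \<iota>)"
    by (intro module.intro module_axioms.intro cring_from_type_algebra abelian_group_l2_module)
       (auto simp: l2_module_simps ring_of_type_algebra_def algebra_simps intro: l2_smult)
  show ?thesis
  proof (intro complex_hilbert_space.intro complex_hilbert_space_axioms.intro mod)
    fix x assume x: "x \<in> carrier (l2_module J \<iota>)" "x \<noteq> \<zero>\<^bsub>l2_module J \<iota>\<^esub>"
    then obtain f where f: "f \<in> l2_on J" "x = \<iota> f" by (auto simp: l2_module_simps)
    then have "l2_sq f \<noteq> 0" using x(2) l2_sq_eq_0[OF f(1)] by (auto simp: l2_module_simps)
    then show "0 < Re (ip (l2_module J \<iota>) x x)"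
      using f l2_sq_nonneg[OF f(1)] by (simp add: l2_module_simps l2_ip_self)
  next
    fix x :: "nat \<Rightarrow> 'v"
    assume x: "\<And>n. x n \<in> carrier (l2_module J \<iota>)"
      and c: "\<And>e. 0 < e \<Longrightarrow> \<exists>N. \<forall>m\<ge>N. \<forall>n\<ge>N. hnorm (l2_module J \<iota>) (x m \<ominus>\<^bsub>l2_module J \<iota>\<^esub> x n) < e"
    have "\<exists>f. \<forall>n. f n \<in> l2_on J \<and> x n = \<iota> (f n)"
      using x by (intro choice allI) (auto simp: l2_module_simps)
    then obtain f where f: "\<And>n. f n \<in> l2_on J" "\<And>n. x n = \<iota> (f n)" by blast
    have h: "hnorm (l2_module J \<iota>) (x m \<ominus>\<^bsub>l2_module J \<iota>\<^esub> \<iota> g) = sqrt (l2_sq (\<lambda>j. f m j - g j))"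
      if "g \<in> l2_on J" for m g
      using that f by (simp add: l2_module_minus hnorm_l2_module l2_minus)
    have "\<exists>y\<in>l2_on J. (\<lambda>n. sqrt (l2_sq (\<lambda>j. f n j - y j))) \<longlonglongrightarrow> 0"
    proof (rule l2_complete[OF f(1)])
      fix e :: real assume "e > 0"
      then show "\<exists>N. \<forall>m\<ge>N. \<forall>n\<ge>N. sqrt (l2_sq (\<lambda>j. f m j - f n j)) < e"
        using c[of e] h[OF f(1)] by (simp add: f(2))
    qed
    then obtain y where y: "y \<in> l2_on J" "(\<lambda>n. sqrt (l2_sq (\<lambda>j. f n j - y j))) \<longlonglongrightarrow> 0" by blast
    then show "\<exists>z\<in>carrier (l2_module J \<iota>). (\<lambda>n. hnorm (l2_module J \<iota>) (x n \<ominus>\<^bsub>l2_module J \<iota>\<^esub> z)) \<longlonglongrightarrow> 0"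
      by (intro bexI[of _ "\<iota> y"]) (auto simp: h l2_module_simps)
  qed (auto simp: l2_module_simps intro: l2_ip_add l2_ip_smult l2_ip_commute)
qed

end

text \<open>The inner product of the kernel vector of \<open>x\<close> with \<open>f\<close>, a
  finite sum for rows of a kernel factor. It views \<open>f\<close> as a function in the reproducing
  kernel Hilbert space of \<open>K\<close>.\<close>

definition l2_eval :: "('a \<Rightarrow> nat \<Rightarrow> real) \<Rightarrow> (nat \<Rightarrow> complex) \<Rightarrow> 'a \<Rightarrow> complex" where
  "l2_eval a f x = (\<Sum>j\<in>{j. a x j \<noteq> 0}. complex_of_real (a x j) * f j)"

text \<open>For a kernel with a factor the sum is real already, namely the squared norm of the
  combination of kernel vectors with coefficients \<open>c\<close>; \<open>Re\<close> only changes
  the type.\<close>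

definition kernel_quad :: "('a \<Rightarrow> 'a \<Rightarrow> real) \<Rightarrow> 'a set \<Rightarrow> ('a \<Rightarrow> complex) \<Rightarrow> real" where
  "kernel_quad K F c = Re (\<Sum>x\<in>F. \<Sum>y\<in>F. c x * cnj (c y) * complex_of_real (K x y))"

lemma l2_eval_add: "l2_eval a (\<lambda>j. f j + g j) x = l2_eval a f x + l2_eval a g x"
  by (simp add: l2_eval_def distrib_left sum.distrib)

lemma l2_eval_smult: "l2_eval a (\<lambda>j. c * f j) x = c * l2_eval a f x"
  by (simp add: l2_eval_def sum_distrib_left mult_ac)

lemma l2_eval_eq_sum:
  assumes "finite I" "{j. a x j \<noteq> 0} \<subseteq> I"
  shows "l2_eval a f x = (\<Sum>j\<in>I. complex_of_real (a x j) * f j)"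
  unfolding l2_eval_def using assms by (intro sum.mono_neutral_left) auto

context
  fixes A :: "'a set" and K :: "'a \<Rightarrow> 'a \<Rightarrow> real" and J :: "nat set" and a :: "'a \<Rightarrow> nat \<Rightarrow> real"
  assumes kf: "kernel_factor A K J a"
begin

lemma kernel_factorD:
  shows "x \<in> A \<Longrightarrow> finite {j. a x j \<noteq> 0}" "x \<in> A \<Longrightarrow> {j. a x j \<noteq> 0} \<subseteq> J"
    and "x \<in> A \<Longrightarrow> y \<in> A \<Longrightarrow> K x y = (\<Sum>j\<in>{j. a x j \<noteq> 0}. a x j * a y j)"
    and "j \<in> J \<Longrightarrow> \<exists>F b. finite F \<and> F \<subseteq> A \<and> (\<forall>i. (\<Sum>x\<in>F. b x * a x i) = (if i = j then 1 else 0))"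
  using kf unfolding kernel_factor_def by blast+

lemma kernel_quad_eq:
  assumes F: "finite F" "F \<subseteq> A" and I: "finite I" "\<And>x. x \<in> F \<Longrightarrow> {j. a x j \<noteq> 0} \<subseteq> I"
  shows "kernel_quad K F c = (\<Sum>i\<in>I. (cmod (\<Sum>x\<in>F. c x * complex_of_real (a x i)))\<^sup>2)"
proof -
  have "complex_of_real (\<Sum>i\<in>I. (cmod (\<Sum>x\<in>F. c x * complex_of_real (a x i)))\<^sup>2) =
      (\<Sum>i\<in>I. (\<Sum>x\<in>F. c x * complex_of_real (a x i)) * (\<Sum>y\<in>F. cnj (c y) * complex_of_real (a y i)))"
    unfolding of_real_sum complex_norm_square by simp
  also have "\<dots> = (\<Sum>i\<in>I. \<Sum>x\<in>F. \<Sum>y\<in>F. c x * cnj (c y) * complex_of_real (a x i * a y i))"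
    by (simp add: sum_product mult_ac)
  also have "\<dots> = (\<Sum>x\<in>F. \<Sum>i\<in>I. \<Sum>y\<in>F. c x * cnj (c y) * complex_of_real (a x i * a y i))"
    by (rule sum.swap)
  also have "\<dots> = (\<Sum>x\<in>F. \<Sum>y\<in>F. \<Sum>i\<in>I. c x * cnj (c y) * complex_of_real (a x i * a y i))"
    by (intro sum.cong refl sum.swap)
  also have "\<dots> = (\<Sum>x\<in>F. \<Sum>y\<in>F. c x * cnj (c y) * complex_of_real (K x y))"
  proof (intro sum.cong refl)
    fix x y assume xy: "x \<in> F" "y \<in> F"
    then have "x \<in> A" "y \<in> A" using F by auto
    then have "K x y = (\<Sum>j\<in>{j. a x j \<noteq> 0}. a x j * a y j)" by (rule kernel_factorD(3))
    also have "\<dots> = (\<Sum>i\<in>I. a x i * a y i)"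
      using I xy by (intro sum.mono_neutral_left) auto
    finally show "(\<Sum>i\<in>I. c x * cnj (c y) * complex_of_real (a x i * a y i)) = c x * cnj (c y) * complex_of_real (K x y)"
      by (simp only: sum_distrib_left of_real_sum)
  qed
  finally have "kernel_quad K F c = Re (complex_of_real (\<Sum>i\<in>I. (cmod (\<Sum>x\<in>F. c x * complex_of_real (a x i)))\<^sup>2))"
    unfolding kernel_quad_def by simp
  then show ?thesis by (simp only: Re_complex_of_real)
qed

text \<open>Cauchy-Schwarz for \<open>f\<close> and a combination of kernel vectors.
  \<open>l2_eval_surj\<close> is the converse with the same constant, so together they characterise
  the functions \<open>l2_eval a f\<close> and the norm of \<open>f\<close>.\<close>

lemma l2_eval_bound:
  assumes f: "f \<in> l2_on J" and F: "finite F" "F \<subseteq> A"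
  shows "(cmod (\<Sum>x\<in>F. c x * l2_eval a f x))\<^sup>2 \<le> l2_sq f * kernel_quad K F c"
proof -
  define I where "I = (\<Union>x\<in>F. {j. a x j \<noteq> 0})"
  define d where "d = (\<lambda>i. \<Sum>x\<in>F. c x * complex_of_real (a x i))"
  have I: "finite I" using F kernel_factorD(1) by (auto simp: I_def)
  have sub: "{j. a x j \<noteq> 0} \<subseteq> I" if "x \<in> F" for x using that by (auto simp: I_def)
  have ev: "l2_eval a u x = (\<Sum>j\<in>I. complex_of_real (a x j) * u j)" if "x \<in> F" for u x
    using l2_eval_eq_sum[OF I, of a x u] sub[OF that] by simp
  have "(\<Sum>x\<in>F. c x * l2_eval a f x) = (\<Sum>x\<in>F. \<Sum>i\<in>I. c x * complex_of_real (a x i) * f i)"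
    using ev by (simp add: sum_distrib_left mult.assoc)
  also have "\<dots> = (\<Sum>i\<in>I. d i * f i)"
    unfolding d_def sum_distrib_right by (rule sum.swap)
  finally have "cmod (\<Sum>x\<in>F. c x * l2_eval a f x) \<le> (\<Sum>i\<in>I. cmod (d i) * cmod (f i))"
    by (simp add: norm_mult[symmetric] norm_sum)
  also have "\<dots> \<le> L2_set (\<lambda>i. cmod (d i)) I * L2_set (\<lambda>i. cmod (f i)) I"
    using L2_set_mult_ineq[of "\<lambda>i. cmod (d i)" "\<lambda>i. cmod (f i)" I] by simp
  finally have "(cmod (\<Sum>x\<in>F. c x * l2_eval a f x))\<^sup>2 \<le>
      (L2_set (\<lambda>i. cmod (d i)) I * L2_set (\<lambda>i. cmod (f i)) I)\<^sup>2"
    by (intro power_mono) auto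
  also have "\<dots> = kernel_quad K F c * (\<Sum>i\<in>I. (cmod (f i))\<^sup>2)"
    using kernel_quad_eq[OF F I sub, of c]
    by (simp add: power_mult_distrib L2_set_def sum_nonneg d_def)
  also have "\<dots> \<le> kernel_quad K F c * l2_sq f"
    using kernel_quad_eq[OF F I sub, of c] l2_partial_sum_le[OF f I]
    by (intro mult_left_mono) (simp_all add: sum_nonneg)
  finally show ?thesis by (simp add: mult.commute)
qed

text \<open>Unit vectors at the indices in \<open>J\<close> are finite combinations of kernel
  vectors, so each coordinate of \<open>f\<close> is a combination of its values.\<close>

lemma l2_eval_inj:
  assumes "f \<in> l2_on J" "g \<in> l2_on J" and eq: "\<And>x. x \<in> A \<Longrightarrow> l2_eval a f x = l2_eval a g x"
  shows "f = g"
proof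
  fix j
  show "f j = g j"
  proof (cases "j \<in> J")
    case True
    then obtain F b where F: "finite F" "F \<subseteq> A" and b: "\<And>i. (\<Sum>x\<in>F. b x * a x i) = (if i = j then 1 else 0)"
      using kernel_factorD(4)[OF True] by blast
    define I where "I = insert j (\<Union>x\<in>F. {j. a x j \<noteq> 0})"
    have I: "finite I" using F kernel_factorD(1) by (auto simp: I_def)
    have sub: "{j. a x j \<noteq> 0} \<subseteq> I" if "x \<in> F" for x using that by (auto simp: I_def)
    have ev: "l2_eval a u x = (\<Sum>j\<in>I. complex_of_real (a x j) * u j)" if "x \<in> F" for u x
      using l2_eval_eq_sum[OF I, of a x u] sub[OF that] by simp
    have "(\<Sum>x\<in>F. complex_of_real (b x) * l2_eval a h x) = h j" for h
    proof -
      have "(\<Sum>x\<in>F. complex_of_real (b x) * l2_eval a h x) =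
          (\<Sum>x\<in>F. \<Sum>i\<in>I. complex_of_real (b x * a x i) * h i)"
        using ev by (simp add: sum_distrib_left mult.assoc)
      also have "\<dots> = (\<Sum>i\<in>I. \<Sum>x\<in>F. complex_of_real (b x * a x i) * h i)" by (rule sum.swap)
      also have "\<dots> = (\<Sum>i\<in>I. complex_of_real (\<Sum>x\<in>F. b x * a x i) * h i)"
        by (simp only: sum_distrib_right of_real_sum)
      also have "\<dots> = (\<Sum>i\<in>I. if i = j then h i else 0)"
        unfolding b by (intro sum.cong) auto
      also have "\<dots> = h j" using I by (simp add: I_def)
      finally show ?thesis .
    qed
    note r = this
    have "(\<Sum>x\<in>F. complex_of_real (b x) * l2_eval a f x) = (\<Sum>x\<in>F. complex_of_real (b x) * l2_eval a g x)"
      using F eq by (intro sum.cong) auto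
    then show ?thesis by (simp only: r)
  next
    case False
    then show ?thesis using l2_onD(1) assms by metis
  qed
qed

text \<open>This description of the range and of the norm refers only to the kernel, and so is invariant
  under all symmetries of the kernel.\<close>

lemma l2_eval_surj:
  assumes C: "0 \<le> C" and bound: "\<And>F c. finite F \<Longrightarrow> F \<subseteq> A \<Longrightarrow> (cmod (\<Sum>x\<in>F. c x * h x))\<^sup>2 \<le> C * kernel_quad K F c"
  shows "\<exists>f\<in>l2_on J. l2_sq f \<le> C \<and> (\<forall>x\<in>A. l2_eval a f x = h x)"
proof -
  \<comment> \<open>The coefficients vanish outside their finite set, so that several such
    combinations can be summed over one larger set.\<close>
  define P where "P = (\<lambda>j p. finite (fst p) \<and> fst p \<subseteq> A \<and> (\<forall>x. x \<notin> fst p \<longrightarrow> snd p x = 0) \<and>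
      (\<forall>i. (\<Sum>x\<in>fst p. snd p x * a x i) = (if i = j then 1 else 0)))"
  have "\<forall>j\<in>J. \<exists>p. P j p"
  proof
    fix j assume j: "j \<in> J"
    obtain F b where "finite F" "F \<subseteq> A" "\<And>i. (\<Sum>x\<in>F. b x * a x i) = (if i = j then 1 else 0)"
      using kernel_factorD(4)[OF j] by blast
    then have "P j (F, \<lambda>x. if x \<in> F then b x else 0)" by (simp add: P_def)
    then show "\<exists>p. P j p" ..
  qed
  from bchoice[OF this] obtain p where p: "\<And>j. j \<in> J \<Longrightarrow> P j (p j)" by blast
  define F where "F = (\<lambda>j. fst (p j))"
  define b where "b = (\<lambda>j. snd (p j))"
  have F: "finite (F j)" "F j \<subseteq> A" and b0: "x \<notin> F j \<Longrightarrow> b j x = 0"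
    and b: "(\<Sum>x\<in>F j. b j x * a x i) = (if i = j then 1 else 0)" if "j \<in> J" for j x i
    using p[OF that] unfolding P_def F_def b_def by blast+
  have ext: "(\<Sum>x\<in>F'. complex_of_real (b j x) * u x) = (\<Sum>x\<in>F j. complex_of_real (b j x) * u x)"
    if "j \<in> J" "finite F'" "F j \<subseteq> F'" for j F' u
    using that b0 by (intro sum.mono_neutral_right) auto
  have bc: "(\<Sum>x\<in>F j. complex_of_real (b j x) * complex_of_real (a x i)) = (if i = j then 1 else 0)"
    if "j \<in> J" for j i
    using arg_cong[OF b[OF that, of i], of complex_of_real] by (simp add: if_distrib cong: if_cong)
  \<comment> \<open>These are the coordinates that any preimage must have, by the computation in
    \<open>l2_eval_inj\<close>.\<close>
  define f where "f = (\<lambda>j. if j \<in> J then \<Sum>x\<in>F j. complex_of_real (b j x) * h x else 0)"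
  have eval: "l2_eval a f x = h x" if x: "x \<in> A" for x
  proof -
    define I where "I = {j. a x j \<noteq> 0}"
    define F' where "F' = insert x (\<Union>j\<in>I. F j)"
    \<comment> \<open>The kernel vector of \<open>x\<close> minus its own expansion in unit vectors,
      written with kernel vectors. As a vector this is 0, so \<open>kernel_quad\<close> vanishes and
      the bound forces \<open>h\<close> to respect the expansion.\<close>
    define c where "c = (\<lambda>y. (if y = x then 1 else 0) - (\<Sum>j\<in>I. complex_of_real (a x j) * complex_of_real (b j y)))"
    have I: "finite I" "I \<subseteq> J" using kernel_factorD(1,2)[OF x] by (simp_all add: I_def)
    have F': "finite F'" "F' \<subseteq> A" using I F x unfolding F'_def by blast+
    have comb: "(\<Sum>y\<in>F'. c y * u y) = u x - (\<Sum>j\<in>I. complex_of_real (a x j) * (\<Sum>y\<in>F j. complex_of_real (b j y) * u y))" for u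
    proof -
      have "(\<Sum>y\<in>F'. c y * u y) = (\<Sum>y\<in>F'. (if y = x then u y else 0) -
          (\<Sum>j\<in>I. complex_of_real (a x j) * (complex_of_real (b j y) * u y)))"
        by (intro sum.cong refl) (simp add: c_def left_diff_distrib sum_distrib_right mult.assoc)
      also have "\<dots> = (\<Sum>y\<in>F'. if y = x then u y else 0) -
          (\<Sum>y\<in>F'. \<Sum>j\<in>I. complex_of_real (a x j) * (complex_of_real (b j y) * u y))"
        by (rule sum_subtractf)
      also have "(\<Sum>y\<in>F'. if y = x then u y else 0) = u x" using F' by (simp add: F'_def)
      also have "(\<Sum>y\<in>F'. \<Sum>j\<in>I. complex_of_real (a x j) * (complex_of_real (b j y) * u y)) =
          (\<Sum>j\<in>I. \<Sum>y\<in>F'. complex_of_real (a x j) * (complex_of_real (b j y) * u y))" by (rule sum.swap)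
      also have "\<dots> = (\<Sum>j\<in>I. complex_of_real (a x j) * (\<Sum>y\<in>F j. complex_of_real (b j y) * u y))"
      proof (rule sum.cong[OF refl])
        fix j assume "j \<in> I"
        then show "(\<Sum>y\<in>F'. complex_of_real (a x j) * (complex_of_real (b j y) * u y)) =
          complex_of_real (a x j) * (\<Sum>y\<in>F j. complex_of_real (b j y) * u y)"
          unfolding sum_distrib_left[symmetric] using I F' by (subst ext) (auto simp: F'_def)
      qed
      finally show ?thesis .
    qed
    define I' where "I' = (\<Union>y\<in>F'. {j. a y j \<noteq> 0})"
    have I': "finite I'" using F' kernel_factorD(1) by (auto simp: I'_def)
    have "(\<Sum>y\<in>F'. c y * complex_of_real (a y i)) = 0" for i
    proof -
      have "(\<Sum>y\<in>F'. c y * complex_of_real (a y i)) =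
          complex_of_real (a x i) - (\<Sum>j\<in>I. complex_of_real (a x j) * (if i = j then 1 else 0))"
        unfolding comb using I bc by (intro arg_cong2[of _ _ _ _ "(-)"] refl sum.cong) auto
      also have "(\<Sum>j\<in>I. complex_of_real (a x j) * (if i = j then 1 else 0)) = complex_of_real (a x i)"
        using I(1) by (simp add: if_distrib[of "\<lambda>t. _ * t"] I_def cong: if_cong)
      finally show ?thesis by simp
    qed
    then have "kernel_quad K F' c = 0"
      using kernel_quad_eq[OF F' I', of c] by (auto simp: I'_def)
    then have "(\<Sum>y\<in>F'. c y * h y) = 0" using bound[OF F', of c] by simp
    then have "h x = (\<Sum>j\<in>I. complex_of_real (a x j) * (\<Sum>y\<in>F j. complex_of_real (b j y) * h y))"
      unfolding comb by simp
    also have "\<dots> = l2_eval a f x"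
      unfolding l2_eval_def I_def[symmetric] f_def using I by (intro sum.cong) auto
    finally show ?thesis by simp
  qed
  have norm: "(\<Sum>j<n. (cmod (f j))\<^sup>2) \<le> C" for n
  proof -
    define I where "I = {j. j < n \<and> j \<in> J}"
    define F' where "F' = (\<Union>j\<in>I. F j)"
    \<comment> \<open>Coefficients that represent the conjugate of \<open>f\<close>, cut off to
      \<open>j < n\<close>. Tested with them, the bound reads \<open>s\<^sup>2 \<le> C * s\<close>
      for the partial sum \<open>s\<close>, whence \<open>s \<le> C\<close>.\<close>
    define c where "c = (\<lambda>y. \<Sum>j\<in>I. cnj (f j) * complex_of_real (b j y))"
    define s where "s = (\<Sum>j\<in>I. (cmod (f j))\<^sup>2)"
    have I: "finite I" "I \<subseteq> J" by (auto simp: I_def)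
    have F': "finite F'" "F' \<subseteq> A" using I F unfolding F'_def by blast+
    have comb: "(\<Sum>y\<in>F'. c y * u y) = (\<Sum>j\<in>I. cnj (f j) * (\<Sum>y\<in>F j. complex_of_real (b j y) * u y))" for u
    proof -
      have "(\<Sum>y\<in>F'. c y * u y) = (\<Sum>y\<in>F'. \<Sum>j\<in>I. cnj (f j) * (complex_of_real (b j y) * u y))"
        by (simp add: c_def sum_distrib_right mult.assoc)
      also have "\<dots> = (\<Sum>j\<in>I. \<Sum>y\<in>F'. cnj (f j) * (complex_of_real (b j y) * u y))" by (rule sum.swap)
      also have "\<dots> = (\<Sum>j\<in>I. cnj (f j) * (\<Sum>y\<in>F j. complex_of_real (b j y) * u y))"
      proof (rule sum.cong[OF refl])
        fix j assume "j \<in> I"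
        then show "(\<Sum>y\<in>F'. cnj (f j) * (complex_of_real (b j y) * u y)) =
          cnj (f j) * (\<Sum>y\<in>F j. complex_of_real (b j y) * u y)"
          unfolding sum_distrib_left[symmetric] using I F' by (subst ext) (auto simp: F'_def)
      qed
      finally show ?thesis .
    qed
    define I' where "I' = I \<union> (\<Union>y\<in>F'. {j. a y j \<noteq> 0})"
    have I': "finite I'" using F' I kernel_factorD(1) by (auto simp: I'_def)
    have "(\<Sum>y\<in>F'. c y * complex_of_real (a y i)) = (if i \<in> I then cnj (f i) else 0)" for i
    proof -
      have "(\<Sum>y\<in>F'. c y * complex_of_real (a y i)) = (\<Sum>j\<in>I. cnj (f j) * (if i = j then 1 else 0))"
        unfolding comb using I bc by (intro sum.cong refl) auto
      also have "\<dots> = (if i \<in> I then cnj (f i) else 0)"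
        using I(1) by (simp add: if_distrib[of "\<lambda>t. _ * t"] cong: if_cong)
      finally show ?thesis .
    qed
    then have "kernel_quad K F' c = (\<Sum>i\<in>I'. (cmod (if i \<in> I then cnj (f i) else 0))\<^sup>2)"
      using kernel_quad_eq[OF F' I', of c] by (auto simp: I'_def)
    also have "\<dots> = s"
      unfolding s_def using I' by (intro sum.mono_neutral_cong_right) (auto simp: I'_def)
    finally have Q: "kernel_quad K F' c = s" .
    have "(\<Sum>y\<in>F'. c y * h y) = (\<Sum>j\<in>I. cnj (f j) * f j)"
      unfolding comb f_def using I by (intro sum.cong) auto
    also have "\<dots> = complex_of_real s"
      unfolding s_def of_real_sum complex_norm_square by (simp add: mult.commute)
    finally have "s\<^sup>2 \<le> C * s" using bound[OF F', of c] Q by (simp add: norm_of_real)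
    moreover have "0 \<le> s" by (simp add: s_def sum_nonneg)
    ultimately have "s \<le> C" using C by (cases "s = 0") (auto simp: power2_eq_square)
    moreover have "s = (\<Sum>j<n. (cmod (f j))\<^sup>2)"
      unfolding s_def by (intro sum.mono_neutral_left) (auto simp: I_def f_def)
    ultimately show ?thesis by simp
  qed
  have "f j = 0" if "j \<notin> J" for j using that by (simp add: f_def)
  from l2_sq_leI[OF this norm] eval show ?thesis by blast
qed

end

text \<open>A sequence is encoded by the rational lower cuts of the real and imaginary parts of its
  entries, as a set of coded pairs: an even second component records a real part, an odd one an
  imaginary part.\<close>

lemma nat_complex_lepoll_real: "(UNIV :: (nat \<Rightarrow> complex) set) \<lesssim> (UNIV :: real set)"
proof -
  define q :: "nat \<Rightarrow> rat" where "q = from_nat_into UNIV"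
  have q: "range q = UNIV" unfolding q_def by (intro range_from_nat_into) auto
  define \<kappa> :: "(nat \<Rightarrow> complex) \<Rightarrow> nat set" where
    "\<kappa> = (\<lambda>f. {prod_encode (n, 2 * k) | n k. of_rat (q k) < Re (f n)} \<union>
       {prod_encode (n, Suc (2 * k)) | n k. of_rat (q k) < Im (f n)})"
  have re: "prod_encode (n, 2 * k) \<in> \<kappa> f \<longleftrightarrow> of_rat (q k) < Re (f n)" for n k f
    unfolding \<kappa>_def by (auto simp: prod_encode_eq) presburger+
  have im: "prod_encode (n, Suc (2 * k)) \<in> \<kappa> f \<longleftrightarrow> of_rat (q k) < Im (f n)" for n k f
    unfolding \<kappa>_def by (auto simp: prod_encode_eq) presburger+
  have sep: "r = t" if "\<And>k. of_rat (q k) < r \<longleftrightarrow> of_rat (q k) < (t :: real)" for r t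
  proof (rule ccontr)
    assume "r \<noteq> t"
    then have "min r t < max r t" by (simp add: min_def max_def)
    then obtain p where "min r t < of_rat p" "of_rat p < max r t"
      using of_rat_dense by blast
    moreover obtain k where "p = q k" using q by (metis surjD)
    ultimately show False using that[of k] by (auto simp: min_def max_def split: if_splits)
  qed
  have "inj \<kappa>"
  proof (rule injI)
    fix f g assume eq: "\<kappa> f = \<kappa> g"
    have "f n = g n" for n
    proof (rule complex_eqI)
      show "Re (f n) = Re (g n)" using re[of n _ f] re[of n _ g] eq by (intro sep) simp
      show "Im (f n) = Im (g n)" using im[of n _ f] im[of n _ g] eq by (intro sep) simp
    qed
    then show "f = g" by auto
  qed
  then have "(UNIV :: (nat \<Rightarrow> complex) set) \<lesssim> (UNIV :: nat set set)" by (auto simp: lepoll_def)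
  then show ?thesis using nat_sets_eqpoll_reals by (meson eqpoll_imp_lepoll lepoll_trans)
qed

section \<open>Representations from invariant kernels\<close>

lemma l2_sq_minus:
  assumes "f \<in> l2_on J" "g \<in> l2_on J"
  shows "l2_sq (\<lambda>j. f j - g j) = l2_sq f - 2 * Re (l2_ip f g) + l2_sq g"
proof -
  have "l2_sq (\<lambda>j. f j + - 1 * g j) = l2_sq f + 2 * Re (l2_ip f (\<lambda>j. - 1 * g j)) + l2_sq (\<lambda>j. - 1 * g j)"
    using assms by (intro l2_sq_add l2_smult)
  then show ?thesis using l2_ip_smult[OF assms, of "- 1"] by (simp add: l2_sq_def)
qed

context
  fixes A :: "'a set" and K :: "'a \<Rightarrow> 'a \<Rightarrow> real" and J :: "nat set" and a :: "'a \<Rightarrow> nat \<Rightarrow> real"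
  assumes kf: "kernel_factor A K J a"
begin

lemma kernel_vector_in_l2: "x \<in> A \<Longrightarrow> (\<lambda>j. complex_of_real (a x j)) \<in> l2_on J"
  using kernel_factorD(1,2)[OF kf, of x]
  by (auto simp: l2_on_def intro!: summable_finite[of "{j. a x j \<noteq> 0}"])

lemma l2_ip_kernel_vector:
  assumes "x \<in> A"
  shows "l2_ip (\<lambda>j. complex_of_real (a x j)) f = l2_eval a f x"
  unfolding l2_ip_def l2_eval_def using kernel_factorD(1)[OF kf assms]
  by (subst suminf_finite[of "{j. a x j \<noteq> 0}"]) auto

lemma l2_eval_kernel_vector:
  assumes "x \<in> A" "y \<in> A"
  shows "l2_eval a (\<lambda>j. complex_of_real (a y j)) x = complex_of_real (K x y)"
  unfolding l2_eval_def kernel_factorD(3)[OF kf assms] by simp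

lemma l2_sq_kernel_vector: "x \<in> A \<Longrightarrow> l2_sq (\<lambda>j. complex_of_real (a x j)) = K x x"
  using l2_ip_self[OF kernel_vector_in_l2] l2_ip_kernel_vector l2_eval_kernel_vector
  by (metis of_real_eq_iff)

lemma l2_sq_kernel_vector_minus:
  assumes "x \<in> A" "y \<in> A"
  shows "l2_sq (\<lambda>j. complex_of_real (a x j) - complex_of_real (a y j)) = K x x - 2 * K x y + K y y"
  using l2_sq_minus[OF kernel_vector_in_l2 kernel_vector_in_l2, OF assms] assms
  by (simp add: l2_sq_kernel_vector l2_ip_kernel_vector l2_eval_kernel_vector)

text \<open>The coordinates of the kernel vectors are finite combinations of kernel values, so the kernel
  vectors of \<open>x k\<close> tend weakly to zero.\<close>

lemma l2_eval_tendsto_0: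
  assumes f: "f \<in> l2_on J" and x: "\<And>k. x k \<in> A" and diag: "\<And>k. K (x k) (x k) \<le> 1"
    and lim: "\<And>y. y \<in> A \<Longrightarrow> (\<lambda>k. K (x k) y) \<longlonglongrightarrow> 0"
  shows "(\<lambda>k. l2_eval a f (x k)) \<longlonglongrightarrow> 0"
proof (rule LIMSEQ_I)
  fix e :: real assume e: "e > 0"
  have coord: "(\<lambda>k. a (x k) j) \<longlonglongrightarrow> 0" for j
  proof (cases "j \<in> J")
    case True
    then obtain F b where F: "finite F" "F \<subseteq> A" and b: "\<And>i. (\<Sum>y\<in>F. b y * a y i) = (if i = j then 1 else 0)"
      using kernel_factorD(4)[OF kf True] by blast
    have "a (x k) j = (\<Sum>y\<in>F. b y * K (x k) y)" for k
    proof -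
      let ?I = "{j. a (x k) j \<noteq> 0}"
      have I: "finite ?I" by (rule kernel_factorD(1)[OF kf x])
      have "(\<Sum>y\<in>F. b y * K (x k) y) = (\<Sum>y\<in>F. \<Sum>i\<in>?I. a (x k) i * (b y * a y i))"
        using F by (intro sum.cong refl) (simp add: kernel_factorD(3)[OF kf x] subset_iff sum_distrib_left mult_ac)
      also have "\<dots> = (\<Sum>i\<in>?I. a (x k) i * (\<Sum>y\<in>F. b y * a y i))"
        unfolding sum_distrib_left by (rule sum.swap)
      also have "\<dots> = a (x k) j"
        unfolding b using I by (simp add: if_distrib[of "\<lambda>t. _ * t"] cong: if_cong)
      finally show ?thesis by simp
    qed
    moreover have "(\<lambda>k. \<Sum>y\<in>F. b y * K (x k) y) \<longlonglongrightarrow> (\<Sum>y\<in>F. b y * 0)"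
      using F by (intro tendsto_sum tendsto_mult tendsto_const lim) auto
    ultimately show ?thesis by simp
  next
    case False
    then have "a (x k) j = 0" for k using kernel_factorD(2)[OF kf x, of k] by auto
    then show ?thesis by simp
  qed
  \<comment> \<open>\<open>t N\<close> is the tail of \<open>f\<close>. Its contribution is small
    uniformly in \<open>k\<close> because the diagonal of the kernel is at most 1 along
    \<open>x\<close>; the head involves finitely many coordinates, each tending to 0.\<close>
  define t where "t = (\<lambda>N j. if j < N then 0 else f j)"
  have s: "summable (\<lambda>j. (cmod (f j))\<^sup>2)" using l2_onD(2)[OF f] .
  have t_in: "t N \<in> l2_on J" and t_sq: "l2_sq (t N) = l2_sq f - (\<Sum>j<N. (cmod (f j))\<^sup>2)" for N
  proof -
    have s2: "summable (\<lambda>j. (cmod (t N j))\<^sup>2)"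
      by (rule summable_comparison_test[OF _ s]) (auto simp: t_def)
    then show "t N \<in> l2_on J" using l2_onD(1)[OF f] by (simp add: l2_on_def t_def)
    have "(\<Sum>j. (cmod (t N j))\<^sup>2) = (\<Sum>j. (cmod (t N (j + N)))\<^sup>2) + (\<Sum>j<N. (cmod (t N j))\<^sup>2)"
      by (rule suminf_split_initial_segment[OF s2])
    moreover have "(\<Sum>j. (cmod (f j))\<^sup>2) = (\<Sum>j. (cmod (f (j + N)))\<^sup>2) + (\<Sum>j<N. (cmod (f j))\<^sup>2)"
      by (rule suminf_split_initial_segment[OF s])
    ultimately show "l2_sq (t N) = l2_sq f - (\<Sum>j<N. (cmod (f j))\<^sup>2)"
      by (simp add: l2_sq_def t_def)
  qed
  have "(\<lambda>N. \<Sum>j<N. (cmod (f j))\<^sup>2) \<longlonglongrightarrow> l2_sq f"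
    unfolding l2_sq_def using s by (rule summable_LIMSEQ)
  then have "(\<lambda>N. l2_sq (t N)) \<longlonglongrightarrow> l2_sq f - l2_sq f"
    unfolding t_sq by (intro tendsto_intros)
  then have "\<forall>\<^sub>F N in sequentially. l2_sq (t N) < (e / 2)\<^sup>2"
    using e by (intro order_tendstoD(2)) auto
  then obtain N where N: "l2_sq (t N) < (e / 2)\<^sup>2" by (auto simp: eventually_sequentially)
  have tail: "cmod (l2_eval a (t N) (x k)) < e / 2" for k
  proof -
    have "(cmod (l2_eval a (t N) (x k)))\<^sup>2 \<le> l2_sq (t N) * K (x k) (x k)"
      using l2_eval_bound[OF kf t_in, of "{x k}" "\<lambda>_. 1" N] x by (simp add: kernel_quad_def)
    also have "\<dots> \<le> l2_sq (t N) * 1" using diag l2_sq_nonneg[OF t_in] by (intro mult_left_mono)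
    also have "\<dots> < (e / 2)\<^sup>2" using N by simp
    finally show ?thesis by (rule power2_less_imp_less) (use e in simp)
  qed
  have dec: "l2_eval a f (x k) = (\<Sum>j<N. complex_of_real (a (x k) j) * f j) + l2_eval a (t N) (x k)" for k
  proof -
    let ?I = "{j. a (x k) j \<noteq> 0} \<union> {..<N}"
    have I: "finite ?I" using kernel_factorD(1)[OF kf x] by simp
    have "f = (\<lambda>j. (f j - t N j) + t N j)" by simp
    then have "l2_eval a f (x k) = l2_eval a (\<lambda>j. f j - t N j) (x k) + l2_eval a (t N) (x k)"
      using l2_eval_add by metis
    also have "l2_eval a (\<lambda>j. f j - t N j) (x k) = (\<Sum>j\<in>?I. complex_of_real (a (x k) j) * (f j - t N j))"
      by (rule l2_eval_eq_sum[OF I]) simp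
    also have "\<dots> = (\<Sum>j<N. complex_of_real (a (x k) j) * f j)"
      using I by (intro sum.mono_neutral_cong_right) (auto simp: t_def)
    finally show ?thesis .
  qed
  have "(\<lambda>k. \<Sum>j<N. complex_of_real (a (x k) j) * f j) \<longlonglongrightarrow> (\<Sum>j<N. complex_of_real 0 * f j)"
    by (intro tendsto_intros coord)
  then obtain k0 where k0: "\<And>k. k \<ge> k0 \<Longrightarrow> cmod (\<Sum>j<N. complex_of_real (a (x k) j) * f j) < e / 2"
    using e LIMSEQ_D[of "\<lambda>k. \<Sum>j<N. complex_of_real (a (x k) j) * f j" 0 "e / 2"] by auto
  show "\<exists>k0. \<forall>k\<ge>k0. norm (l2_eval a f (x k) - 0) < e"
  proof (intro exI[of _ k0] allI impI)
    fix k assume "k0 \<le> k"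
    have "norm (l2_eval a f (x k)) \<le> cmod (\<Sum>j<N. complex_of_real (a (x k) j) * f j) + cmod (l2_eval a (t N) (x k))"
      unfolding dec[of k] by (rule norm_triangle_ineq)
    then show "norm (l2_eval a f (x k) - 0) < e" using k0[OF \<open>k0 \<le> k\<close>] tail[of k] by simp
  qed
qed

end

section \<open>The unitary representation of an invariant kernel\<close>

locale kernel_action = group G for G :: "('g, 'b) monoid_scheme" (structure) +
  fixes K :: "'g \<times> nat \<Rightarrow> 'g \<times> nat \<Rightarrow> real" and J :: "nat set" and a :: "'g \<times> nat \<Rightarrow> nat \<Rightarrow> real"
    and \<iota> :: "(nat \<Rightarrow> complex) \<Rightarrow> 'v"
  assumes kf: "kernel_factor (carrier G \<times> UNIV) K J a"
    and K_inv: "g \<in> carrier G \<Longrightarrow> x \<in> carrier G \<Longrightarrow> y \<in> carrier G \<Longrightarrow> K (g \<otimes> x, n) (g \<otimes> y, m) = K (x, n) (y, m)"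
    and inj: "inj \<iota>"
begin

text \<open>Left translation of the function \<open>l2_eval a f\<close>. It is specified by values
  because the pivots come from an enumeration on which the group does not visibly act.\<close>

definition act :: "'g \<Rightarrow> (nat \<Rightarrow> complex) \<Rightarrow> nat \<Rightarrow> complex" where
  "act g f = (THE f'. f' \<in> l2_on J \<and>
     (\<forall>p\<in>carrier G \<times> UNIV. l2_eval a f' p = l2_eval a f (inv g \<otimes> fst p, snd p)))"

text \<open>For the translated function, the criterion of \<open>l2_eval_surj\<close> is
  \<open>l2_eval_bound\<close> for \<open>f\<close> at the translated points: an invariant kernel
  has the same \<open>kernel_quad\<close> there.\<close>

lemma act_exists:
  assumes g: "g \<in> carrier G" and f: "f \<in> l2_on J"
  shows "\<exists>f'\<in>l2_on J. l2_sq f' \<le> l2_sq f \<and>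
    (\<forall>p\<in>carrier G \<times> UNIV. l2_eval a f' p = l2_eval a f (inv g \<otimes> fst p, snd p))"
proof (rule l2_eval_surj[OF kf l2_sq_nonneg[OF f]])
  fix F :: "('g \<times> nat) set" and c :: "'g \<times> nat \<Rightarrow> complex"
  assume F: "finite F" "F \<subseteq> carrier G \<times> UNIV"
  let ?\<sigma> = "\<lambda>p :: 'g \<times> nat. (inv g \<otimes> fst p, snd p)"
  have inj: "inj_on ?\<sigma> F"
  proof (rule inj_onI)
    fix p q assume pq: "p \<in> F" "q \<in> F" "?\<sigma> p = ?\<sigma> q"
    have "fst p \<in> carrier G" "fst q \<in> carrier G" using pq F(2) by auto
    then have "fst p = fst q" using pq(3) g by simp
    then show "p = q" using pq(3) by (simp add: prod_eq_iff)
  qed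
  define c' where "c' = (\<lambda>q. c (the_inv_into F ?\<sigma> q))"
  have c': "p \<in> F \<Longrightarrow> c' (?\<sigma> p) = c p" for p
    unfolding c'_def using the_inv_into_f_f[OF inj] by simp
  have F': "finite (?\<sigma> ` F)" "?\<sigma> ` F \<subseteq> carrier G \<times> UNIV" using F g by auto
  have "(\<Sum>p\<in>F. c p * l2_eval a f (?\<sigma> p)) = (\<Sum>q\<in>?\<sigma> ` F. c' q * l2_eval a f q)"
    unfolding sum.reindex[OF inj] using c' by (intro sum.cong) auto
  then have "(cmod (\<Sum>p\<in>F. c p * l2_eval a f (?\<sigma> p)))\<^sup>2 \<le> l2_sq f * kernel_quad K (?\<sigma> ` F) c'"
    using l2_eval_bound[OF kf f F', of c'] by simp
  also have "kernel_quad K (?\<sigma> ` F) c' = kernel_quad K F c"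
  proof -
    have "(\<Sum>x\<in>?\<sigma> ` F. \<Sum>y\<in>?\<sigma> ` F. c' x * cnj (c' y) * complex_of_real (K x y)) =
        (\<Sum>x\<in>F. \<Sum>y\<in>F. c' (?\<sigma> x) * cnj (c' (?\<sigma> y)) * complex_of_real (K (?\<sigma> x) (?\<sigma> y)))"
      by (simp only: sum.reindex[OF inj] comp_def)
    also have "\<dots> = (\<Sum>x\<in>F. \<Sum>y\<in>F. c x * cnj (c y) * complex_of_real (K x y))"
    proof (intro sum.cong refl)
      fix x y assume xy: "x \<in> F" "y \<in> F"
      then have "fst x \<in> carrier G" "fst y \<in> carrier G" using F by auto
      then have "K (?\<sigma> x) (?\<sigma> y) = K x y" using K_inv[of "inv g" "fst x" "fst y" "snd x" "snd y"] g by simp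
      then show "c' (?\<sigma> x) * cnj (c' (?\<sigma> y)) * complex_of_real (K (?\<sigma> x) (?\<sigma> y)) =
          c x * cnj (c y) * complex_of_real (K x y)" using c' xy by simp
    qed
    finally show ?thesis by (simp add: kernel_quad_def)
  qed
  finally show "(cmod (\<Sum>p\<in>F. c p * l2_eval a f (?\<sigma> p)))\<^sup>2 \<le> l2_sq f * kernel_quad K F c" .
qed

lemma act_eqI:
  assumes "f' \<in> l2_on J"
    and "\<And>x n. x \<in> carrier G \<Longrightarrow> l2_eval a f' (x, n) = l2_eval a f (inv g \<otimes> x, n)"
  shows "act g f = f'"
  unfolding act_def
proof (rule the_equality)
  show "f' \<in> l2_on J \<and> (\<forall>p\<in>carrier G \<times> UNIV. l2_eval a f' p = l2_eval a f (inv g \<otimes> fst p, snd p))"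
    using assms by auto
  fix f'' assume "f'' \<in> l2_on J \<and> (\<forall>p\<in>carrier G \<times> UNIV. l2_eval a f'' p = l2_eval a f (inv g \<otimes> fst p, snd p))"
  then show "f'' = f'" using assms by (intro l2_eval_inj[OF kf]) auto
qed

lemma act:
  assumes "g \<in> carrier G" "f \<in> l2_on J"
  shows act_closed: "act g f \<in> l2_on J"
    and eval_act: "x \<in> carrier G \<Longrightarrow> l2_eval a (act g f) (x, n) = l2_eval a f (inv g \<otimes> x, n)"
    and sq_act_le: "l2_sq (act g f) \<le> l2_sq f"
proof -
  obtain f' where f': "f' \<in> l2_on J" "l2_sq f' \<le> l2_sq f"
    and ev: "\<And>x n. x \<in> carrier G \<Longrightarrow> l2_eval a f' (x, n) = l2_eval a f (inv g \<otimes> x, n)"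
    using act_exists[OF assms] by auto
  have "act g f = f'" using f' ev by (intro act_eqI)
  then show "act g f \<in> l2_on J" "x \<in> carrier G \<Longrightarrow> l2_eval a (act g f) (x, n) = l2_eval a f (inv g \<otimes> x, n)"
    "l2_sq (act g f) \<le> l2_sq f" using f' ev by simp_all
qed

lemma act_mult:
  assumes "g \<in> carrier G" "h \<in> carrier G" "f \<in> l2_on J"
  shows "act (g \<otimes> h) f = act g (act h f)"
  using assms by (intro act_eqI act_closed) (simp_all add: eval_act act_closed inv_mult_group m_assoc)

lemma act_one: "f \<in> l2_on J \<Longrightarrow> act \<one> f = f"
  by (intro act_eqI) simp_all

lemma act_inv:
  assumes "g \<in> carrier G" "f \<in> l2_on J"
  shows "act (inv g) (act g f) = f" "act g (act (inv g) f) = f"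
  using assms act_mult[of "inv g" g f] act_mult[of g "inv g" f] by (simp_all add: act_one)

lemma act_add:
  assumes "g \<in> carrier G" "f \<in> l2_on J" "h \<in> l2_on J"
  shows "act g (\<lambda>j. f j + h j) = (\<lambda>j. act g f j + act g h j)"
  using assms by (intro act_eqI l2_add act_closed) (simp_all add: l2_eval_add eval_act)

lemma act_smult:
  assumes "g \<in> carrier G" "f \<in> l2_on J"
  shows "act g (\<lambda>j. c * f j) = (\<lambda>j. c * act g f j)"
  using assms by (intro act_eqI l2_smult act_closed) (simp_all add: l2_eval_smult eval_act)

text \<open>\<open>act_exists\<close> only yields a contraction; applied to the inverse element it
  yields an isometry.\<close>

lemma sq_act:
  assumes "g \<in> carrier G" "f \<in> l2_on J"
  shows "l2_sq (act g f) = l2_sq f"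
proof (rule antisym)
  show "l2_sq (act g f) \<le> l2_sq f" by (rule sq_act_le[OF assms])
  show "l2_sq f \<le> l2_sq (act g f)"
    using sq_act_le[OF inv_closed[OF assms(1)] act_closed[OF assms]] by (simp add: act_inv assms)
qed

lemma ip_act:
  assumes "g \<in> carrier G" "f \<in> l2_on J" "h \<in> l2_on J"
  shows "l2_ip (act g f) (act g h) = l2_ip f h"
proof (rule l2_ip_eq_of_sq_eq)
  show "l2_sq (\<lambda>j. act g f j + act g h j) = l2_sq (\<lambda>j. f j + h j)"
    using sq_act[OF assms(1) l2_add[OF assms(2,3)]] act_add[OF assms] by simp
  have "act g (\<lambda>j. f j + \<i> * h j) = (\<lambda>j. act g f j + \<i> * act g h j)"
    using act_add[OF assms(1,2) l2_smult[OF assms(3)]] act_smult[OF assms(1,3)] by simp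
  then show "l2_sq (\<lambda>j. act g f j + \<i> * act g h j) = l2_sq (\<lambda>j. f j + \<i> * h j)"
    using sq_act[OF assms(1) l2_add[OF assms(2) l2_smult[OF assms(3)]], of \<i>] by simp
qed (use assms in \<open>simp_all add: act_closed sq_act\<close>)

lemma act_kernel_vector:
  assumes "g \<in> carrier G" "x \<in> carrier G"
  shows "act g (\<lambda>j. complex_of_real (a (x, n) j)) = (\<lambda>j. complex_of_real (a (g \<otimes> x, n) j))"
proof (rule act_eqI)
  show "(\<lambda>j. complex_of_real (a (g \<otimes> x, n) j)) \<in> l2_on J"
    using assms by (intro kernel_vector_in_l2[OF kf]) auto
  fix y m assume y: "y \<in> carrier G"
  have "K (y, m) (g \<otimes> x, n) = K (inv g \<otimes> y, m) (x, n)"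
    using K_inv[of g "inv g \<otimes> y" x m n] assms y m_assoc[of g "inv g" y] by simp
  then show "l2_eval a (\<lambda>j. complex_of_real (a (g \<otimes> x, n) j)) (y, m) =
      l2_eval a (\<lambda>j. complex_of_real (a (x, n) j)) (inv g \<otimes> y, m)"
    using assms y by (simp add: l2_eval_kernel_vector[OF kf])
qed

abbreviation "V \<equiv> l2_module J \<iota>"

text \<open>Restricted to the carrier because the elements of \<open>BijGroup\<close> are
  extensional functions.\<close>

definition kernel_rep :: "'g \<Rightarrow> 'v \<Rightarrow> 'v" where
  "kernel_rep g = (\<lambda>v\<in>carrier V. \<iota> (act g (inv_into UNIV \<iota> v)))"

lemma kernel_rep_apply: "f \<in> l2_on J \<Longrightarrow> kernel_rep g (\<iota> f) = \<iota> (act g f)"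
  using inj by (simp add: kernel_rep_def l2_module_simps[OF inj])

lemma carrier_V: "carrier V = \<iota> ` l2_on J"
  by (rule l2_module_simps(1)[OF inj])

lemma bij_kernel_rep:
  assumes g: "g \<in> carrier G"
  shows "bij_betw (kernel_rep g) (carrier V) (carrier V)"
  using g unfolding carrier_V
  by (intro bij_betw_byWitness[of _ "kernel_rep (inv g)"])
     (auto simp: kernel_rep_apply act_closed act_inv)

lemma unitary_kernel_rep: "unitary_representation G V kernel_rep"
  unfolding unitary_representation_def
proof (intro conjI ballI)
  show "complex_hilbert_space V" by (rule complex_hilbert_space_l2_module[OF inj])
  have Bij: "kernel_rep g \<in> Bij (carrier V)" if "g \<in> carrier G" for g
    using bij_kernel_rep[OF that] by (simp add: Bij_def kernel_rep_def)
  have "kernel_rep (g \<otimes> h) = compose (carrier V) (kernel_rep g) (kernel_rep h)"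
    if "g \<in> carrier G" "h \<in> carrier G" for g h
  proof
    fix v
    show "kernel_rep (g \<otimes> h) v = compose (carrier V) (kernel_rep g) (kernel_rep h) v"
    proof (cases "v \<in> carrier V")
      case True
      then obtain f where f: "f \<in> l2_on J" "v = \<iota> f" by (auto simp: carrier_V)
      then show ?thesis using that True by (simp add: compose_def kernel_rep_apply act_mult act_closed)
    next
      case False
      then show ?thesis by (simp add: compose_def kernel_rep_def)
    qed
  qed
  then have "kernel_rep \<in> hom G (BijGroup (carrier V))"
    using Bij by (auto simp: hom_def BijGroup_def)
  then show "group_action G (carrier V) kernel_rep"
    by (intro group_action.intro group_hom.intro group_hom_axioms.intro group_BijGroup group_axioms)
next
  fix g assume g: "g \<in> carrier G"
  show "unitary_operator V (kernel_rep g)"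
    unfolding unitary_operator_def
    using bij_kernel_rep[OF g] g
    by (auto simp: carrier_V l2_module_simps[OF inj] kernel_rep_apply l2_add l2_smult act_add act_smult ip_act act_closed)
qed

text \<open>The test vectors are the kernel vectors at \<open>(\<one>, n)\<close>: \<open>s\<close>
  moves such a unit vector by the squared distance \<open>2 - 2 * K (s, n) (\<one>, n)\<close>,
  hence the bound \<open>1 - \<epsilon>\<^sup>2 / 2\<close>.\<close>

lemma almost_invariant_kernel_rep:
  assumes diag: "\<And>n. K (\<one>, n) (\<one>, n) = 1"
    and lim: "\<And>x. x \<in> carrier G \<Longrightarrow> (\<lambda>n. K (x, n) (\<one>, n)) \<longlonglongrightarrow> 1"
  shows "almost_invariant_vectors G V kernel_rep"
  unfolding almost_invariant_vectors_def
proof (intro allI impI)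
  fix \<epsilon> :: real and L assume \<epsilon>: "\<epsilon> > 0" and L: "finite L \<and> L \<subseteq> carrier G"
  have "\<forall>\<^sub>F n in sequentially. \<forall>x\<in>L. 1 - \<epsilon>\<^sup>2 / 2 < K (x, n) (\<one>, n)"
    using L \<epsilon> by (intro eventually_ball_finite ballI order_tendstoD(1)[OF lim]) auto
  then obtain n where n: "\<And>x. x \<in> L \<Longrightarrow> 1 - \<epsilon>\<^sup>2 / 2 < K (x, n) (\<one>, n)"
    by (auto simp: eventually_sequentially)
  define e where "e = (\<lambda>x j. complex_of_real (a (x, n) j))"
  have e_in: "e x \<in> l2_on J" if "x \<in> carrier G" for x
    unfolding e_def using that by (intro kernel_vector_in_l2[OF kf]) auto
  have K1: "K (x, n) (x, n) = 1" if "x \<in> carrier G" for x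
    using K_inv[of x \<one> \<one> n n] that diag by simp
  have "hnorm V (kernel_rep s (\<iota> (e \<one>)) \<ominus>\<^bsub>V\<^esub> \<iota> (e \<one>)) < \<epsilon>" if s: "s \<in> L" for s
  proof -
    have sG: "s \<in> carrier G" using L s by auto
    have "kernel_rep s (\<iota> (e \<one>)) = \<iota> (e s)"
      using e_in[of \<one>] act_kernel_vector[OF sG one_closed, of n] sG by (simp add: kernel_rep_apply e_def)
    then have "hnorm V (kernel_rep s (\<iota> (e \<one>)) \<ominus>\<^bsub>V\<^esub> \<iota> (e \<one>)) = sqrt (l2_sq (\<lambda>j. e s j - e \<one> j))"
      using e_in[OF sG] e_in[OF one_closed] by (simp add: l2_module_minus[OF inj] hnorm_l2_module[OF inj] l2_minus)
    also have "l2_sq (\<lambda>j. e s j - e \<one> j) = 2 - 2 * K (s, n) (\<one>, n)"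
      unfolding e_def using sG by (subst l2_sq_kernel_vector_minus[OF kf]) (auto simp: K1)
    also have "sqrt (2 - 2 * K (s, n) (\<one>, n)) < \<epsilon>"
      using n[OF s] \<epsilon> by (intro real_less_lsqrt) auto
    finally show ?thesis .
  qed
  moreover have "\<iota> (e \<one>) \<in> carrier V" using e_in[OF one_closed] by (simp add: carrier_V)
  moreover have "hnorm V (\<iota> (e \<one>)) = 1"
    using e_in[OF one_closed] l2_sq_kernel_vector[OF kf, of "(\<one>, n)"] by (simp add: hnorm_l2_module[OF inj] diag e_def)
  ultimately show "\<exists>\<phi>\<in>carrier V. hnorm V \<phi> = 1 \<and> (\<forall>s\<in>L. hnorm V (kernel_rep s \<phi> \<ominus>\<^bsub>V\<^esub> \<phi>) < \<epsilon>)"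
    by blast
qed

text \<open>For an invariant \<open>f\<close> the value at \<open>(x, n)\<close> equals all values
  at \<open>(inv (h k) \<otimes> x, n)\<close>, and these tend to 0 by
  \<open>l2_eval_tendsto_0\<close>. A vector with all values 0 is 0.\<close>

lemma no_invariant_kernel_rep:
  assumes diag: "\<And>n. K (\<one>, n) (\<one>, n) = 1" and H: "H \<subseteq> carrier G" and h: "\<And>k. h k \<in> H"
    and lim: "\<And>x y n m. x \<in> carrier G \<Longrightarrow> y \<in> carrier G \<Longrightarrow> (\<lambda>k. K (x, n) (h k \<otimes> y, m)) \<longlonglongrightarrow> 0"
  shows "\<not> nonzero_invariant_vector H V kernel_rep"
proof
  assume "nonzero_invariant_vector H V kernel_rep"
  then obtain f where f: "f \<in> l2_on J" "\<iota> f \<noteq> \<zero>\<^bsub>V\<^esub>" and inv: "\<And>h. h \<in> H \<Longrightarrow> kernel_rep h (\<iota> f) = \<iota> f"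
    by (auto simp: nonzero_invariant_vector_def carrier_V)
  have hG: "h k \<in> carrier G" for k using h H by blast
  have "act (h k) f = f" for k
    using inv[OF h[of k]] f(1) injD[OF inj] by (simp add: kernel_rep_apply)
  then have ev: "l2_eval a f (inv (h k) \<otimes> x, n) = l2_eval a f (x, n)" if "x \<in> carrier G" for k x n
    using eval_act[OF hG f(1) that, of k n] by simp
  have "l2_eval a f (x, n) = 0" if x: "x \<in> carrier G" for x n
  proof -
    have "(\<lambda>k. l2_eval a f (inv (h k) \<otimes> x, n)) \<longlonglongrightarrow> 0"
    proof (rule l2_eval_tendsto_0[OF kf f(1)])
      show "(inv (h k) \<otimes> x, n) \<in> carrier G \<times> UNIV" for k using hG x by simp
      have "K (y, n) (y, n) = 1" if "y \<in> carrier G" for y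
        using K_inv[of y \<one> \<one> n n] that diag by simp
      then show "K (inv (h k) \<otimes> x, n) (inv (h k) \<otimes> x, n) \<le> 1" for k using hG x by simp
      fix p assume "p \<in> carrier G \<times> (UNIV :: nat set)"
      then obtain y m where p: "p = (y, m)" "y \<in> carrier G" by auto
      have "K (inv (h k) \<otimes> x, n) (y, m) = K (x, n) (h k \<otimes> y, m)" for k
        using K_inv[of "h k" "inv (h k) \<otimes> x" y n m] hG x p(2) m_assoc[of "h k" "inv (h k)" x] by simp
      then show "(\<lambda>k. K (inv (h k) \<otimes> x, n) p) \<longlonglongrightarrow> 0" using lim[OF x p(2)] p(1) by simp
    qed
    then show ?thesis using x by (simp add: ev LIMSEQ_const_iff)
  qed
  then have "f = (\<lambda>_. 0)"
    using f(1) by (intro l2_eval_inj[OF kf f(1) l2_zero]) (auto simp: l2_eval_def)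
  then show False using f(2) by (simp add: l2_module_simps[OF inj])
qed

end

text \<open>The size of \<open>'v\<close> enters here, through an injection of complex sequences
  into \<open>'v\<close> along which the sequence space is transported.\<close>

lemma kernel_not_relative_property_T:
  fixes G :: "('g, 'b) monoid_scheme" (structure) and K :: "'g \<times> nat \<Rightarrow> 'g \<times> nat \<Rightarrow> real"
  assumes G: "group G" "countable (carrier G)"
    and psd: "psd_on (carrier G \<times> UNIV) K"
    and inv: "\<And>g x y n m. g \<in> carrier G \<Longrightarrow> x \<in> carrier G \<Longrightarrow> y \<in> carrier G \<Longrightarrow>
      K (g \<otimes> x, n) (g \<otimes> y, m) = K (x, n) (y, m)"
    and diag: "\<And>n. K (\<one>, n) (\<one>, n) = 1"
    and near: "\<And>x. x \<in> carrier G \<Longrightarrow> (\<lambda>n. K (x, n) (\<one>, n)) \<longlonglongrightarrow> 1"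
    and H: "H \<subseteq> carrier G" and h: "\<And>k. h k \<in> H"
    and far: "\<And>x y n m. x \<in> carrier G \<Longrightarrow> y \<in> carrier G \<Longrightarrow> (\<lambda>k. K (x, n) (h k \<otimes> y, m)) \<longlonglongrightarrow> 0"
    and univ: "(UNIV :: real set) \<lesssim> (UNIV :: 'v set)"
  shows "\<not> relative_property_T TYPE('v) G H"
proof -
  have "(UNIV :: (nat \<Rightarrow> complex) set) \<lesssim> (UNIV :: 'v set)"
    using nat_complex_lepoll_real univ by (rule lepoll_trans)
  then obtain \<iota> :: "(nat \<Rightarrow> complex) \<Rightarrow> 'v" where \<iota>: "inj \<iota>" by (auto simp: lepoll_def)
  have "countable (carrier G \<times> (UNIV :: nat set))" using G(2) by (intro countable_SIGMA) auto
  moreover have "infinite (carrier G \<times> (UNIV :: nat set))"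
    using monoid.one_closed[OF group.is_monoid[OF G(1)]] by (auto simp: finite_cartesian_product_iff)
  ultimately obtain J a where kf: "kernel_factor (carrier G \<times> UNIV) K J a"
    using kernel_factor_exists psd by blast
  interpret kernel_action G K J a \<iota>
    by (intro kernel_action.intro kernel_action_axioms.intro G kf inv \<iota>)
  have "almost_invariant_vectors G V kernel_rep" by (rule almost_invariant_kernel_rep[OF diag near])
  moreover have "\<not> nonzero_invariant_vector H V kernel_rep"
    by (rule no_invariant_kernel_rep[OF diag H h far])
  ultimately show ?thesis using unitary_kernel_rep unfolding relative_property_T_def by blast
qed

section \<open>The threshold\<close>

lemma psd_on_const_1: "psd_on A (\<lambda>_ _. 1)"
  unfolding psd_on_def by (auto simp: sum_product[symmetric])

lemma psd_on_limit:
  assumes psd: "\<And>m. psd_on A (K m)"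
    and lim: "\<And>x y. x \<in> A \<Longrightarrow> y \<in> A \<Longrightarrow> (\<lambda>m. K m x y) \<longlonglongrightarrow> L x y"
  shows "psd_on A L"
  unfolding psd_on_def
proof (intro conjI allI impI ballI)
  fix x y assume xy: "x \<in> A" "y \<in> A"
  have "(\<lambda>m. K m x y) \<longlonglongrightarrow> L y x" using lim[OF xy(2,1)] psd_onD(1)[OF psd xy] by simp
  then show "L x y = L y x" using lim[OF xy] LIMSEQ_unique by blast
next
  fix F and c :: "'a \<Rightarrow> real"
  assume F: "finite F \<and> F \<subseteq> A"
  have "(\<lambda>m. \<Sum>x\<in>F. \<Sum>y\<in>F. c x * c y * K m x y) \<longlonglongrightarrow> (\<Sum>x\<in>F. \<Sum>y\<in>F. c x * c y * L x y)"
    using F by (intro tendsto_sum tendsto_mult tendsto_const lim) auto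
  then show "0 \<le> (\<Sum>x\<in>F. \<Sum>y\<in>F. c x * c y * L x y)"
    using psd_onD(2)[OF psd, of F] F by (intro LIMSEQ_le_const) auto
qed

text \<open>Kernel of an orthogonal direct sum: the form splits into the forms of the summands,
  indexed by the second component.\<close>

lemma psd_on_direct_sum:
  fixes A :: "'a set" and K :: "'b \<Rightarrow> 'a \<Rightarrow> 'a \<Rightarrow> real"
  assumes psd: "\<And>n. psd_on A (K n)"
  shows "psd_on (A \<times> UNIV) (\<lambda>p q. if snd p = snd q then K (snd p) (fst p) (fst q) else 0)"
  unfolding psd_on_def
proof (intro conjI allI impI ballI)
  fix F :: "('a \<times> 'b) set" and c :: "'a \<times> 'b \<Rightarrow> real"
  assume F: "finite F \<and> F \<subseteq> A \<times> UNIV"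
  let ?L = "\<lambda>p q. if snd p = snd q then K (snd p) (fst p) (fst q) else 0"
  have inner: "(\<Sum>q\<in>F. c p * c q * ?L p q) = (\<Sum>q\<in>{q\<in>F. snd q = snd p}. c p * c q * K (snd p) (fst p) (fst q))" for p
    using F by (intro sum.mono_neutral_cong_right) auto
  have "(\<Sum>p\<in>F. \<Sum>q\<in>F. c p * c q * ?L p q) =
      (\<Sum>p\<in>F. \<Sum>q\<in>{q\<in>F. snd q = snd p}. c p * c q * K (snd p) (fst p) (fst q))"
    unfolding inner ..
  also have "\<dots> = (\<Sum>n\<in>snd`F. \<Sum>p\<in>{p\<in>F. snd p = n}. \<Sum>q\<in>{q\<in>F. snd q = snd p}. c p * c q * K (snd p) (fst p) (fst q))"
    using F by (intro sum.image_gen) simp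
  also have "\<dots> = (\<Sum>n\<in>snd`F. \<Sum>p\<in>{p\<in>F. snd p = n}. \<Sum>q\<in>{q\<in>F. snd q = n}. c p * c q * K n (fst p) (fst q))"
    by (intro sum.cong refl) auto
  also have "\<dots> \<ge> 0"
  proof (rule sum_nonneg)
    fix n
    have "psd_on {p \<in> F. snd p = n} (\<lambda>p q. K n (fst p) (fst q))"
      using F by (intro psd_on_reindex[OF psd]) (auto simp: inj_on_def prod_eq_iff)
    then show "0 \<le> (\<Sum>p\<in>{p\<in>F. snd p = n}. \<Sum>q\<in>{q\<in>F. snd q = n}. c p * c q * K n (fst p) (fst q))"
      using F by (intro psd_onD(2)) auto
  qed
  finally show "0 \<le> (\<Sum>p\<in>F. \<Sum>q\<in>F. c p * c q * ?L p q)" .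
next
  fix p q assume "p \<in> A \<times> (UNIV :: 'b set)" "q \<in> A \<times> (UNIV :: 'b set)"
  then have "fst p \<in> A" "fst q \<in> A" by auto
  then show "(if snd p = snd q then K (snd p) (fst p) (fst q) else 0) =
      (if snd q = snd p then K (snd q) (fst q) (fst p) else 0)"
    using psd_onD(1)[OF psd, of "fst p" "fst q" "snd p"] by (cases "snd p = snd q") simp_all
qed

context cayley_graph
begin

text \<open>The kernel \<open>\<Phi> n = \<Prod>k\<ge>n. \<tau> k\<close> is close to \<open>1\<close> on each fixed element for large \<open>n\<close>, and yet
  every \<open>\<Phi> n\<close> tends to \<open>0\<close> along the sequence \<open>h\<close>.\<close>

lemma threshold_failure_imp_not_relative_property_T:
  assumes P: "\<And>k. invariant_bond_percolation G S (P k)"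
    and deg: "\<And>k. real (edge_degree edges \<one>) -
      prob_space.expectation (P k) (\<lambda>\<omega>. real (edge_degree \<omega> \<one>)) \<le> (1/2) ^ k"
    and H: "H \<subseteq> carrier G" and h: "\<And>k. h k \<in> H"
    and small: "\<And>k. two_point_function (P k) \<one> (h k) \<le> (1/2) ^ k"
    and univ: "(UNIV :: real set) \<lesssim> (UNIV :: 'v set)"
  shows "\<not> relative_property_T TYPE('v) G H"
proof -
  have bp: "bond_percolation G S (P k)" for k
    by (intro bond_percolation.intro bond_percolation_axioms.intro P cayley_graph_axioms)
  define \<tau> where "\<tau> = (\<lambda>k. two_point_function (P k))"
  have \<tau>_def': "two_point_function (P k) = \<tau> k" for k by (simp add: \<tau>_def)
  have t0: "0 \<le> \<tau> k x y" and t1: "\<tau> k x y \<le> 1" and tr: "\<tau> k x x = 1" for k x y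
    using bond_percolation.tau_nonneg[OF bp] bond_percolation.tau_le_1[OF bp] bond_percolation.tau_refl[OF bp]
    by (simp_all add: \<tau>_def)
  have tsym: "\<tau> k x y = \<tau> k y x" for k x y
    using bond_percolation.tau_sym[OF bp] by (simp add: \<tau>_def)
  have ttri: "1 - \<tau> k x z \<le> (1 - \<tau> k x y) + (1 - \<tau> k y z)" for k x y z
    using bond_percolation.tau_triangle[OF bp] by (simp only: \<tau>_def)
  have tinv: "\<tau> k (g \<otimes> x) (g \<otimes> y) = \<tau> k x y" if "g \<in> carrier G" "x \<in> carrier G" "y \<in> carrier G" for k g x y
    using bond_percolation.tau_invariant[OF bp that] by (simp add: \<tau>_def)
  have tpsd: "psd_on A (\<lambda>x y. \<tau> k x y * L x y)" if "psd_on A L" for k A L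
    using bond_percolation.psd_on_tau_mult[OF bp that] by (simp add: \<tau>_def)
  have hG: "h k \<in> carrier G" for k using h H by blast

  have gen: "1 - \<tau> k \<one> s \<le> (1/2) ^ k" if "s \<in> S" for k s
    using bond_percolation.one_minus_tau_generator[OF bp that, of k] deg[of k] by (simp add: \<tau>_def)
  \<comment> \<open>The constant grows with the length of a word for \<open>x\<close> but does not
    depend on \<open>k\<close>, so decay at the generators becomes decay at every element.\<close>
  have "\<exists>C\<ge>0. \<forall>k. 1 - \<tau> k \<one> x \<le> C * (1/2) ^ k" if "x \<in> generate G S" for x
    using that
  proof (induction rule: generate.induct)
    case one
    then show ?case by (intro exI[of _ 0]) (simp add: tr)
  next
    case (incl s)
    then show ?case using gen by (intro exI[of _ 1]) simp
  next
    case (inv s)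
    then show ?case using gen S_inv by (intro exI[of _ 1]) simp
  next
    case (eng x y)
    then obtain C D where C: "C \<ge> 0" "D \<ge> 0" and b: "\<And>k. 1 - \<tau> k \<one> x \<le> C * (1/2) ^ k" "\<And>k. 1 - \<tau> k \<one> y \<le> D * (1/2) ^ k"
      by auto
    have "x \<in> carrier G" "y \<in> carrier G" using eng.hyps S_gen by auto
    then have "1 - \<tau> k \<one> (x \<otimes> y) \<le> (C + D) * (1/2) ^ k" for k
      using bond_percolation.one_minus_tau_mult[OF bp[of k], of x y] b[of k] by (simp add: \<tau>_def' distrib_right)
    then show ?case using C by (intro exI[of _ "C + D"]) simp
  qed
  then have "\<forall>x\<in>carrier G. \<exists>C. C \<ge> 0 \<and> (\<forall>k. 1 - \<tau> k \<one> x \<le> C * (1/2) ^ k)" using S_gen by simp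
  from bchoice[OF this] obtain C where C0: "\<And>x. x \<in> carrier G \<Longrightarrow> C x \<ge> 0"
    and C: "\<And>x k. x \<in> carrier G \<Longrightarrow> 1 - \<tau> k \<one> x \<le> C x * (1/2) ^ k" by blast

  \<comment> \<open>Partial products for \<open>\<Phi> n\<close>. They decrease in \<open>M\<close>
    and stay nonnegative, so they converge pointwise, and positive semidefiniteness passes to the
    limit.\<close>
  define \<Psi> where "\<Psi> = (\<lambda>n M x y. \<Prod>k<M. \<tau> (n + k) x y)"
  have \<Psi>0: "0 \<le> \<Psi> n M x y" for n M x y by (simp add: \<Psi>_def prod_nonneg t0)
  have dec: "\<Psi> n (Suc M) x y \<le> \<Psi> n M x y" for n M x y
    using mult_left_mono[OF t1[of "n + M" x y] \<Psi>0[of n M x y]] by (simp add: \<Psi>_def)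
  have dec_le: "\<Psi> n M' x y \<le> \<Psi> n M x y" if "M \<le> M'" for n M M' x y
    using decseqD[OF decseq_SucI[of "\<lambda>M. \<Psi> n M x y", OF dec] that] .
  have "\<exists>L. (\<lambda>M. \<Psi> n M x y) \<longlonglongrightarrow> L" for n x y
    using decseq_convergent[OF decseq_SucI[of "\<lambda>M. \<Psi> n M x y", OF dec], of 0] \<Psi>0 by metis
  then obtain \<Phi> where \<Phi>: "\<And>n x y. (\<lambda>M. \<Psi> n M x y) \<longlonglongrightarrow> \<Phi> n x y" by metis
  have psd\<Psi>: "psd_on A (\<Psi> n M)" for A n M
  proof (induction M)
    case 0
    then show ?case using psd_on_const_1 by (simp add: \<Psi>_def)
  next
    case (Suc M)
    then show ?case using tpsd[OF Suc, of "n + M"] by (simp add: \<Psi>_def mult.commute)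
  qed
  have psd\<Phi>: "psd_on A (\<Phi> n)" for A n
    using psd\<Psi> \<Phi> by (rule psd_on_limit)
  have \<Phi>_inv: "\<Phi> n (g \<otimes> x) (g \<otimes> y) = \<Phi> n x y" if "g \<in> carrier G" "x \<in> carrier G" "y \<in> carrier G" for n g x y
    using \<Phi>[of n "g \<otimes> x" "g \<otimes> y"] \<Phi>[of n x y] LIMSEQ_unique by (simp add: \<Psi>_def tinv[OF that])
  have \<Phi>_refl: "\<Phi> n x x = 1" for n x
    using \<Phi>[of n x x] by (simp add: \<Psi>_def tr LIMSEQ_const_iff)
  \<comment> \<open>All factors are at most 1, so the product is dominated by each single one; this
    is the source of the decay along \<open>h\<close>.\<close>
  have \<Phi>_le: "\<Phi> n x y \<le> \<tau> (n + k) x y" for n k x y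
  proof -
    have "\<Phi> n x y \<le> \<Psi> n (Suc k) x y"
      using dec_le[of "Suc k"] by (intro LIMSEQ_le_const2[OF \<Phi>]) blast
    also have "\<dots> = \<Psi> n k x y * \<tau> (n + k) x y" by (simp add: \<Psi>_def)
    also have "\<dots> \<le> 1 * \<tau> (n + k) x y"
      using dec_le[of 0 k n x y] t0 by (intro mult_right_mono) (simp_all add: \<Psi>_def)
    finally show ?thesis by simp
  qed
  \<comment> \<open>Weierstrass inequality: a product of numbers in the unit interval is at least 1
    minus the sum of their defects. The 2 bounds the geometric series.\<close>
  have \<Phi>_ge: "1 - C x * 2 * (1/2) ^ n \<le> \<Phi> n \<one> x" if x: "x \<in> carrier G" for n x
  proof (rule LIMSEQ_le_const[OF \<Phi>], intro exI allI impI)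
    fix M :: nat
    have "(\<Sum>k<M. 1 - \<tau> (n + k) \<one> x) \<le> (\<Sum>k<M. C x * (1/2) ^ n * (1/2) ^ k)"
      using C[OF x] by (intro sum_mono) (simp add: power_add[symmetric] mult.assoc)
    also have "\<dots> = C x * (1/2) ^ n * (\<Sum>k<M. (1/2) ^ k)" by (simp add: sum_distrib_left)
    also have "\<dots> \<le> C x * (1/2) ^ n * 2"
      using C0[OF x] by (intro mult_left_mono) (simp_all add: sum_gp_strict)
    finally have "1 - C x * 2 * (1/2) ^ n \<le> 1 - (\<Sum>k<M. 1 - \<tau> (n + k) \<one> x)" by (simp add: mult_ac)
    also have "\<dots> \<le> (\<Prod>k<M. 1 - (1 - \<tau> (n + k) \<one> x))"
      by (intro Weierstrass_prod_ineq) (auto simp: t0 t1)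
    finally show "1 - C x * 2 * (1/2) ^ n \<le> \<Psi> n M \<one> x" by (simp add: \<Psi>_def)
  qed
  define K where "K = (\<lambda>p q :: 'g \<times> nat. if snd p = snd q then \<Phi> (snd p) (fst p) (fst q) else 0)"
  have "psd_on (carrier G \<times> UNIV) K"
    unfolding K_def by (rule psd_on_direct_sum[OF psd\<Phi>])
  moreover have "K (g \<otimes> x, n) (g \<otimes> y, m) = K (x, n) (y, m)"
    if "g \<in> carrier G" "x \<in> carrier G" "y \<in> carrier G" for g x y n m
    using \<Phi>_inv[OF that] by (simp add: K_def)
  moreover have "K (\<one>, n) (\<one>, n) = 1" for n by (simp add: K_def \<Phi>_refl)
  moreover have "(\<lambda>n. K (x, n) (\<one>, n)) \<longlonglongrightarrow> 1" if x: "x \<in> carrier G" for x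
  proof (rule tendsto_sandwich[of "\<lambda>n. 1 - C x * 2 * (1/2) ^ n" _ _ "\<lambda>_. 1"])
    have eq: "K (x, n) (\<one>, n) = \<Phi> n \<one> x" for n
      using psd_onD(1)[OF psd\<Phi>[of UNIV]] by (simp add: K_def)
    show "\<forall>\<^sub>F n in sequentially. 1 - C x * 2 * (1/2) ^ n \<le> K (x, n) (\<one>, n)"
      using \<Phi>_ge[OF x] by (simp add: eq)
    show "\<forall>\<^sub>F n in sequentially. K (x, n) (\<one>, n) \<le> 1"
      unfolding eq using order_trans[OF \<Phi>_le t1] by (intro always_eventually allI) blast
    have "(\<lambda>n. 1 - C x * 2 * (1/2) ^ n) \<longlonglongrightarrow> 1 - C x * 2 * 0"
      by (intro tendsto_intros LIMSEQ_power_zero) simp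
    then show "(\<lambda>n. 1 - C x * 2 * (1/2) ^ n) \<longlonglongrightarrow> 1" by simp
  qed simp
  moreover have "(\<lambda>k. K (x, n) (h k \<otimes> y, m)) \<longlonglongrightarrow> 0" if x: "x \<in> carrier G" and y: "y \<in> carrier G" for x y n m
  proof (cases "n = m")
    case True
    \<comment> \<open>Only indices from \<open>n\<close> on occur in \<open>\<Phi> n\<close>, so
      \<open>k\<close> must have reached \<open>n\<close>. Replacing the endpoints \<open>x\<close>
      and \<open>h k \<otimes> y\<close> by \<open>\<one>\<close> and \<open>h k\<close> costs two
      defects, by the triangle inequality.\<close>
    have bound: "\<Phi> n x (h k \<otimes> y) \<le> (1 + C x + C y) * (1/2) ^ k" if "n \<le> k" for k
    proof -
      have "\<Phi> n x (h k \<otimes> y) \<le> \<tau> k x (h k \<otimes> y)" using \<Phi>_le[of n x "h k \<otimes> y" "k - n"] that by simp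
      also have "\<dots> \<le> \<tau> k \<one> (h k) + (1 - \<tau> k \<one> x) + (1 - \<tau> k (h k \<otimes> y) (h k))"
        using ttri[of k \<one> "h k" x] ttri[of k x "h k" "h k \<otimes> y"] by linarith
      also have "\<tau> k (h k \<otimes> y) (h k) = \<tau> k \<one> y"
        using tinv[OF hG y one_closed, of k k] hG[of k] tsym by simp
      also have "\<tau> k \<one> (h k) + (1 - \<tau> k \<one> x) + (1 - \<tau> k \<one> y) \<le> (1 + C x + C y) * (1/2) ^ k"
        using small[of k] C[OF x, of k] C[OF y, of k] by (simp add: \<tau>_def' algebra_simps)
      finally show ?thesis .
    qed
    have "(\<lambda>k. (1 + C x + C y) * (1/2) ^ k) \<longlonglongrightarrow> (1 + C x + C y) * 0"
      by (intro tendsto_intros LIMSEQ_power_zero) simp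
    then have lim0: "(\<lambda>k. (1 + C x + C y) * (1/2) ^ k) \<longlonglongrightarrow> 0" by simp
    have "0 \<le> \<Phi> n x z" for z using LIMSEQ_le_const[OF \<Phi>] \<Psi>0 by blast
    then have "\<forall>\<^sub>F k in sequentially. 0 \<le> \<Phi> n x (h k \<otimes> y)" by (intro always_eventually allI)
    moreover have "\<forall>\<^sub>F k in sequentially. \<Phi> n x (h k \<otimes> y) \<le> (1 + C x + C y) * (1/2) ^ k"
      by (rule eventually_sequentiallyI[of n]) (rule bound)
    ultimately have "(\<lambda>k. \<Phi> n x (h k \<otimes> y)) \<longlonglongrightarrow> 0"
      by (rule tendsto_sandwich[OF _ _ tendsto_const lim0])
    then show ?thesis using True by (simp add: K_def)
  next
    case False
    then show ?thesis by (simp add: K_def)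
  qed
  ultimately show ?thesis
    using H h univ
    by (intro kernel_not_relative_property_T[of G K H h] is_group countable_carrier)
qed

definition coset_threshold :: "'g set \<Rightarrow> bool" where
  "coset_threshold H \<longleftrightarrow> (\<exists>\<alpha> :: real. \<alpha> < 1 \<and>
      (\<forall>P. invariant_bond_percolation G S P \<and>
           prob_space.expectation P (\<lambda>\<omega>. real (edge_degree \<omega> \<one>)) > \<alpha> * real (edge_degree edges \<one>)
         \<longrightarrow> (\<forall>g\<in>carrier G. (INF h\<in>H. two_point_function P g (g \<otimes> h)) > 0)))"

lemma relative_property_T_imp_threshold:
  assumes T: "relative_property_T TYPE('v) G H" and H: "subgroup H G"
    and univ: "(UNIV :: real set) \<lesssim> (UNIV :: 'v set)" and S: "S \<noteq> {}"
  shows "coset_threshold H"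
proof (rule ccontr)
  assume contra: "\<not> ?thesis"
  have HG: "H \<subseteq> carrier G" using H subgroup.subset by blast
  have Hne: "H \<noteq> {}" using subgroup.one_closed[OF H] by blast
  define d where "d = real (edge_degree edges \<one>)"
  have d: "d \<ge> 1" using S fin_S by (simp add: d_def edge_degree_one_edges Suc_le_eq card_gt_0_iff)
  have "\<exists>P h. invariant_bond_percolation G S P \<and>
      d - prob_space.expectation P (\<lambda>\<omega>. real (edge_degree \<omega> \<one>)) \<le> (1/2) ^ k \<and>
      h \<in> H \<and> two_point_function P \<one> h \<le> (1/2) ^ k" for k :: nat
  proof -
    \<comment> \<open>With this candidate threshold, an expected degree above
      \<open>\<alpha> * d\<close> means a deficit below \<open>(1/2) ^ k\<close>.\<close>
    define \<alpha> where "\<alpha> = 1 - (1/2) ^ k / d"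
    have "\<alpha> < 1" using d by (simp add: \<alpha>_def)
    then obtain P g where P: "invariant_bond_percolation G S P"
      and e: "prob_space.expectation P (\<lambda>\<omega>. real (edge_degree \<omega> \<one>)) > \<alpha> * d"
      and g: "g \<in> carrier G" and i: "\<not> (INF h\<in>H. two_point_function P g (g \<otimes> h)) > 0"
      using contra unfolding d_def coset_threshold_def by blast
    interpret bp: bond_percolation G S P
      by (intro bond_percolation.intro bond_percolation_axioms.intro P cayley_graph_axioms)
    have "\<exists>h\<in>H. two_point_function P g (g \<otimes> h) < (1/2) ^ k"
    proof (rule ccontr)
      assume "\<not> ?thesis"
      then have "(1/2) ^ k \<le> (INF h\<in>H. two_point_function P g (g \<otimes> h))"
        using Hne by (intro cINF_greatest) (auto simp: not_less)
      moreover have "(0 :: real) < (1/2) ^ k" by simp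
      ultimately show False using i by linarith
    qed
    then obtain h where h: "h \<in> H" "two_point_function P g (g \<otimes> h) < (1/2) ^ k" by blast
    have "two_point_function P \<one> h \<le> (1/2) ^ k"
      using h bp.tau_invariant[of g \<one> h] g HG by auto
    moreover have "\<alpha> * d = d - (1/2) ^ k" using d by (simp add: \<alpha>_def field_simps)
    ultimately show ?thesis using P e h(1) by (intro exI[of _ P] exI[of _ h]) auto
  qed
  then obtain P h where "\<And>k :: nat. invariant_bond_percolation G S (P k)"
    "\<And>k. d - prob_space.expectation (P k) (\<lambda>\<omega>. real (edge_degree \<omega> \<one>)) \<le> (1/2) ^ k"
    "\<And>k. h k \<in> H" "\<And>k. two_point_function (P k) \<one> (h k) \<le> (1/2) ^ k"
    by metis
  then have "\<not> relative_property_T TYPE('v) G H"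
    unfolding d_def by (intro threshold_failure_imp_not_relative_property_T[of P H h] HG univ)
  then show False using T by blast
qed

lemma threshold_imp_nonzero_invariant_vector:
  fixes V :: "('v, 'm) inner_module_scheme"
  assumes inf: "infinite (carrier G)" and H: "subgroup H G" and S: "S \<noteq> {}" and \<alpha>: "\<alpha> < 1"
    and thr: "\<And>P. invariant_bond_percolation G S P \<Longrightarrow>
      prob_space.expectation P (\<lambda>\<omega>. real (edge_degree \<omega> \<one>)) > \<alpha> * real (edge_degree edges \<one>) \<Longrightarrow>
      (INF h\<in>H. two_point_function P \<one> h) > 0"
    and rep: "unitary_representation G V \<pi>" and almost: "almost_invariant_vectors G V \<pi>"
  shows "nonzero_invariant_vector H V \<pi>"
proof (rule ccontr)
  assume no: "\<not> nonzero_invariant_vector H V \<pi>"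
  interpret V: complex_hilbert_space V using rep by (simp add: unitary_representation_def)
  interpret A: group_action G "carrier V" \<pi> using rep by (simp add: unitary_representation_def)
  have HG: "H \<subseteq> carrier G" using H subgroup.subset by blast
  define d where "d = real (edge_degree edges \<one>)"
  have d: "d \<ge> 1" using S fin_S by (simp add: d_def edge_degree_one_edges Suc_le_eq card_gt_0_iff)
  \<comment> \<open>Makes the total loss \<open>2 * card S * D\<close> half of the allowed deficit
    \<open>(1 - \<alpha>) * d\<close>, so that the threshold is exceeded strictly.\<close>
  define D where "D = (1 - \<alpha>) * d / (4 * card S)"
  have cS: "real (card S) > 0" using S fin_S by (simp add: card_gt_0_iff)
  then have D: "D > 0" using d \<alpha> by (simp add: D_def)
  \<comment> \<open>The exponent starts at 1, so that the sequence sums to \<open>D\<close>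
    exactly.\<close>
  define \<delta> where "\<delta> = (\<lambda>n. D * (1/2) ^ Suc n)"
  have \<delta>: "0 \<le> \<delta> n" "0 < \<delta> n" for n using D by (simp_all add: \<delta>_def)
  have sums: "\<delta> sums D" using sums_mult[OF power_half_series, of D] by (simp add: \<delta>_def)
  have "\<exists>\<psi>\<in>carrier V. (\<forall>s\<in>S. hnorm V (\<pi> s \<psi> \<ominus>\<^bsub>V\<^esub> \<psi>) \<le> \<delta> n) \<and>
      (\<exists>h\<in>H. real (Suc n) \<le> hnorm V (\<pi> h \<psi> \<ominus>\<^bsub>V\<^esub> \<psi>))" for n
    using \<delta>(2)[of n] by (intro V.almost_invariant_unbounded_vector[OF rep H almost no fin_S S_subset]) auto
  then obtain \<psi> h where \<psi>: "\<And>n. \<psi> n \<in> carrier V" and \<psi>S: "\<And>n s. s \<in> S \<Longrightarrow> hnorm V (\<pi> s (\<psi> n) \<ominus>\<^bsub>V\<^esub> \<psi> n) \<le> \<delta> n"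
    and h: "\<And>n. h n \<in> H" and far: "\<And>n. real (Suc n) \<le> hnorm V (\<pi> (h n) (\<psi> n) \<ominus>\<^bsub>V\<^esub> \<psi> n)"
    unfolding Bex_def by metis
  have hG: "h n \<in> carrier G" for n using h HG by blast
  have cl: "\<pi> g v \<in> carrier V" if "g \<in> carrier G" "v \<in> carrier V" for g v
    using that by (rule A.element_image) simp
  have one: "\<pi> \<one> v = v" if "v \<in> carrier V" for v
    using A.id_eq_one that by (metis restrict_apply')
  define v where "v = (\<lambda>(x, n). \<pi> x (\<psi> n))"
  define K where "K = (\<lambda>p q. Re (ip V (v p) (v q)))"
  have psd: "psd_on (carrier G \<times> UNIV) K"
    unfolding K_def by (rule V.psd_on_ip) (auto simp: v_def cl \<psi>)
  have inv: "K (g \<otimes> x, n) (g \<otimes> y, m) = K (x, n) (y, m)"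
    if "g \<in> carrier G" "x \<in> carrier G" "y \<in> carrier G" for g x y n m
  proof -
    have "\<pi> (g \<otimes> x) (\<psi> n) = \<pi> g (\<pi> x (\<psi> n))" "\<pi> (g \<otimes> y) (\<psi> m) = \<pi> g (\<pi> y (\<psi> m))"
      using A.composition_rule[OF \<psi>] that by simp_all
    moreover have "unitary_operator V (\<pi> g)" using rep that by (simp add: unitary_representation_def)
    ultimately show ?thesis
      using cl[OF that(2) \<psi>] cl[OF that(3) \<psi>] by (simp add: K_def v_def unitary_operator_def)
  qed
  \<comment> \<open>The variance of the increment between \<open>(\<one>, n)\<close> and
    \<open>(x, n)\<close> is the squared displacement of \<open>\<psi> n\<close> by
    \<open>x\<close>; it supplies the cost at the generators as well as the value of
    \<open>\<sigma>\<close>.\<close>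
  have dist: "K (\<one>, n) (\<one>, n) - 2 * K (\<one>, n) (x, n) + K (x, n) (x, n) = (hnorm V (\<pi> x (\<psi> n) \<ominus>\<^bsub>V\<^esub> \<psi> n))\<^sup>2"
    if "x \<in> carrier G" for x n
    using V.hnorm_minus_power2[OF cl[OF that \<psi>] \<psi>, of n n] V.Re_ip_commute[OF cl[OF that \<psi>] \<psi>, of n n]
    by (simp add: K_def v_def one[OF \<psi>])
  have "\<exists>P. invariant_bond_percolation G S P \<and>
      d - prob_space.expectation P (\<lambda>\<omega>. real (edge_degree \<omega> \<one>)) \<le> 2 * card S * D \<and>
      (\<forall>x\<in>carrier G. \<forall>n. \<forall>\<sigma>>0. \<sigma>\<^sup>2 = K (\<one>, n) (\<one>, n) - 2 * K (\<one>, n) (x, n) + K (x, n) (x, n) \<longrightarrow>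
        two_point_function P \<one> x \<le> 1 / \<sigma>)"
    unfolding d_def
  proof (rule percolation_of_kernel[where K = K and \<delta> = \<delta> and D = D, OF inf psd inv \<delta>(1) sums D])
    fix s n assume s: "s \<in> S"
    then have sG: "s \<in> carrier G" using S_subset by auto
    then have "0 \<le> hnorm V (\<pi> s (\<psi> n) \<ominus>\<^bsub>V\<^esub> \<psi> n)" using cl \<psi> by (intro V.hnorm_nonneg) auto
    then show "K (\<one>, n) (\<one>, n) - 2 * K (\<one>, n) (s, n) + K (s, n) (s, n) \<le> (\<delta> n)\<^sup>2"
      unfolding dist[OF sG] using \<psi>S[OF s] by (intro power_mono)
  qed (simp_all add: dist)
  then obtain P where P: "invariant_bond_percolation G S P"
    and deg: "d - prob_space.expectation P (\<lambda>\<omega>. real (edge_degree \<omega> \<one>)) \<le> 2 * card S * D"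
    and bound: "\<And>x n \<sigma>. x \<in> carrier G \<Longrightarrow> \<sigma> > 0 \<Longrightarrow>
      \<sigma>\<^sup>2 = K (\<one>, n) (\<one>, n) - 2 * K (\<one>, n) (x, n) + K (x, n) (x, n) \<Longrightarrow> two_point_function P \<one> x \<le> 1 / \<sigma>"
    by blast
  interpret bp: bond_percolation G S P
    by (intro bond_percolation.intro bond_percolation_axioms.intro P cayley_graph_axioms)
  have "2 * card S * D = (1 - \<alpha>) * d / 2" using cS by (simp add: D_def)
  moreover have "0 < (1 - \<alpha>) * d" using \<alpha> d by simp
  ultimately have "2 * card S * D < (1 - \<alpha>) * d" by linarith
  then have "prob_space.expectation P (\<lambda>\<omega>. real (edge_degree \<omega> \<one>)) > \<alpha> * d"
    using deg by (simp add: algebra_simps)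
  then have pos: "(INF h\<in>H. two_point_function P \<one> h) > 0" using thr[OF P] by (simp add: d_def)
  \<comment> \<open>Coordinate \<open>n\<close> alone bounds the infimum, at the element
    \<open>h n\<close>; letting \<open>n\<close> grow contradicts positivity.\<close>
  have "(INF h\<in>H. two_point_function P \<one> h) \<le> 1 / real (Suc n)" for n
  proof -
    let ?\<sigma> = "hnorm V (\<pi> (h n) (\<psi> n) \<ominus>\<^bsub>V\<^esub> \<psi> n)"
    have \<sigma>: "real (Suc n) \<le> ?\<sigma>" by (rule far)
    have "(INF h\<in>H. two_point_function P \<one> h) \<le> two_point_function P \<one> (h n)"
      using bp.tau_nonneg h by (intro cINF_lower bdd_belowI2)
    also have "\<dots> \<le> 1 / ?\<sigma>"
      using \<sigma> by (intro bound[OF hG, of _ n n] dist[OF hG, symmetric]) auto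
    also have "\<dots> \<le> 1 / real (Suc n)" using \<sigma> by (intro divide_left_mono) auto
    finally show ?thesis .
  qed
  then show False using pos nat_approx_posE by (metis not_le)
qed

lemma threshold_imp_relative_property_T:
  assumes inf: "infinite (carrier G)" and H: "subgroup H G" and S: "S \<noteq> {}"
    and thr: "coset_threshold H"
  shows "relative_property_T TYPE('v) G H"
proof -
  have HG: "H \<subseteq> carrier G" using H subgroup.subset by blast
  obtain \<alpha> :: real where \<alpha>: "\<alpha> < 1" and *: "\<And>P g. invariant_bond_percolation G S P \<Longrightarrow>
      prob_space.expectation P (\<lambda>\<omega>. real (edge_degree \<omega> \<one>)) > \<alpha> * real (edge_degree edges \<one>) \<Longrightarrow>
      g \<in> carrier G \<Longrightarrow> (INF h\<in>H. two_point_function P g (g \<otimes> h)) > 0"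
    using thr unfolding coset_threshold_def by blast
  have "(INF h\<in>H. two_point_function P \<one> h) > 0"
    if "invariant_bond_percolation G S P"
      "prob_space.expectation P (\<lambda>\<omega>. real (edge_degree \<omega> \<one>)) > \<alpha> * real (edge_degree edges \<one>)" for P
  proof -
    have "(\<lambda>h. two_point_function P \<one> (\<one> \<otimes> h)) ` H = (\<lambda>h. two_point_function P \<one> h) ` H"
      using HG by (intro image_cong) auto
    then show ?thesis using *[OF that one_closed] by simp
  qed
  then show ?thesis
    unfolding relative_property_T_def
    using threshold_imp_nonzero_invariant_vector[OF inf H S \<alpha>] by blast
qed

end

theorem theorem4p3:
  fixes G :: "('g, 'b) monoid_scheme" and H S :: "'g set"
  assumes "group G"
    and "infinite (carrier G)"
    and "subgroup H G"
    and "finite S" and "S \<subseteq> carrier G"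
    and "\<And>s. s \<in> S \<Longrightarrow> inv\<^bsub>G\<^esub> s \<in> S"
    and "generate G S = carrier G"
    and universe_large: "(UNIV :: real set) \<lesssim> (UNIV :: 'v set)"
  shows "relative_property_T TYPE('v) G H \<longleftrightarrow>
    (\<exists>\<alpha> :: real. \<alpha> < 1 \<and>
      (\<forall>P. invariant_bond_percolation G S P \<and>
           prob_space.expectation P (\<lambda>\<omega>. real (edge_degree \<omega> \<one>\<^bsub>G\<^esub>))
             > \<alpha> * real (edge_degree (cayley_edges G S) \<one>\<^bsub>G\<^esub>)
         \<longrightarrow> (\<forall>g\<in>carrier G. (INF h\<in>H. two_point_function P g (g \<otimes>\<^bsub>G\<^esub> h)) > 0)))"
proof -
  interpret cayley_graph G S
    using assms by (intro cayley_graph.intro cayley_graph_axioms.intro)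
  have S: "S \<noteq> {}"
  proof
    assume "S = {}"
    then have "carrier G = {\<one>\<^bsub>G\<^esub>}" using S_gen generate_empty by simp
    then show False using assms(2) by simp
  qed
  show ?thesis
    unfolding coset_threshold_def[symmetric]
    using relative_property_T_imp_threshold[OF _ assms(3) universe_large S]
      threshold_imp_relative_property_T[OF assms(2,3) S] by blast
qed

end
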